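(* Let $\Omega \subseteq \mathbb{R}^d$ be a domain, $\rho$ a probability measure on $\Omega$, $P_1\subset P_2\subset\cdots\subset P_r\subset L^2(\Omega,\rho)$ subspaces of finite dimensions $N_1<N_2<\cdots<N_r$, and $\psi_1,\ldots,\psi_{N_r}$ functions such that $\{\psi_1,\ldots,\psi_{N_t}\}$ is a basis of $P_t$ for each $t=1,\ldots,r$. Let $k_1\le k_2\le\cdots\le k_r$ be positive integers and $K\ge N_r$ an integer. Let the grid, matrices, samples and, for $f\in L^\infty(\Omega)$, the approximations $\tilde f^{(t)}$ be generated by Method 2 as described in the context. Suppose that $\gamma,\delta\in(0,1)$, $\gamma_1,\ldots,\gamma_r\in(0,1)$ with $\sum_{t=1}^r\gamma_t=\gamma$, and $$k_t \ge \log(4N_t/\gamma_t)\left((1+\delta)\log(1+\delta)-\delta\right)^{-1},\qquad t=1,\ldots,r,$$ $$K\ge (\mathcal{N}(P_r,\rho))^2\log(2N_r/\gamma)\left((1-\delta)\log(1-\delta)+\delta\right)^{-1},$$ where $\mathcal{N}(P_r,\rho)$ is the smallest constant such that $\|p\|_{L^\infty(\Omega)}\le\mathcal{N}(P_r,\rho)\|p\|_{L^2(\Omega,\rho)}$ for all $p\in P_r$. Then the following holds with probability at least $1-\gamma$. For every $t=1,\ldots,r$: (i) the matrix $\boldsymbol{B}_t$ has full rank, $\mathrm{rank}(\boldsymbol{B}_t)=N_t$; (ii) the condition number of the matrix $\boldsymbol{A}_t$ satisfies $\kappa(\boldsymbol{A}_t)\le\sqrt{\frac{1+\delta}{1-\delta}}$;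 (iii) for any $f\in L^\infty(\Omega)$ the approximation $\tilde f^{(t)}$ is unique and satisfies $$\|f-\tilde f^{(t)}\|_{L^2(\Omega,\rho)}\le\inf_{p\in P_t}\left\{\|f-p\|_{L^2(\Omega,\rho)}+\frac{1}{1-\delta}\max_{i=1,\ldots,K}\frac{|(f-p)(\boldsymbol{z}_i)|}{\sqrt{\frac{K}{N_t}\sum_{l=1}^{N_t}\pi^{(l)}_i}}\right\}.$$
   Context: Functions are complex-valued. Functions in $P_r$ and in $L^\infty(\Omega)$ are regarded as measurable functions defined at every point of $\Omega$, so that point values make sense, and $\|\cdot\|_{L^\infty(\Omega)}$ is the sup norm over $\Omega$. $\kappa$ denotes the condition number with respect to the matrix $2$-norm. Method 2 (one pass): Step 1: draw $\boldsymbol{z}_1,\ldots,\boldsymbol{z}_K$ independently from $\rho$. Step 2: form the $K\times N_r$ matrix $\{\psi_j(\boldsymbol{z}_i)/\sqrt{K}\}_{i,j=1}^{K,N_r}$ and check that it has rank $N_r$. (If not, the method returns to Step 1; statement (i) concerns a single draw, and the subsequent quantities are defined when this matrix has full rank.) Set $N_0=k_0=M_0=0$. Then, successively for $t=1,\ldots,r$: Step 3: form $\boldsymbol{B}_t=\{\psi_j(\boldsymbol{z}_i)/\sqrt{K}\}_{i,j=1}^{K,N_t}\in\mathbb{C}^{K\times N_t}$ and its reduced QR decomposition $\boldsymbol{B}_t=\boldsymbol{Q}\boldsymbol{R}$, where $\boldsymbol{Q}=\{q_{ij}\}\in\mathbb{C}^{K\times N_t}$ satisfies $\boldsymbol{Q}^*\boldsymbol{Q}=\boldsymbol{I}$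 and $\boldsymbol{R}\in\mathbb{C}^{N_t\times N_t}$ is upper triangular (the values $|q_{il}|$, $l\le N_t$, do not change when $t$ is increased). Step 4: for $l=N_{t-1}+1,\ldots,N_t$ define the probability distribution $\pi^{(l)}=\{\pi_i^{(l)}\}_{i=1}^K$ on $\{1,\ldots,K\}$ by $\pi^{(l)}_i=|q_{il}|^2$. Step 5: set $M_t=k_tN_t$. For each $l=1,\ldots,N_{t-1}$ draw $k_t-k_{t-1}$ further integers independently from $\pi^{(l)}$, and for each $l=N_{t-1}+1,\ldots,N_t$ draw $k_t$ integers independently from $\pi^{(l)}$. Together with the integers drawn previously this gives $M_t$ integers $i_1,\ldots,i_{M_t}$ in total ($k_t$ from each $\pi^{(l)}$, $l=1,\ldots,N_t$; all draws are independent given the grid). Step 6: define $$\boldsymbol{A}_t=\left\{\frac{q_{i_j,k}}{\sqrt{\frac{M_t}{N_t}\sum_{l=1}^{N_t}\pi^{(l)}_{i_j}}}\right\}_{j,k=1}^{M_t,N_t}\in\mathbb{C}^{M_t\times N_t},\qquad \boldsymbol{b}=\left\{\frac{f(\boldsymbol{z}_{i_j})}{\sqrt{\frac{M_tK}{N_t}\sum_{l=1}^{N_t}\pi^{(l)}_{i_j}}}\right\}_{j=1}^{M_t}\in\mathbb{C}^{M_t},$$ and let $\boldsymbol{c}^{(t)}\in\operatorname{argmin}_{\boldsymbol{x}\in\mathbb{C}^{N_t}}\|\boldsymbol{A}_t\boldsymbol{x}-\boldsymbol{b}\|_2$. Output: $\tilde f^{(t)}=\sum_{i=1}^{N_t}c^{(t)}_i\phi_i$,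 $t=1,\ldots,r$, where $\phi_i=\sum_{j=1}^i(R^{-\top})_{ij}\psi_j$ (so that $\phi_i(\boldsymbol{z}_k)=\sqrt{K}\,q_{ki}$). Standing assumption: with probability one, for every grid point $\boldsymbol{z}_i$ and every $t$ there exists $p\in P_t$ with $p(\boldsymbol{z}_i)\ne0$ (so that $\sum_{l=1}^{N_t}\pi_i^{(l)}>0$). The probability in the theorem is with respect to the joint draw of the grid and all the sampled integers. *)

theory Defs
  imports
    "HOL-Probability.Probability"
    "HOL-Library.Function_Algebras"
    "Jordan_Normal_Form.DL_Rank"
    "Jordan_Normal_Form.Gauss_Jordan_Elimination"
    "Jordan_Normal_Form.Schur_Decomposition"
begin

text \<open>Conventions. The domain is the space of the measure \<open>\<rho>\<close>, and a complex function on it is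
  represented by a total function whose values outside that space play no role. All matrix and
  vector indices are zero-based: \<open>\<psi> 0, \<dots>, \<psi> (n - 1)\<close> are the basis functions, \<open>z 0, \<dots>, z (K - 1)\<close>
  the grid points, and the sampled integers range over \<open>{..<K}\<close>. The index \<open>t\<close> of the spaces keeps
  its range \<open>1, \<dots>, r\<close>, with \<open>N 0 = k 0 = 0\<close>.\<close>

definition L2_fun :: "'a measure \<Rightarrow> ('a \<Rightarrow> complex) set" where
  "L2_fun \<rho> = {f \<in> borel_measurable \<rho>. integrable \<rho> (\<lambda>x. (cmod (f x))\<^sup>2)}"

definition L2_norm :: "'a measure \<Rightarrow> ('a \<Rightarrow> complex) \<Rightarrow> real" where
  "L2_norm \<rho> f = sqrt (\<integral>x. (cmod (f x))\<^sup>2 \<partial>\<rho>)"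

definition Linf_fun :: "'a measure \<Rightarrow> ('a \<Rightarrow> complex) set" where
  "Linf_fun \<rho> = {f \<in> borel_measurable \<rho>. bounded (f ` space \<rho>)}"

definition Linf_norm :: "'a measure \<Rightarrow> ('a \<Rightarrow> complex) \<Rightarrow> ennreal" where
  "Linf_norm \<rho> f = (SUP x\<in>space \<rho>. ennreal (cmod (f x)))"

text \<open>The smallest constant \<open>C\<close> with \<open>Linf_norm \<rho> p \<le> C * L2_norm \<rho> p\<close> on \<open>P\<close>; it is \<open>\<infinity>\<close> if there
  is no finite one.\<close>

definition nikolskii :: "('a \<Rightarrow> complex) set \<Rightarrow> 'a measure \<Rightarrow> ennreal" where
  "nikolskii P \<rho> = Inf {C. \<forall>p\<in>P. Linf_norm \<rho> p \<le> C * ennreal (L2_norm \<rho> p)}"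

definition L2_subspace :: "'a measure \<Rightarrow> ('a \<Rightarrow> complex) set \<Rightarrow> bool" where
  "L2_subspace \<rho> P \<longleftrightarrow>
     P \<subseteq> L2_fun \<rho> \<and> Modules.module.subspace (\<lambda>(c::complex) p x. c * p x) P"

text \<open>Linear independence is that of \<open>L\<^sup>2\<close>, so an almost everywhere vanishing combination is
  trivial; the spanning condition holds at every point of the domain.\<close>

definition is_basis :: "'a measure \<Rightarrow> (nat \<Rightarrow> 'a \<Rightarrow> complex) \<Rightarrow> nat \<Rightarrow> ('a \<Rightarrow> complex) set \<Rightarrow> bool" where
  "is_basis \<rho> \<psi> n P \<longleftrightarrow>
     (\<forall>j<n. \<psi> j \<in> P) \<and>
     (\<forall>p\<in>P. \<exists>c. \<forall>x\<in>space \<rho>. p x = (\<Sum>j<n. c j * \<psi> j x)) \<and>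
     (\<forall>c. (AE x in \<rho>. (\<Sum>j<n. c j * \<psi> j x) = 0) \<longrightarrow> (\<forall>j<n. c j = 0))"

definition vec_norm2 :: "complex Matrix.vec \<Rightarrow> real" where
  "vec_norm2 v = L2_set (\<lambda>i. cmod (vec_index v i)) {..<dim_vec v}"

definition mat_norm2 :: "complex mat \<Rightarrow> real" where
  "mat_norm2 A = Sup {vec_norm2 (A *\<^sub>v x) | x. x \<in> carrier_vec (dim_col A) \<and> vec_norm2 x \<le> 1}"

definition is_pseudoinverse :: "complex mat \<Rightarrow> complex mat \<Rightarrow> bool" where
  "is_pseudoinverse A X \<longleftrightarrow>
     X \<in> carrier_mat (dim_col A) (dim_row A) \<and>
     A * X * A = A \<and> X * A * X = X \<and>
     mat_adjoint (A * X) = A * X \<and> mat_adjoint (X * A) = X * A"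

definition pseudoinverse :: "complex mat \<Rightarrow> complex mat" where
  "pseudoinverse A = (THE X. is_pseudoinverse A X)"

text \<open>Condition number of a rectangular matrix with respect to the 2-norm; it is \<open>\<infinity>\<close> for a
  rank-deficient matrix.\<close>

definition cond2 :: "complex mat \<Rightarrow> ereal" where
  "cond2 A =
     (if vec_space.rank (dim_row A) A = min (dim_row A) (dim_col A)
      then ereal (mat_norm2 A * mat_norm2 (pseudoinverse A)) else \<infinity>)"

definition is_reduced_QR :: "complex mat \<Rightarrow> complex mat \<Rightarrow> complex mat \<Rightarrow> bool" where
  "is_reduced_QR B Q R \<longleftrightarrow>
     Q \<in> carrier_mat (dim_row B) (dim_col B) \<and>
     R \<in> carrier_mat (dim_col B) (dim_col B) \<and>
     mat_adjoint Q * Q = 1\<^sub>m (dim_col B) \<and> upper_triangular R \<and> B = Q * R"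

definition B_mat :: "(nat \<Rightarrow> 'a \<Rightarrow> complex) \<Rightarrow> nat \<Rightarrow> nat \<Rightarrow> (nat \<Rightarrow> 'a) \<Rightarrow> complex mat" where
  "B_mat \<psi> K n z = Matrix.mat K n (\<lambda>(i, j). \<psi> j (z i) / complex_of_real (sqrt (real K)))"

text \<open>In what follows \<open>Q t\<close> and \<open>R t\<close> are the QR factors computed in pass \<open>t\<close> for a fixed grid.
  The distribution \<open>\<pi>\<^sup>(\<^sup>l\<^sup>)\<close> is formed in the unique pass \<open>t\<close> with \<open>N (t - 1) \<le> l < N t\<close>.\<close>

definition samp_prob :: "(nat \<Rightarrow> nat) \<Rightarrow> (nat \<Rightarrow> complex mat) \<Rightarrow> nat \<Rightarrow> nat \<Rightarrow> real" where
  "samp_prob N Q l i = (cmod (Q (LEAST t. l < N t) $$ (i, l)))\<^sup>2"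

text \<open>The integer \<open>J l m\<close> is the \<open>m\<close>-th draw from \<open>\<pi>\<^sup>(\<^sup>l\<^sup>)\<close>; \<open>drawn N k J t\<close> lists all
  \<open>k t * N t\<close> integers available in pass \<open>t\<close>, in the order in which they are drawn.\<close>

fun drawn :: "(nat \<Rightarrow> nat) \<Rightarrow> (nat \<Rightarrow> nat) \<Rightarrow> (nat \<Rightarrow> nat \<Rightarrow> nat) \<Rightarrow> nat \<Rightarrow> nat list" where
  "drawn N k J 0 = []"
| "drawn N k J (Suc t) = drawn N k J t
     @ concat (map (\<lambda>l. map (J l) [k t..<k (Suc t)]) [0..<N t])
     @ concat (map (\<lambda>l. map (J l) [0..<k (Suc t)]) [N t..<N (Suc t)])"

definition num_samples :: "(nat \<Rightarrow> nat) \<Rightarrow> (nat \<Rightarrow> nat) \<Rightarrow> nat \<Rightarrow> nat" where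
  "num_samples N k t = k t * N t"

definition A_mat ::
  "(nat \<Rightarrow> nat) \<Rightarrow> (nat \<Rightarrow> nat) \<Rightarrow> (nat \<Rightarrow> complex mat) \<Rightarrow> (nat \<Rightarrow> nat \<Rightarrow> nat) \<Rightarrow> nat \<Rightarrow> complex mat"
where
  "A_mat N k Q J t = Matrix.mat (num_samples N k t) (N t) (\<lambda>(j, n).
     let i = drawn N k J t ! j in
     Q t $$ (i, n) / complex_of_real
       (sqrt (real (num_samples N k t) / real (N t) * (\<Sum>l<N t. samp_prob N Q l i))))"

definition b_vec ::
  "nat \<Rightarrow> (nat \<Rightarrow> nat) \<Rightarrow> (nat \<Rightarrow> nat) \<Rightarrow> (nat \<Rightarrow> complex mat) \<Rightarrow> (nat \<Rightarrow> 'a) \<Rightarrow> (nat \<Rightarrow> nat \<Rightarrow> nat)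
     \<Rightarrow> nat \<Rightarrow> ('a \<Rightarrow> complex) \<Rightarrow> complex Matrix.vec"
where
  "b_vec K N k Q z J t f = Matrix.vec (num_samples N k t) (\<lambda>j.
     let i = drawn N k J t ! j in
     f (z i) / complex_of_real
       (sqrt (real (num_samples N k t) * real K / real (N t) * (\<Sum>l<N t. samp_prob N Q l i))))"

definition is_least_squares :: "complex mat \<Rightarrow> complex Matrix.vec \<Rightarrow> complex Matrix.vec \<Rightarrow> bool" where
  "is_least_squares A b c \<longleftrightarrow> c \<in> carrier_vec (dim_col A) \<and>
     (\<forall>x\<in>carrier_vec (dim_col A). vec_norm2 (A *\<^sub>v c - b) \<le> vec_norm2 (A *\<^sub>v x - b))"

definition phi :: "(nat \<Rightarrow> 'a \<Rightarrow> complex) \<Rightarrow> complex mat \<Rightarrow> nat \<Rightarrow> 'a \<Rightarrow> complex" where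
  "phi \<psi> R i x = (\<Sum>j\<le>i. transpose_mat (the (mat_inverse R)) $$ (i, j) * \<psi> j x)"

text \<open>\<open>g\<close> is a possible output of pass \<open>t\<close>, i.e. it comes from some least-squares minimiser.\<close>

definition is_output ::
  "(nat \<Rightarrow> 'a \<Rightarrow> complex) \<Rightarrow> nat \<Rightarrow> (nat \<Rightarrow> nat) \<Rightarrow> (nat \<Rightarrow> nat) \<Rightarrow> (nat \<Rightarrow> complex mat)
     \<Rightarrow> (nat \<Rightarrow> complex mat) \<Rightarrow> (nat \<Rightarrow> 'a) \<Rightarrow> (nat \<Rightarrow> nat \<Rightarrow> nat) \<Rightarrow> nat \<Rightarrow> ('a \<Rightarrow> complex)
     \<Rightarrow> ('a \<Rightarrow> complex) \<Rightarrow> bool"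
where
  "is_output \<psi> K N k Q R z J t f g \<longleftrightarrow>
     (\<exists>c. is_least_squares (A_mat N k Q J t) (b_vec K N k Q z J t f) c \<and>
          g = (\<lambda>x. \<Sum>i<N t. vec_index c i * phi \<psi> (R t) i x))"

definition grid :: "nat \<Rightarrow> (nat \<Rightarrow> 'w \<Rightarrow> 'a) \<Rightarrow> 'w \<Rightarrow> nat \<Rightarrow> 'a" where
  "grid K Z \<omega> = (\<lambda>i\<in>{..<K}. Z i \<omega>)"

text \<open>A deterministic choice, for every grid of full rank, of the QR decompositions used in the
  passes \<open>1, \<dots>, r\<close>. Such a decomposition is unique only up to the phases of the columns of \<open>Q\<close>.\<close>

definition QR_choice ::
  "(nat \<Rightarrow> 'a \<Rightarrow> complex) \<Rightarrow> 'a measure \<Rightarrow> nat \<Rightarrow> (nat \<Rightarrow> nat) \<Rightarrow> nat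
     \<Rightarrow> ((nat \<Rightarrow> 'a) \<Rightarrow> nat \<Rightarrow> complex mat) \<Rightarrow> ((nat \<Rightarrow> 'a) \<Rightarrow> nat \<Rightarrow> complex mat) \<Rightarrow> bool"
where
  "QR_choice \<psi> \<rho> K N r Q R \<longleftrightarrow>
     (\<forall>z \<in> {..<K} \<rightarrow>\<^sub>E space \<rho>. vec_space.rank K (B_mat \<psi> K (N r) z) = N r \<longrightarrow>
        (\<forall>t\<in>{1..r}. is_reduced_QR (B_mat \<psi> K (N t) z) (Q z t) (R z t)))"

text \<open>\<open>Z\<close> is an i.i.d. grid from \<open>\<rho>\<close>. Given a grid of full rank, all the integers \<open>J l m\<close> are
  independent and \<open>J l m\<close> has distribution \<open>\<pi>\<^sup>(\<^sup>l\<^sup>)\<close>: their joint conditional mass function given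
  the sigma-algebra of the grid is the product. Nothing is said about the integers on grids that are
  rank deficient, where the method rejects the grid before drawing them. In total \<open>k r\<close> integers are drawn from
  each \<open>\<pi>\<^sup>(\<^sup>l\<^sup>)\<close>, \<open>l < N r\<close>.\<close>

definition method2_draw ::
  "'w measure \<Rightarrow> (nat \<Rightarrow> 'a \<Rightarrow> complex) \<Rightarrow> 'a measure \<Rightarrow> nat \<Rightarrow> (nat \<Rightarrow> nat) \<Rightarrow> (nat \<Rightarrow> nat) \<Rightarrow> nat
     \<Rightarrow> ((nat \<Rightarrow> 'a) \<Rightarrow> nat \<Rightarrow> complex mat) \<Rightarrow> (nat \<Rightarrow> 'w \<Rightarrow> 'a) \<Rightarrow> (nat \<Rightarrow> nat \<Rightarrow> 'w \<Rightarrow> nat) \<Rightarrow> bool"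
where
  "method2_draw M \<psi> \<rho> K N k r Q Z J \<longleftrightarrow>
     prob_space M \<and>
     prob_space.indep_vars M (\<lambda>_. \<rho>) Z {..<K} \<and>
     (\<forall>i<K. distr M \<rho> (Z i) = \<rho>) \<and>
     (\<forall>l<N r. \<forall>m<k r. J l m \<in> measurable M (count_space UNIV)) \<and>
     (\<forall>a. (\<forall>l<N r. \<forall>m<k r. a l m < K) \<longrightarrow>
        (AE \<omega> in M. vec_space.rank K (B_mat \<psi> K (N r) (grid K Z \<omega>)) = N r \<longrightarrow>
           real_cond_exp M (vimage_algebra (space M) (grid K Z) (\<Pi>\<^sub>M i\<in>{..<K}. \<rho>))
             (indicator {\<omega>' \<in> space M. \<forall>l<N r. \<forall>m<k r. J l m \<omega>' = a l m}) \<omega>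
           = (\<Prod>l<N r. \<Prod>m<k r. samp_prob N (Q (grid K Z \<omega>)) l (a l m))))"

end

theory Submission
  imports Defs "HOL-Real_Asymp.Real_Asymp"
begin

text \<open>The grid and the integers drawn on it are handled by two matrix Chernoff bounds. On the grid the
  summands are identically distributed, so their means are multiples of the identity and the
  Golden--Thompson inequality gives the sharp constant. The integers of one pass come from the
  different distributions \<open>\<pi>\<^sup>(\<^sup>l\<^sup>)\<close>, and only the sum of the means of the matrices
  \<open>q\<^sub>i\<^sup>* q\<^sub>i / (\<Sum>l. \<pi>\<^sup>(\<^sup>l\<^sup>)\<^sub>i)\<close> over \<open>l\<close> is the identity; here Lieb's inequality is needed. Both inequalities are derived from one
  variational formula for the quantum relative entropy, which writes it as an integral of suprema of linear functions.
  When both Chernoff bounds hold, the singular values of \<open>A\<^sub>t\<close> lie between \<open>sqrt (1 - \<delta>)\<close> and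
  \<open>sqrt (1 + \<delta>)\<close>, and the error bound follows by comparing the least-squares solution with the
  coefficients of an arbitrary \<open>p\<close> in \<open>P\<^sub>t\<close>, once for the sampled matrix and once for the grid.\<close>

section \<open>Complex matrices and the spectral theorem\<close>

text \<open>One variational formula serves both inequalities: for fixed s and V the expression
  \<open>dual_form\<close> is linear in the pair of matrices, so its supremum over V is jointly
  convex (Lieb), and admitting only V diagonal in one basis shows that pinching lowers it
  (Golden--Thompson). The integral over s never occurs as an integral; its truncation has a closed
  form, which is differentiated. The constants come from the failure budget. The grid gets
  \<gamma>/2 and needs a lower tail only, whence 2 N_r and the exponent with 1 - \<delta>. Pass t
  gets \<gamma>_t/2, shared by two tails, whence 4 N_t, and the exponent with 1 + \<delta> because
  it is the smaller of the two. The second obstacle is measurability. The QR factors are an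
  arbitrary choice for each grid and may depend on it in a nonmeasurable way, while conditioning on
  the grid needs events in its sigma-algebra. Hence the sampling probabilities are recovered from
  conditional expectations, and the sampling condition is rewritten in terms of \<psi>.\<close>

text \<open>An \<open>n \<times> n\<close> matrix is a function of two indices whose values at indices \<open>\<ge> n\<close> are irrelevant: products
  are then associative without side conditions, and \<open>eqm n\<close> is the appropriate equality.\<close>

type_synonym cmatrix = "nat \<Rightarrow> nat \<Rightarrow> complex"
type_synonym cvector = "nat \<Rightarrow> complex"

definition mm :: "nat \<Rightarrow> cmatrix \<Rightarrow> cmatrix \<Rightarrow> cmatrix" where
  "mm n A B = (\<lambda>i j. \<Sum>k<n. A i k * B k j)"

definition adj :: "cmatrix \<Rightarrow> cmatrix" where
  "adj A = (\<lambda>i j. cnj (A j i))"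

definition tr :: "nat \<Rightarrow> cmatrix \<Rightarrow> complex" where
  "tr n A = (\<Sum>i<n. A i i)"

definition dg :: "cvector \<Rightarrow> cmatrix" where
  "dg d = (\<lambda>i j. if i = j then d i else 0)"

abbreviation idm :: cmatrix where "idm \<equiv> dg (\<lambda>_. 1)"

definition eqm :: "nat \<Rightarrow> cmatrix \<Rightarrow> cmatrix \<Rightarrow> bool" where
  "eqm n A B \<longleftrightarrow> (\<forall>i<n. \<forall>j<n. A i j = B i j)"

definition hermitian :: "nat \<Rightarrow> cmatrix \<Rightarrow> bool" where
  "hermitian n A \<longleftrightarrow> (\<forall>i<n. \<forall>j<n. cnj (A i j) = A j i)"

definition ip :: "nat \<Rightarrow> cvector \<Rightarrow> cvector \<Rightarrow> complex" where
  "ip n u v = (\<Sum>i<n. cnj (u i) * v i)"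

definition mv :: "nat \<Rightarrow> cmatrix \<Rightarrow> cvector \<Rightarrow> cvector" where
  "mv n A v = (\<lambda>i. \<Sum>j<n. A i j * v j)"

definition qf :: "nat \<Rightarrow> cmatrix \<Rightarrow> cvector \<Rightarrow> real" where
  "qf n A u = Re (ip n u (mv n A u))"

definition nsq :: "nat \<Rightarrow> cvector \<Rightarrow> real" where
  "nsq n u = (\<Sum>i<n. (cmod (u i))\<^sup>2)"

definition unitary :: "nat \<Rightarrow> cmatrix \<Rightarrow> bool" where
  "unitary n U \<longleftrightarrow> eqm n (mm n U (adj U)) idm \<and> eqm n (mm n (adj U) U) idm"

definition spec :: "nat \<Rightarrow> cmatrix \<Rightarrow> (nat \<Rightarrow> real) \<Rightarrow> cmatrix \<Rightarrow> bool" where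
  "spec n A l U \<longleftrightarrow> unitary n U \<and> eqm n A (mm n U (mm n (dg (\<lambda>i. of_real (l i))) (adj U)))"

lemma mm_assoc: "mm n (mm n A B) C = mm n A (mm n B C)"
  unfolding mm_def sum_distrib_left sum_distrib_right
  by (intro ext, subst sum.swap) (simp add: mult.assoc)

lemma adj_mm: "adj (mm n A B) = mm n (adj B) (adj A)"
  by (simp add: adj_def mm_def mult.commute)

lemma adj_adj [simp]: "adj (adj A) = A"
  by (simp add: adj_def)

lemma tr_mm_comm: "tr n (mm n A B) = tr n (mm n B A)"
  unfolding tr_def mm_def by (subst sum.swap) (simp add: mult.commute)

lemma tr_cong: "eqm n A B \<Longrightarrow> tr n A = tr n B"
  by (simp add: tr_def eqm_def)

lemma mm_cong: "eqm n A A' \<Longrightarrow> eqm n B B' \<Longrightarrow> eqm n (mm n A B) (mm n A' B')"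
  by (simp add: mm_def eqm_def)

lemma eqm_refl [simp]: "eqm n A A"
  by (simp add: eqm_def)

lemma eqm_sym: "eqm n A B \<Longrightarrow> eqm n B A"
  by (simp add: eqm_def)

lemma eqm_trans [trans]: "eqm n A B \<Longrightarrow> eqm n B C \<Longrightarrow> eqm n A C"
  by (simp add: eqm_def)

lemma mm_dg_left: "i < n \<Longrightarrow> mm n (dg d) A i j = d i * A i j"
  by (simp add: mm_def dg_def if_distrib[of "\<lambda>x. x * _"] cong: if_cong)

lemma mm_dg_right: "j < n \<Longrightarrow> mm n A (dg d) i j = A i j * d j"
  by (simp add: mm_def dg_def if_distrib[of "\<lambda>x. _ * x"] cong: if_cong)

lemma mm_idm_left: "eqm n (mm n idm A) A"
  by (simp add: eqm_def mm_dg_left)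

lemma mm_idm_right: "eqm n (mm n A idm) A"
  by (simp add: eqm_def mm_dg_right)

lemma unitaryD1: "unitary n U \<Longrightarrow> eqm n (mm n U (adj U)) idm"
  and unitaryD2: "unitary n U \<Longrightarrow> eqm n (mm n (adj U) U) idm"
  by (auto simp: unitary_def)

lemma unitary_adj: "unitary n U \<Longrightarrow> unitary n (adj U)"
  by (simp add: unitary_def)

lemma tr_insert_unitary:
  assumes "unitary n W"
  shows "tr n (mm n (adj W) (mm n A W)) = tr n A"
proof -
  have "tr n (mm n (adj W) (mm n A W)) = tr n (mm n A (mm n W (adj W)))"
    by (subst tr_mm_comm) (simp add: mm_assoc)
  also have "\<dots> = tr n (mm n A idm)"
    by (intro tr_cong mm_cong unitaryD1[OF assms] eqm_refl)
  also have "\<dots> = tr n A"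
    by (intro tr_cong mm_idm_right)
  finally show ?thesis .
qed

lemma mm_insert_unitary:
  assumes "unitary n W"
  shows "eqm n (mm n A (mm n W (mm n (adj W) B))) (mm n A B)"
proof -
  have "eqm n (mm n A (mm n W (mm n (adj W) B))) (mm n A (mm n idm B))"
    unfolding mm_assoc[symmetric, of n W]
    by (intro mm_cong unitaryD1[OF assms] eqm_refl)
  also have "eqm n \<dots> (mm n A B)"
    by (intro mm_cong mm_idm_left eqm_refl)
  finally show ?thesis .
qed

section \<open>Inner products and Hermitian forms\<close>

lemma Re_of_real_mult: "Re (of_real r * z) = r * Re z"
  by simp

lemma ip_cnj: "cnj (ip n u v) = ip n v u"
  by (simp add: ip_def mult.commute)

lemma ip_self: "ip n u u = of_real (nsq n u)"
  by (simp add: ip_def nsq_def complex_norm_square mult.commute del: of_real_power)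

lemma nsq_nonneg [simp]: "0 \<le> nsq n u"
  by (simp add: nsq_def sum_nonneg)

lemma hermitianD: "hermitian n A \<Longrightarrow> i < n \<Longrightarrow> j < n \<Longrightarrow> cnj (A i j) = A j i"
  unfolding hermitian_def by simp

lemma ip_mv_hermitian:
  assumes "hermitian n A"
  shows "ip n (mv n A u) v = ip n u (mv n A v)"
proof -
  have "ip n (mv n A u) v = (\<Sum>i<n. \<Sum>j<n. cnj (A i j) * cnj (u j) * v i)"
    by (simp add: ip_def mv_def sum_distrib_right)
  also have "\<dots> = (\<Sum>j<n. \<Sum>i<n. cnj (A i j) * cnj (u j) * v i)"
    by (rule sum.swap)
  also have "\<dots> = (\<Sum>j<n. \<Sum>i<n. cnj (u j) * (A j i * v i))"
    by (intro sum.cong refl) (simp add: hermitianD[OF assms])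
  finally show ?thesis
    by (simp add: ip_def mv_def sum_distrib_left)
qed

lemma ip_add_right: "ip n u (\<lambda>i. v i + w i) = ip n u v + ip n u w"
  and ip_add_left: "ip n (\<lambda>i. v i + w i) u = ip n v u + ip n w u"
  and ip_scale_right: "ip n u (\<lambda>i. c * v i) = c * ip n u v"
  and ip_scale_left: "ip n (\<lambda>i. c * v i) u = cnj c * ip n v u"
  by (simp_all only: ip_def distrib_left distrib_right sum.distrib sum_distrib_left
      complex_cnj_add complex_cnj_mult mult.assoc mult.left_commute)

lemma mv_add: "mv n A (\<lambda>i. v i + w i) = (\<lambda>i. mv n A v i + mv n A w i)"
  and mv_scale: "mv n A (\<lambda>i. c * v i) = (\<lambda>i. c * mv n A v i)"
  by (simp_all only: mv_def distrib_left sum.distrib sum_distrib_left mult.left_commute)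

lemma det_zero_row:
  fixes M :: "complex mat"
  assumes M: "M \<in> carrier_mat n n" and k: "k < n" and r: "Matrix.row M k = 0\<^sub>v n"
  shows "Determinant.det M = 0"
proof -
  have "M = mat\<^sub>r n n (\<lambda>i. if i = k then 0\<^sub>v n else Matrix.row M i)"
    using M r by (intro eq_rowI) auto
  also have "Determinant.det \<dots> = 0"
    by (rule det_row_0[OF k]) (use M in auto)
  finally show ?thesis .
qed

text \<open>Filled up with zero rows, the k conjugated vectors form a singular square matrix, and
  every vector in its kernel is orthogonal to all of them. Vanishing at indices \<ge> n places the
  result in the compact set of \<open>hermitian_qf_maximum\<close>.\<close>

lemma exists_unit_orthogonal:
  fixes u :: "nat \<Rightarrow> cvector"
  assumes "k < n"
  shows "\<exists>v. nsq n v = 1 \<and> (\<forall>i\<ge>n. v i = 0) \<and> (\<forall>a<k. ip n (u a) v = 0)"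
proof -
  define M where "M = Matrix.mat n n (\<lambda>(a, i). if a < k then cnj (u a i) else 0)"
  have M: "M \<in> carrier_mat n n"
    by (simp add: M_def)
  have "Matrix.row M k = 0\<^sub>v n"
    using assms by (auto simp: M_def)
  then have "Determinant.det M = 0"
    using det_zero_row[OF M] assms by blast
  then obtain x where x: "x \<in> carrier_vec n" "x \<noteq> 0\<^sub>v n" "M *\<^sub>v x = 0\<^sub>v n"
    using det_0_iff_vec_prod_zero_field[OF M] by auto
  define y where "y = (\<lambda>i. if i < n then vec_index x i else 0)"
  have orth: "ip n (u a) y = 0" if "a < k" for a
  proof -
    have "vec_index (M *\<^sub>v x) a = 0"
      using x that assms by simp
    then show ?thesis
      using that assms x
      by (simp add: M_def ip_def y_def scalar_prod_def atLeast0LessThan)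
  qed
  have "nsq n y > 0"
  proof -
    obtain i where i: "i < n" "vec_index x i \<noteq> 0"
      using x by (metis carrier_vecD eq_vecI index_zero_vec)
    then have "0 < (cmod (y i))\<^sup>2" by (simp add: y_def)
    also have "\<dots> \<le> nsq n y"
      unfolding nsq_def by (rule member_le_sum) (use i in auto)
    finally show ?thesis .
  qed
  then obtain s where s: "s > 0" "s\<^sup>2 = nsq n y"
    using that[of "sqrt (nsq n y)"] by simp
  define v where "v = (\<lambda>i. of_real (1 / s) * y i)"
  have "nsq n v = (1 / s)\<^sup>2 * nsq n y"
    unfolding nsq_def v_def sum_distrib_left
    by (intro sum.cong refl) (simp add: norm_mult power_mult_distrib norm_divide power_divide)
  then have "nsq n v = 1"
    using s(1) by (simp add: power_divide flip: s(2))
  moreover have "ip n (u a) v = 0" if "a < k" for a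
    using orth[OF that] unfolding v_def ip_scale_right by simp
  moreover have "\<forall>i\<ge>n. v i = 0"
    by (simp add: v_def y_def)
  ultimately show ?thesis by blast
qed

lemma hermitian_qf_maximum:
  fixes u :: "nat \<Rightarrow> cvector"
  assumes "k < n"
  shows "\<exists>v. nsq n v = 1 \<and> (\<forall>a<k. ip n (u a) v = 0) \<and>
    (\<forall>w. (\<forall>a<k. ip n (u a) w = 0) \<longrightarrow> qf n A w \<le> qf n A v * nsq n w)"
proof -
  \<comment> \<open>A \<open>cvector\<close> has infinitely many coordinates. Fixing those with
    index \<ge> n at 0 leaves a product of compact sets, which is compact by Tychonoff.\<close>
  define B :: "(nat \<Rightarrow> complex) set"
    where "B = PiE UNIV (\<lambda>i. if i < n then cball 0 1 else {0})"
  define S where "S = B \<inter> {v. nsq n v = 1 \<and> (\<forall>a<k. ip n (u a) v = 0)}"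
  have coord: "continuous_on UNIV (\<lambda>v::nat \<Rightarrow> complex. v i)" for i
    by (rule continuous_on_product_coordinates)
  have cnsq: "continuous_on UNIV (\<lambda>v. nsq n v)"
    unfolding nsq_def by (intro continuous_intros coord)
  have cip: "continuous_on UNIV (\<lambda>v. ip n (u a) v)" for a
    unfolding ip_def by (intro continuous_intros coord)
  have cqf: "continuous_on UNIV (\<lambda>v. qf n A v)"
    unfolding qf_def ip_def mv_def by (intro continuous_intros coord)
  have "compactin (product_topology (\<lambda>i. euclidean) UNIV) B"
    unfolding B_def compactin_PiE by (auto simp: compactin_euclidean_iff)
  then have cB: "compact B"
    by (simp add: euclidean_product_topology compactin_euclidean_iff)
  have "{v. nsq n v = 1 \<and> (\<forall>a<k. ip n (u a) v = 0)}
      = {v. nsq n v = 1} \<inter> (\<Inter>a\<in>{..<k}. {v. ip n (u a) v = 0})"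
    by auto
  moreover have "closed \<dots>"
    by (intro closed_Int closed_INT ballI closed_Collect_eq cnsq cip continuous_on_const)
  ultimately have "compact S"
    unfolding S_def using cB by (simp add: compact_Int_closed)
  have bnd: "cmod (v i) \<le> 1" if "nsq n v = 1" "i < n" for v i
  proof -
    have "(cmod (v i))\<^sup>2 \<le> nsq n v"
      unfolding nsq_def by (rule member_le_sum) (use that in auto)
    then show ?thesis
      using that by (simp add: power_le_one_iff abs_square_le_1)
  qed
  have inS: "v \<in> S" if "nsq n v = 1" "\<forall>i\<ge>n. v i = 0" "\<forall>a<k. ip n (u a) v = 0" for v
    using that bnd by (auto simp: S_def B_def)
  have "S \<noteq> {}"
    using exists_unit_orthogonal[OF assms, of u] inS by blast
  from continuous_attains_sup[OF \<open>compact S\<close> this continuous_on_subset[OF cqf]]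
  obtain v where v: "v \<in> S" "\<And>w. w \<in> S \<Longrightarrow> qf n A w \<le> qf n A v"
    by auto
  have "qf n A w \<le> qf n A v * nsq n w" if w: "\<forall>a<k. ip n (u a) w = 0" for w
  proof (cases "nsq n w = 0")
    case True
    then have "w i = 0" if "i < n" for i
      using that by (simp add: nsq_def sum_nonneg_eq_0_iff)
    then have "qf n A w = 0"
      by (simp add: qf_def ip_def)
    with True show ?thesis by simp
  next
    case False
    then have "nsq n w > 0" using nsq_nonneg[of n w] by linarith
    then obtain s where s: "s > 0" "s\<^sup>2 = nsq n w"
      using that[of "sqrt (nsq n w)"] by simp
    define x where "x = (\<lambda>i. of_real (1 / s) * (if i < n then w i else 0))"
    have "nsq n x = (1 / s)\<^sup>2 * nsq n w"
      unfolding nsq_def x_def sum_distrib_left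
      by (intro sum.cong refl) (simp add: norm_mult power_mult_distrib norm_divide power_divide)
    then have 1: "nsq n x = 1"
      using s(1) by (simp add: power_divide flip: s(2))
    have "ip n (u a) x = of_real (1 / s) * ip n (u a) w" for a
      unfolding ip_def x_def sum_distrib_left by (intro sum.cong refl) simp
    with w 1 have "x \<in> S"
      by (intro inS) (auto simp: x_def)
    have "ip n x (mv n A x) = of_real (1 / s) * of_real (1 / s) * ip n w (mv n A w)"
      unfolding ip_def x_def mv_def sum_distrib_left sum_distrib_right
      by (intro sum.cong refl) simp
    then have "qf n A x = (1 / s) * (1 / s) * qf n A w"
      unfolding qf_def by (simp only: mult.assoc Re_of_real_mult)
    then have "(1 / s) * (1 / s) * qf n A w \<le> qf n A v"
      using v(2)[OF \<open>x \<in> S\<close>] by simp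
    then show ?thesis
      using s(1) unfolding s(2)[symmetric] by (simp add: field_simps power2_eq_square)
  qed
  with v show ?thesis
    by (auto simp: S_def)
qed

lemma nsq_add:
  "nsq n (\<lambda>i. v i + of_real t * w i) = nsq n v + 2 * t * Re (ip n w v) + t\<^sup>2 * nsq n w"
proof -
  have "complex_of_real (nsq n (\<lambda>i. v i + of_real t * w i)) =
      ip n v v + of_real t * ip n v w + of_real t * ip n w v + of_real t * of_real t * ip n w w"
    unfolding ip_self[symmetric]
    by (simp add: ip_add_right ip_add_left ip_scale_left ip_scale_right algebra_simps)
  from arg_cong[OF this, of Re] show ?thesis
    by (simp add: ip_self power2_eq_square) (simp add: ip_cnj[symmetric, of n v w])
qed

lemma qf_add_hermitian:
  assumes "hermitian n A"
  shows "qf n A (\<lambda>i. v i + of_real t * w i) =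
    qf n A v + 2 * t * Re (ip n w (mv n A v)) + t\<^sup>2 * qf n A w"
proof -
  have "ip n (\<lambda>i. v i + of_real t * w i) (mv n A (\<lambda>i. v i + of_real t * w i)) =
      ip n v (mv n A v) + of_real t * ip n v (mv n A w) + of_real t * ip n w (mv n A v)
        + of_real t * of_real t * ip n w (mv n A w)"
    by (simp add: mv_add mv_scale ip_add_right ip_add_left ip_scale_left ip_scale_right algebra_simps)
  moreover have "Re (ip n v (mv n A w)) = Re (ip n w (mv n A v))"
    using arg_cong[OF ip_cnj[of n w "mv n A v"], of Re] by (simp add: ip_mv_hermitian[OF assms])
  ultimately show ?thesis
    unfolding qf_def by (simp add: power2_eq_square)
qed

text \<open>A maximiser of the quadratic form on the orthogonal complement of earlier eigenvectors is an
  eigenvector, since the form is stationary there.\<close>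

lemma hermitian_eigenvectors:
  assumes A: "hermitian n A" and "k \<le> n"
  shows "\<exists>u (l :: nat \<Rightarrow> real). (\<forall>a<k. \<forall>b<k. ip n (u a) (u b) = (if a = b then 1 else 0)) \<and>
    (\<forall>a<k. \<forall>i<n. mv n A (u a) i = of_real (l a) * u a i)"
  using assms(2)
proof (induction k)
  case 0
  show ?case by simp
next
  case (Suc k)
  then have "k \<le> n" by simp
  from Suc.IH[OF this] obtain u and l :: "nat \<Rightarrow> real"
    where "(\<forall>a<k. \<forall>b<k. ip n (u a) (u b) = (if a = b then 1 else 0)) \<and>
      (\<forall>a<k. \<forall>i<n. mv n A (u a) i = of_real (l a) * u a i)"
    by (elim exE)
  then have orth: "\<And>a b. a < k \<Longrightarrow> b < k \<Longrightarrow> ip n (u a) (u b) = (if a = b then 1 else 0)"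
    and eig: "\<And>a i. a < k \<Longrightarrow> i < n \<Longrightarrow> mv n A (u a) i = of_real (l a) * u a i"
    by blast+
  from hermitian_qf_maximum[of k n u A] Suc.prems
  obtain v where v1: "nsq n v = 1" and vo: "\<And>a. a < k \<Longrightarrow> ip n (u a) v = 0"
    and max: "\<And>w. (\<forall>a<k. ip n (u a) w = 0) \<Longrightarrow> qf n A w \<le> qf n A v * nsq n w"
    by (auto simp: Suc_le_eq)
  define m where "m = qf n A v"
  \<comment> \<open>The residual of the eigenvalue equation for the maximiser v. It is itself
    orthogonal to the earlier eigenvectors, so it is an admissible direction of variation.\<close>
  define w where "w = (\<lambda>i. mv n A v i + of_real (-m) * v i)"
  have wo: "ip n (u a) w = 0" if "a < k" for a
  proof -
    have "ip n (u a) (mv n A v) = ip n (mv n A (u a)) v"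
      by (simp add: ip_mv_hermitian[OF A])
    also have "\<dots> = ip n (\<lambda>i. of_real (l a) * u a i) v"
      unfolding ip_def by (intro sum.cong refl) (simp add: eig[OF that])
    also have "\<dots> = 0"
      by (simp only: ip_scale_left vo[OF that]) simp
    finally show ?thesis
      by (simp only: w_def ip_add_right ip_scale_right vo[OF that]) simp
  qed
  \<comment> \<open>Comparing v with v + t w: since w is the residual, the first-order gain is 2 t
    times \<open>nsq n w\<close>, and maximality bounds it by a term of order t^2.\<close>
  have key: "2 * nsq n w \<le> t * (m * nsq n w - qf n A w)" if "t > 0" for t :: real
  proof -
    have "\<forall>a<k. ip n (u a) (\<lambda>i. v i + of_real t * w i) = 0"
      by (simp add: ip_add_right ip_scale_right vo wo)
    from max[OF this] have le: "m + 2 * t * Re (ip n w (mv n A v)) + t\<^sup>2 * qf n A w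
      \<le> m * (1 + 2 * t * Re (ip n w v) + t\<^sup>2 * nsq n w)"
      unfolding nsq_add qf_add_hermitian[OF A] v1 m_def[symmetric] .
    have "ip n w w = ip n w (mv n A v) + of_real (-m) * ip n w v"
      by (subst (2) w_def) (simp only: ip_add_right ip_scale_right)
    from arg_cong[OF this, of Re] have "Re (ip n w (mv n A v)) = nsq n w + m * Re (ip n w v)"
      by (simp add: ip_self)
    note le = le[unfolded this]
    have "t * (2 * nsq n w) \<le> t * (t * (m * nsq n w - qf n A w))"
      using le by (simp add: algebra_simps power2_eq_square)
    with that show ?thesis
      by (simp only: mult_le_cancel_left_pos)
  qed
  have w0: "nsq n w = 0"
  proof (rule ccontr)
    assume "nsq n w \<noteq> 0"
    then have pos: "nsq n w > 0" using nsq_nonneg[of n w] by linarith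
    define c where "c = m * nsq n w - qf n A w"
    have "c > 0" using key[of 1] pos by (simp add: c_def)
    \<comment> \<open>At this t the estimate reads 2 \<open>nsq n w\<close> \<le>
      \<open>nsq n w\<close>.\<close>
    with key[of "nsq n w / c"] pos show False
      by (simp add: c_def)
  qed
  have vev: "mv n A v i = of_real m * v i" if "i < n" for i
  proof -
    have "w i = 0"
      using w0 that by (simp add: nsq_def sum_nonneg_eq_0_iff)
    then show ?thesis by (simp add: w_def)
  qed
  have vo': "ip n v (u a) = 0" if "a < k" for a
    using vo[OF that] ip_cnj[of n "u a" v] by simp
  show ?case
    by (rule exI[of _ "u(k := v)"], rule exI[of _ "l(k := m)"])
      (auto simp: less_Suc_eq orth eig vev vo vo' ip_self v1)
qed

text \<open>For square matrices a left inverse is a right inverse; this is taken over from the type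
  \<open>mat\<close>.\<close>

lemma orthonormal_imp_unitary:
  assumes "eqm n (mm n (adj U) U) idm"
  shows "unitary n U"
proof -
  let ?m = "\<lambda>A::cmatrix. Matrix.mat n n (\<lambda>(i, j). A i j)"
  have mm: "?m (mm n A B) = ?m A * ?m B" for A B
    by (auto simp: mm_def scalar_prod_def atLeast0LessThan)
  have one: "?m A = 1\<^sub>m n \<longleftrightarrow> eqm n A idm" for A
    by (auto simp: mat_eq_iff eqm_def dg_def)
  have "?m (adj U) * ?m U = 1\<^sub>m n"
    using assms by (simp flip: mm add: one)
  then have "?m U * ?m (adj U) = 1\<^sub>m n"
    by (rule mat_mult_left_right_inverse[rotated 2]) auto
  then show ?thesis
    using assms by (simp flip: mm add: one unitary_def)
qed

theorem spectral_theorem: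
  assumes "hermitian n A"
  shows "\<exists>l U. spec n A l U"
proof -
  from hermitian_eigenvectors[OF assms, of n]
  obtain u l where orth: "\<forall>a<n. \<forall>b<n. ip n (u a) (u b) = (if a = b then 1 else 0)"
    and eig: "\<forall>a<n. \<forall>i<n. mv n A (u a) i = of_real (l a) * u a i"
    by auto
  define U where "U = (\<lambda>i a. u a i)"
  have "eqm n (mm n (adj U) U) idm"
    using orth by (simp add: eqm_def mm_def adj_def U_def ip_def dg_def)
  then have U: "unitary n U"
    by (rule orthonormal_imp_unitary)
  have "eqm n (mm n A U) (mm n U (dg (\<lambda>i. of_real (l i))))"
    using eig by (simp add: eqm_def mm_dg_right) (simp add: mm_def mv_def U_def mult.commute)
  then have "eqm n (mm n A (mm n U (adj U))) (mm n U (mm n (dg (\<lambda>i. of_real (l i))) (adj U)))"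
    unfolding mm_assoc[symmetric] by (rule mm_cong[OF _ eqm_refl])
  moreover have "eqm n (mm n A (mm n U (adj U))) A"
    using mm_cong[OF eqm_refl unitaryD1[OF U], of A] mm_idm_right eqm_trans by blast
  ultimately have "eqm n A (mm n U (mm n (dg (\<lambda>i. of_real (l i))) (adj U)))"
    using eqm_trans eqm_sym by blast
  with U show ?thesis
    unfolding spec_def by blast
qed

section \<open>Traces and quadratic forms in an eigenbasis\<close>

abbreviation (input) column :: "cmatrix \<Rightarrow> nat \<Rightarrow> cvector" where
  "column U k \<equiv> (\<lambda>i. U i k)"

definition rt :: "nat \<Rightarrow> cmatrix \<Rightarrow> cmatrix \<Rightarrow> real" where
  "rt n A B = Re (tr n (mm n A B))"

definition plus_scaled :: "cmatrix \<Rightarrow> real \<Rightarrow> cmatrix \<Rightarrow> cmatrix" where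
  "plus_scaled A t B = (\<lambda>i j. A i j + of_real t * B i j)"

definition combination :: "'a set \<Rightarrow> ('a \<Rightarrow> real) \<Rightarrow> ('a \<Rightarrow> cmatrix) \<Rightarrow> cmatrix" where
  "combination I p X = (\<lambda>i j. \<Sum>x\<in>I. of_real (p x) * X x i j)"

definition spectral :: "nat \<Rightarrow> (nat \<Rightarrow> real) \<Rightarrow> cmatrix \<Rightarrow> cmatrix" where
  "spectral n l U = mm n U (mm n (dg (\<lambda>i. of_real (l i))) (adj U))"

lemma spec_spectral: "unitary n U \<Longrightarrow> spec n (spectral n l U) l U"
  by (simp add: spec_def spectral_def)

lemma specD: "spec n A l U \<Longrightarrow> unitary n U" "spec n A l U \<Longrightarrow> eqm n A (spectral n l U)"
  by (auto simp: spec_def spectral_def)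

lemma rt_comm: "rt n A B = rt n B A"
  unfolding rt_def by (subst tr_mm_comm) simp

lemma rt_cong: "eqm n A A' \<Longrightarrow> eqm n B B' \<Longrightarrow> rt n A B = rt n A' B'"
  unfolding rt_def by (intro arg_cong[of _ _ Re] tr_cong mm_cong)

lemma qf_cong: "eqm n A B \<Longrightarrow> qf n A u = qf n B u"
  by (simp add: qf_def ip_def mv_def eqm_def)

lemma tr_mm_dg: "tr n (mm n (dg d) A) = (\<Sum>i<n. d i * A i i)"
  by (simp add: tr_def mm_dg_left)

lemma conj_unitary_diagonal:
  "mm n (adj U) (mm n B U) k k = ip n (column U k) (mv n B (column U k))"
  by (simp add: mm_def adj_def ip_def mv_def)

text \<open>Cyclicity of the trace conjugates B into the eigenbasis of A, where only its diagonal
  meets the diagonal matrix. Nearly every trace below is evaluated in this way, with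
  \<open>rt_comm\<close> choosing which factor is diagonalised.\<close>

lemma rt_spec:
  assumes "spec n A l U"
  shows "rt n A B = (\<Sum>k<n. l k * qf n B (column U k))"
proof -
  have "rt n A B = rt n (spectral n l U) B"
    by (rule rt_cong[OF specD(2)[OF assms] eqm_refl])
  also have "\<dots> = Re (tr n (mm n (dg (\<lambda>i. of_real (l i))) (mm n (adj U) (mm n B U))))"
    unfolding rt_def spectral_def mm_assoc
    by (subst tr_mm_comm) (simp add: mm_assoc)
  also have "\<dots> = (\<Sum>k<n. l k * qf n B (column U k))"
    by (simp add: tr_mm_dg conj_unitary_diagonal qf_def)
  finally show ?thesis .
qed

lemma spec_scaled_identity:
  "spec n (dg (\<lambda>_. of_real a)) (\<lambda>_. a) idm"
proof -
  have "adj idm = idm"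
    by (auto simp: adj_def dg_def fun_eq_iff)
  then show ?thesis
    using mm_idm_left[of n idm] unfolding spec_def unitary_def
    by (auto simp: eqm_def mm_dg_left mm_dg_right)
qed

lemma qf_idm: "qf n idm u = nsq n u"
proof -
  have "ip n u (mv n idm u) = ip n u u"
    by (simp add: ip_def mv_def dg_def if_distrib[of "\<lambda>x. x * _"] cong: if_cong)
  then show ?thesis by (simp add: qf_def ip_self)
qed

lemma qf_spec:
  assumes "spec n A l U"
  shows "qf n A u = (\<Sum>k<n. l k * (cmod (ip n (column U k) u))\<^sup>2)"
proof -
  have A: "A i j = (\<Sum>k<n. U i k * (of_real (l k) * cnj (U j k)))" if "i < n" "j < n" for i j
    using specD(2)[OF assms] that
    by (simp add: eqm_def spectral_def mm_def[of n U] mm_dg_left) (simp add: adj_def)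
  have "ip n u (mv n A u) = (\<Sum>i<n. \<Sum>j<n. \<Sum>k<n. cnj (u i) * (U i k * (of_real (l k) * cnj (U j k)) * u j))"
    unfolding ip_def mv_def sum_distrib_left
    by (intro sum.cong refl) (simp add: A sum_distrib_left sum_distrib_right)
  also have "\<dots> = (\<Sum>i<n. \<Sum>k<n. \<Sum>j<n. cnj (u i) * (U i k * (of_real (l k) * cnj (U j k)) * u j))"
    by (intro sum.cong refl sum.swap)
  also have "\<dots> = (\<Sum>k<n. \<Sum>i<n. \<Sum>j<n. cnj (u i) * (U i k * (of_real (l k) * cnj (U j k)) * u j))"
    by (rule sum.swap)
  also have "\<dots> = (\<Sum>k<n. of_real (l k) * (cnj (ip n (column U k) u) * ip n (column U k) u))"
    by (intro sum.cong refl, unfold ip_cnj, unfold ip_def sum_product, unfold sum_distrib_left)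
      (intro sum.cong refl, simp)
  also have "\<dots> = of_real (\<Sum>k<n. l k * (cmod (ip n (column U k) u))\<^sup>2)"
    by (simp add: complex_norm_square mult.commute del: of_real_power)
  finally show ?thesis
    by (simp add: qf_def)
qed

text \<open>The identity is \<open>spectral n (\<lambda>_. 1) U\<close> for every unitary U, so this
  is \<open>qf_spec\<close> with all eigenvalues equal to 1.\<close>

lemma parseval:
  assumes "unitary n U"
  shows "(\<Sum>k<n. (cmod (ip n (column U k) u))\<^sup>2) = nsq n u"
proof -
  have "qf n (spectral n (\<lambda>_. 1) U) u = nsq n u"
    unfolding qf_idm[symmetric]
  proof (rule qf_cong)
    have "eqm n (spectral n (\<lambda>_. 1) U) (mm n U (adj U))"
      unfolding spectral_def by (intro mm_cong eqm_refl) (simp add: mm_idm_left)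
    also have "eqm n \<dots> idm"
      by (rule unitaryD1[OF assms])
    finally show "eqm n (spectral n (\<lambda>_. 1) U) idm" .
  qed
  then show ?thesis
    using qf_spec[OF spec_spectral[OF assms, of "\<lambda>_. 1"], of u] by simp
qed

lemma nsq_column:
  assumes "unitary n U" "k < n"
  shows "nsq n (column U k) = 1"
proof -
  have "complex_of_real (nsq n (column U k)) = mm n (adj U) U k k"
    unfolding ip_self[symmetric] by (simp add: ip_def mm_def adj_def)
  also have "\<dots> = 1"
    using unitaryD2[OF assms(1)] assms(2) by (simp add: eqm_def dg_def)
  finally show ?thesis by simp
qed

lemma ip_column_unitary:
  assumes "unitary n U" "k < n" "j < n"
  shows "ip n (column U k) (column U j) = (if k = j then 1 else 0)"
proof -
  have "ip n (column U k) (column U j) = mm n (adj U) U k j"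
    by (simp add: ip_def mm_def adj_def)
  then show ?thesis
    using unitaryD2[OF assms(1)] assms(2,3) by (simp add: eqm_def dg_def)
qed

lemma qf_eigenvector:
  assumes "spec n A l U" "k < n"
  shows "qf n A (column U k) = l k"
proof -
  have "qf n A (column U k) = (\<Sum>j<n. l j * (if j = k then 1 else 0))"
    unfolding qf_spec[OF assms(1)]
    by (intro sum.cong refl) (simp add: ip_column_unitary[OF specD(1)[OF assms(1)]] assms)
  then show ?thesis
    using assms(2) by (simp add: if_distrib[of "\<lambda>x. _ * x"] cong: if_cong)
qed

lemma qf_plus_scaled: "qf n (plus_scaled A t B) u = qf n A u + t * qf n B u"
proof -
  have "ip n u (mv n (plus_scaled A t B) u) = ip n u (mv n A u) + of_real t * ip n u (mv n B u)"
    unfolding ip_def mv_def plus_scaled_def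
    by (simp add: distrib_left distrib_right sum.distrib sum_distrib_left mult.assoc mult.left_commute)
  then show ?thesis by (simp add: qf_def)
qed

lemma qf_combination: "qf n (combination I p X) u = (\<Sum>x\<in>I. p x * qf n (X x) u)"
proof -
  have "ip n u (mv n (combination I p X) u) =
      (\<Sum>i<n. \<Sum>j<n. \<Sum>x\<in>I. cnj (u i) * (of_real (p x) * X x i j * u j))"
    unfolding ip_def mv_def combination_def sum_distrib_left sum_distrib_right ..
  also have "\<dots> = (\<Sum>i<n. \<Sum>x\<in>I. \<Sum>j<n. cnj (u i) * (of_real (p x) * X x i j * u j))"
    by (intro sum.cong refl sum.swap)
  also have "\<dots> = (\<Sum>x\<in>I. \<Sum>i<n. \<Sum>j<n. cnj (u i) * (of_real (p x) * X x i j * u j))"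
    by (rule sum.swap)
  also have "\<dots> = (\<Sum>x\<in>I. of_real (p x) * ip n u (mv n (X x) u))"
    unfolding ip_def mv_def sum_distrib_left
    by (intro sum.cong refl) (simp only: mult.assoc mult.left_commute)
  finally show ?thesis
    by (simp add: qf_def)
qed

lemma hermitian_plus_scaled: "hermitian n A \<Longrightarrow> hermitian n B \<Longrightarrow> hermitian n (plus_scaled A t B)"
  by (simp add: hermitian_def plus_scaled_def)

lemma hermitian_combination: "(\<And>x. x \<in> I \<Longrightarrow> hermitian n (X x)) \<Longrightarrow> hermitian n (combination I p X)"
  by (simp add: hermitian_def combination_def)

lemma hermitian_eqm: "eqm n A B \<Longrightarrow> hermitian n B \<Longrightarrow> hermitian n A"
  by (simp add: hermitian_def eqm_def)

lemma adj_spectral: "adj (spectral n l U) = spectral n l U"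
proof -
  have "adj (dg (\<lambda>i. complex_of_real (l i))) = dg (\<lambda>i. complex_of_real (l i))"
    by (auto simp: adj_def dg_def fun_eq_iff)
  then show ?thesis
    by (simp add: spectral_def adj_mm mm_assoc)
qed

lemma hermitian_spectral: "hermitian n (spectral n l U)"
  unfolding hermitian_def using adj_spectral[of n l U] by (metis adj_def)

lemma spec_hermitian: "spec n A l U \<Longrightarrow> hermitian n A"
  using hermitian_eqm hermitian_spectral specD(2) by blast

definition powm :: "nat \<Rightarrow> cmatrix \<Rightarrow> nat \<Rightarrow> cmatrix" where
  "powm n A m = (mm n A ^^ m) idm"

text \<open>Defined by the power series because it is then measurable in the matrix entries
  (\<open>borel_measurable_trexp\<close>) without any measurable selection of eigenvalues. For
  Hermitian matrices \<open>trexp_spec\<close> gives the spectral formula.\<close>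

definition trexp :: "nat \<Rightarrow> cmatrix \<Rightarrow> real" where
  "trexp n A = (\<Sum>m. Re (tr n (powm n A m)) / fact m)"

lemma tr_powm_spec:
  assumes "spec n A l U"
  shows "tr n (powm n A m) = (\<Sum>k<n. of_real (l k ^ m))"
proof -
  have "eqm n (powm n A m) (spectral n (\<lambda>k. l k ^ m) U)"
  proof (induction m)
    case 0
    have "eqm n (spectral n (\<lambda>k. l k ^ 0) U) (mm n U (adj U))"
      unfolding spectral_def by (intro mm_cong eqm_refl) (simp add: mm_idm_left)
    also have "eqm n \<dots> idm"
      by (rule unitaryD1[OF specD(1)[OF assms]])
    finally show ?case
      by (simp add: powm_def eqm_sym)
  next
    case (Suc m)
    have "eqm n (powm n A (Suc m)) (mm n (spectral n l U) (spectral n (\<lambda>k. l k ^ m) U))"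
      using mm_cong[OF specD(2)[OF assms] Suc] by (simp add: powm_def)
    also have "eqm n \<dots> (mm n U (mm n (dg (\<lambda>k. of_real (l k))) (mm n (dg (\<lambda>k. of_real (l k ^ m))) (adj U))))"
      unfolding spectral_def mm_assoc
      by (rule mm_cong[OF eqm_refl mm_insert_unitary[OF unitary_adj[OF specD(1)[OF assms]],
            unfolded adj_adj]])
    also have "mm n (dg (\<lambda>k. of_real (l k))) (mm n (dg (\<lambda>k. of_real (l k ^ m))) (adj U)) =
        mm n (mm n (dg (\<lambda>k. of_real (l k))) (dg (\<lambda>k. of_real (l k ^ m)))) (adj U)"
      by (simp add: mm_assoc)
    also have "eqm n (mm n U \<dots>) (spectral n (\<lambda>k. l k ^ Suc m) U)"
      unfolding spectral_def
      by (intro mm_cong eqm_refl) (auto simp: eqm_def mm_dg_left, auto simp: dg_def)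
    finally show ?case .
  qed
  then have "tr n (powm n A m) = tr n (spectral n (\<lambda>k. l k ^ m) U)"
    by (rule tr_cong)
  also have "\<dots> = tr n (mm n (dg (\<lambda>k. of_real (l k ^ m))) (mm n (adj U) U))"
    unfolding spectral_def by (subst tr_mm_comm) (simp add: mm_assoc)
  also have "\<dots> = tr n (mm n (dg (\<lambda>k. of_real (l k ^ m))) idm)"
    by (intro tr_cong mm_cong eqm_refl unitaryD2[OF specD(1)[OF assms]])
  also have "\<dots> = (\<Sum>k<n. of_real (l k ^ m))"
    by (simp add: tr_mm_dg) (simp add: dg_def)
  finally show ?thesis .
qed

lemma trexp_spec:
  assumes "spec n A l U"
  shows "trexp n A = (\<Sum>k<n. exp (l k))"
proof -
  have "(\<lambda>m. \<Sum>k<n. l k ^ m / fact m) sums (\<Sum>k<n. exp (l k))"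
    using exp_converges[where 'a = real]
    by (intro sums_sum) (simp add: divide_inverse mult.commute scaleR_conv_of_real)
  moreover have "(\<lambda>m. Re (tr n (powm n A m)) / fact m) = (\<lambda>m. \<Sum>k<n. l k ^ m / fact m)"
    by (simp add: tr_powm_spec[OF assms] sum_divide_distrib fun_eq_iff flip: of_real_power)
  ultimately show ?thesis
    unfolding trexp_def by (metis sums_unique)
qed

section \<open>Relative entropy of positive matrices\<close>

definition kl :: "real \<Rightarrow> real \<Rightarrow> real" where
  "kl a b = a * ln (a / b) - a + b"

text \<open>The integral of s / (1 + s)^2 * ((a - b)^2 / (a + s b)) over s from 0 to S, in closed
  form. Working with the antiderivative replaces an improper integral by a derivative and a
  limit.\<close>

definition kl_trunc :: "real \<Rightarrow> real \<Rightarrow> real \<Rightarrow> real" where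
  "kl_trunc S a b = a * ln (1 + S) + (a - b) / (1 + S) - a * ln (a + S * b) - (a - b) + a * ln a"

lemma kl_trunc_0 [simp]: "kl_trunc 0 a b = 0"
  by (simp add: kl_trunc_def)

lemma kl_trunc_deriv:
  assumes "a > 0" "b > 0" "S \<ge> 0"
  shows "((\<lambda>S. kl_trunc S a b) has_real_derivative S / (1 + S)\<^sup>2 * ((a - b)\<^sup>2 / (a + S * b))) (at S)"
proof -
  have pos: "1 + S > 0" "a + S * b > 0"
    using assms by (auto intro!: add_pos_nonneg)
  have "((\<lambda>S. kl_trunc S a b) has_real_derivative
      a / (1 + S) - (a - b) / (1 + S)\<^sup>2 - a * (b / (a + S * b))) (at S)"
    unfolding kl_trunc_def
    by (rule derivative_eq_intros refl | use pos in simp; fail)+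
      (simp add: power2_eq_square diff_divide_distrib)
  moreover have "a / (1 + S) - (a - b) / (1 + S)\<^sup>2 - a * (b / (a + S * b)) =
      S / (1 + S)\<^sup>2 * ((a - b)\<^sup>2 / (a + S * b))"
  proof -
    \<comment> \<open>The denominators are kept as letters u and v while fractions are combined;
      their values are needed in the numerator only.\<close>
    have "a / u - (a - b) / u\<^sup>2 - a * (b / v) = S / u\<^sup>2 * ((a - b)\<^sup>2 / v)"
      if "u > 0" "v > 0" "u = 1 + S" "v = a + S * b" for u v
    proof -
      have "a / u - (a - b) / u\<^sup>2 - a * (b / v) = (a * u * v - (a - b) * v - a * b * u\<^sup>2) / (u\<^sup>2 * v)"
        using that(1,2) by (simp add: field_simps power2_eq_square)
      also have "a * u * v - (a - b) * v - a * b * u\<^sup>2 = S * (a - b)\<^sup>2"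
        unfolding that(3,4) by (simp add: algebra_simps power2_eq_square)
      finally show ?thesis by simp
    qed
    with pos show ?thesis by blast
  qed
  ultimately show ?thesis by simp
qed

lemma kl_trunc_tendsto:
  assumes "a > 0" "b > 0"
  shows "((\<lambda>S. kl_trunc S a b) \<longlongrightarrow> kl a b) at_top"
proof -
  have "((\<lambda>S. a * ln (1 + S) + (a - b) / (1 + S) - a * ln (a + S * b) - (a - b) + a * ln a)
      \<longlongrightarrow> - a * ln b - (a - b) + a * ln a) at_top"
    using assms by real_asymp
  moreover have "- a * ln b - (a - b) + a * ln a = kl a b"
    using assms by (simp add: kl_def ln_div algebra_simps)
  ultimately show ?thesis
    by (simp add: kl_trunc_def)
qed

text \<open>Everything about \<open>kl\<close> is deduced from the quadratic kernels in its integral representation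
  \<open>kl a b = (\<integral>s>0. s / (1 + s)\<^sup>2 * ((a - b)\<^sup>2 / (a + s * b)))\<close>.\<close>

lemma kl_sum_mono:
  fixes a b w :: "'i \<Rightarrow> real" and a' b' w' :: "'j \<Rightarrow> real"
  assumes pos: "\<And>x. x \<in> T \<Longrightarrow> a x > 0 \<and> b x > 0" "\<And>x. x \<in> T' \<Longrightarrow> a' x > 0 \<and> b' x > 0"
    and le: "\<And>s. s > 0 \<Longrightarrow> (\<Sum>x\<in>T. w x * ((a x - b x)\<^sup>2 / (a x + s * b x)))
      \<le> (\<Sum>x\<in>T'. w' x * ((a' x - b' x)\<^sup>2 / (a' x + s * b' x)))"
  shows "(\<Sum>x\<in>T. w x * kl (a x) (b x)) \<le> (\<Sum>x\<in>T'. w' x * kl (a' x) (b' x))"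
proof -
  \<comment> \<open>The difference of the two sides with the integrals cut off at S. It vanishes at
    0, is nondecreasing because the kernels are ordered for each s, and tends to the difference that
    is to be shown nonnegative.\<close>
  define f where "f S = (\<Sum>x\<in>T'. w' x * kl_trunc S (a' x) (b' x)) - (\<Sum>x\<in>T. w x * kl_trunc S (a x) (b x))" for S
  have lim: "(f \<longlongrightarrow> (\<Sum>x\<in>T'. w' x * kl (a' x) (b' x)) - (\<Sum>x\<in>T. w x * kl (a x) (b x))) at_top"
    unfolding f_def by (intro tendsto_intros kl_trunc_tendsto) (use pos in auto)
  have "f S \<ge> 0" if "S \<ge> 0" for S
  proof -
    have "f 0 \<le> f S"
    proof (rule DERIV_nonneg_imp_nondecreasing[OF that])
      fix s :: real assume s: "0 \<le> s"
      let ?D = "(\<Sum>x\<in>T'. w' x * (s / (1 + s)\<^sup>2 * ((a' x - b' x)\<^sup>2 / (a' x + s * b' x))))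
        - (\<Sum>x\<in>T. w x * (s / (1 + s)\<^sup>2 * ((a x - b x)\<^sup>2 / (a x + s * b x))))"
      have "(f has_real_derivative ?D) (at s)"
        unfolding f_def
        by (intro DERIV_diff DERIV_sum DERIV_cmult kl_trunc_deriv) (use pos s in auto)
      moreover have "?D \<ge> 0"
      proof (cases "s = 0")
        case False
        have "?D = s / (1 + s)\<^sup>2 * ((\<Sum>x\<in>T'. w' x * ((a' x - b' x)\<^sup>2 / (a' x + s * b' x)))
          - (\<Sum>x\<in>T. w x * ((a x - b x)\<^sup>2 / (a x + s * b x))))"
          unfolding right_diff_distrib sum_distrib_left by (simp only: mult.left_commute)
        also have "\<dots> \<ge> 0"
          using le[of s] s False by (intro mult_nonneg_nonneg) auto
        finally show ?thesis .
      qed simp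
      ultimately show "\<exists>y. (f has_real_derivative y) (at s) \<and> 0 \<le> y"
        by blast
    qed
    then show ?thesis by (simp add: f_def)
  qed
  then have "0 \<le> (\<Sum>x\<in>T'. w' x * kl (a' x) (b' x)) - (\<Sum>x\<in>T. w x * kl (a x) (b x))"
    by (intro tendsto_lowerbound[OF lim]) (auto intro: eventually_at_top_linorderI[of 0])
  then show ?thesis by simp
qed

lemma kl_nonneg:
  assumes "a > 0" "b > 0"
  shows "kl a b \<ge> 0"
proof -
  have "ln (b / a) \<le> b / a - 1"
    using assms by (intro ln_le_minus_one) simp
  then have "a * ln (b / a) \<le> a * (b / a - 1)"
    using assms by (intro mult_left_mono) auto
  then show ?thesis
    using assms by (simp add: kl_def ln_div algebra_simps)
qed

section \<open>Relative entropy in two eigenbases and its variational formula\<close>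

definition overlap :: "nat \<Rightarrow> cmatrix \<Rightarrow> cmatrix \<Rightarrow> nat \<Rightarrow> nat \<Rightarrow> real" where
  "overlap n U W i j = (cmod (ip n (column U i) (column W j)))\<^sup>2"

lemma overlap_nonneg [simp]: "0 \<le> overlap n U W i j"
  by (simp add: overlap_def)

lemma overlap_sum_left: "unitary n U \<Longrightarrow> unitary n W \<Longrightarrow> j < n \<Longrightarrow> (\<Sum>i<n. overlap n U W i j) = 1"
  unfolding overlap_def by (simp add: parseval nsq_column)

text \<open>With \<open>overlap_sum_left\<close> this makes the overlaps of two orthonormal bases a
  doubly stochastic matrix.\<close>

lemma overlap_sum_right:
  assumes "unitary n U" "unitary n W" "i < n"
  shows "(\<Sum>j<n. overlap n U W i j) = 1"
proof -
  have "overlap n U W i j = (cmod (ip n (column W j) (column U i)))\<^sup>2" for j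
    unfolding overlap_def by (metis complex_mod_cnj ip_cnj)
  then show ?thesis
    using assms by (simp add: parseval nsq_column)
qed

text \<open>Umegaki's relative entropy tr(Y ln Y - Y ln C - Y + C), where (y, U) and (c, W)
  diagonalise Y and C; \<open>rel_entropy_eq\<close> recovers the trace formula. In this form it is
  a nonnegative combination of scalar divergences, to which \<open>kl_sum_mono\<close>
  applies.\<close>

definition rel_entropy :: "nat \<Rightarrow> (nat \<Rightarrow> real) \<Rightarrow> cmatrix \<Rightarrow> (nat \<Rightarrow> real) \<Rightarrow> cmatrix \<Rightarrow> real" where
  "rel_entropy n y U c W = (\<Sum>i<n. \<Sum>j<n. overlap n U W i j * kl (y i) (c j))"

text \<open>The integrand of \<open>rel_entropy\<close> at s, without the weight s / (1 +
  s)^2.\<close>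

definition kernel :: "nat \<Rightarrow> real \<Rightarrow> (nat \<Rightarrow> real) \<Rightarrow> cmatrix \<Rightarrow> (nat \<Rightarrow> real) \<Rightarrow> cmatrix \<Rightarrow> real" where
  "kernel n s y U c W = (\<Sum>i<n. \<Sum>j<n. overlap n U W i j * ((y i - c j)\<^sup>2 / (y i + s * c j)))"

text \<open>For positive definite Y and C and s > 0 its supremum over all V is
  \<open>kernel\<close>, attained by \<open>dual_form_eq_kernel\<close>. For fixed V it is linear in
  (Y, C), which is the source of all convexity used here.\<close>

definition dual_form :: "nat \<Rightarrow> cmatrix \<Rightarrow> real \<Rightarrow> cmatrix \<Rightarrow> cmatrix \<Rightarrow> real" where
  "dual_form n V s Y C = 2 * rt n (adj V) Y - 2 * rt n (adj V) C
     - rt n Y (mm n V (adj V)) - s * rt n C (mm n (adj V) V)"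

lemma rt_combination: "rt n A (combination I p X) = (\<Sum>x\<in>I. p x * rt n A (X x))"
proof -
  have "tr n (mm n A (combination I p X)) = (\<Sum>i<n. \<Sum>k<n. \<Sum>x\<in>I. A i k * (of_real (p x) * X x k i))"
    unfolding tr_def mm_def combination_def sum_distrib_left ..
  also have "\<dots> = (\<Sum>i<n. \<Sum>x\<in>I. \<Sum>k<n. A i k * (of_real (p x) * X x k i))"
    by (intro sum.cong refl sum.swap)
  also have "\<dots> = (\<Sum>x\<in>I. \<Sum>i<n. \<Sum>k<n. A i k * (of_real (p x) * X x k i))"
    by (rule sum.swap)
  also have "\<dots> = (\<Sum>x\<in>I. of_real (p x) * tr n (mm n A (X x)))"
    unfolding tr_def mm_def sum_distrib_left by (simp only: mult.left_commute)
  finally show ?thesis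
    by (simp add: rt_def)
qed

lemma dual_form_combination:
  assumes "eqm n Y (combination I p Y')" "eqm n C (combination I p C')"
  shows "dual_form n V s Y C = (\<Sum>x\<in>I. p x * dual_form n V s (Y' x) (C' x))"
proof -
  have Y: "rt n A Y = (\<Sum>x\<in>I. p x * rt n A (Y' x))" for A
    using rt_cong[OF eqm_refl assms(1)] by (simp add: rt_combination)
  have C: "rt n A C = (\<Sum>x\<in>I. p x * rt n A (C' x))" for A
    using rt_cong[OF eqm_refl assms(2)] by (simp add: rt_combination)
  show ?thesis
    unfolding dual_form_def rt_comm[of n Y] rt_comm[of n C] Y C
      rt_comm[of n "Y' _" "mm n V _"] rt_comm[of n "C' _" "mm n _ V"]
    by (simp add: sum_distrib_left sum_subtractf algebra_simps)
qed

lemma rt_sandwich: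
  "Re (tr n (mm n (adj v) (mm n (dg (\<lambda>i. of_real (d i))) w))) =
    (\<Sum>i<n. \<Sum>j<n. d i * Re (cnj (v i j) * w i j))"
proof -
  have "tr n (mm n (adj v) (mm n (dg (\<lambda>i. of_real (d i))) w)) =
      (\<Sum>j<n. \<Sum>i<n. cnj (v i j) * (of_real (d i) * w i j))"
    unfolding tr_def mm_def[of n "adj v"]
    by (intro sum.cong refl) (simp add: mm_dg_left adj_def)
  also have "\<dots> = (\<Sum>i<n. \<Sum>j<n. cnj (v i j) * (of_real (d i) * w i j))"
    by (rule sum.swap)
  finally show ?thesis
    by (simp add: algebra_simps sum_distrib_left)
qed

text \<open>In the mixed coordinates v, with rows in the eigenbasis of Y and columns in that of C, Y
  acts on the row index and C on the column index. The form therefore splits into one scalar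
  quadratic for each pair (i, j), although Y and C need not commute.\<close>

lemma dual_form_spec:
  fixes V U W :: cmatrix
  assumes Y: "spec n Y y U" and C: "spec n C c W"
  defines "v \<equiv> mm n (adj U) (mm n V W)" and "o' \<equiv> mm n (adj U) W"
  shows "dual_form n V s Y C = (\<Sum>i<n. \<Sum>j<n.
    2 * (y i - c j) * Re (cnj (v i j) * o' i j) - (y i + s * c j) * (cmod (v i j))\<^sup>2)"
proof -
  note U = specD(1)[OF Y] and W = specD(1)[OF C]
  let ?y = "dg (\<lambda>i. complex_of_real (y i))" and ?c = "dg (\<lambda>i. complex_of_real (c i))"
  have sq: "Re (cnj z * z) = (cmod z)\<^sup>2" for z
    by (metis complex_norm_square mult.commute Re_complex_of_real)
  have adjv: "adj v = mm n (adj W) (mm n (adj V) U)"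
    by (simp add: v_def adj_mm mm_assoc)
  have 1: "rt n (adj V) Y = (\<Sum>i<n. \<Sum>j<n. y i * Re (cnj (v i j) * o' i j))"
  proof -
    have "rt n (adj V) Y = Re (tr n (mm n (adj V) (spectral n y U)))"
      unfolding rt_def[symmetric] by (rule rt_cong[OF eqm_refl specD(2)[OF Y]])
    also have "\<dots> = Re (tr n (mm n (adj W) (mm n (mm n (adj V) (spectral n y U)) W)))"
      by (simp add: tr_insert_unitary[OF W])
    also have "\<dots> = Re (tr n (mm n (adj v) (mm n ?y o')))"
      by (simp add: adjv spectral_def o'_def mm_assoc)
    finally show ?thesis unfolding rt_sandwich .
  qed
  have 2: "rt n (adj V) C = (\<Sum>i<n. \<Sum>j<n. c j * Re (cnj (v i j) * o' i j))"
  proof -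
    have "rt n (adj V) C = Re (tr n (mm n (adj V) (mm n W (mm n ?c (adj W)))))"
      unfolding rt_def[symmetric] by (rule rt_cong[OF eqm_refl specD(2)[OF C, unfolded spectral_def]])
    also have "\<dots> = Re (tr n (mm n (adj W) (mm n (adj V) (mm n W ?c))))"
      by (subst (2) tr_mm_comm) (simp add: mm_assoc)
    \<comment> \<open>Inserting U times its adjoint creates the factors \<open>adj v\<close> and
      \<open>o'\<close>; the same insertion is used for the last of the four terms.\<close>
    also have "\<dots> = Re (tr n (mm n (mm n (adj W) (adj V)) (mm n U (mm n (adj U) (mm n W ?c)))))"
      unfolding mm_assoc[symmetric, of n "adj W"]
      by (intro arg_cong[of _ _ Re] tr_cong eqm_sym[OF mm_insert_unitary[OF U]])
    also have "\<dots> = Re (tr n (mm n (mm n (adj v) o') ?c))"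
      by (simp add: adjv o'_def mm_assoc)
    also have "\<dots> = Re (tr n (mm n ?c (mm n (adj v) o')))"
      by (subst tr_mm_comm) simp
    also have "\<dots> = (\<Sum>j<n. \<Sum>i<n. c j * Re (cnj (v i j) * o' i j))"
      unfolding tr_mm_dg by (simp add: mm_def adj_def sum_distrib_left)
    finally show ?thesis by (subst (asm) sum.swap)
  qed
  have 3: "rt n Y (mm n V (adj V)) = (\<Sum>i<n. \<Sum>j<n. y i * (cmod (v i j))\<^sup>2)"
  proof -
    have "rt n Y (mm n V (adj V)) = Re (tr n (mm n (spectral n y U) (mm n V (adj V))))"
      unfolding rt_def[symmetric] by (rule rt_cong[OF specD(2)[OF Y] eqm_refl])
    also have "\<dots> = Re (tr n (mm n (adj V) (mm n (spectral n y U) V)))"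
      by (subst (2) tr_mm_comm) (simp add: mm_assoc)
    also have "\<dots> = Re (tr n (mm n (adj W) (mm n (mm n (adj V) (mm n (spectral n y U) V)) W)))"
      by (simp add: tr_insert_unitary[OF W])
    also have "\<dots> = Re (tr n (mm n (adj v) (mm n ?y v)))"
      unfolding adjv spectral_def mm_assoc by (simp add: v_def mm_assoc)
    finally show ?thesis unfolding rt_sandwich sq .
  qed
  have 4: "rt n C (mm n (adj V) V) = (\<Sum>i<n. \<Sum>j<n. c j * (cmod (v i j))\<^sup>2)"
  proof -
    have "rt n C (mm n (adj V) V) = Re (tr n (mm n (mm n W (mm n ?c (adj W))) (mm n (adj V) V)))"
      unfolding rt_def[symmetric] by (rule rt_cong[OF specD(2)[OF C, unfolded spectral_def] eqm_refl])
    also have "\<dots> = Re (tr n (mm n (mm n ?c (mm n (adj W) (adj V))) (mm n V W)))"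
      unfolding mm_assoc by (subst (1) tr_mm_comm) (simp add: mm_assoc)
    also have "\<dots> = Re (tr n (mm n (mm n ?c (mm n (adj W) (adj V))) (mm n U (mm n (adj U) (mm n V W)))))"
      by (intro arg_cong[of _ _ Re] tr_cong eqm_sym[OF mm_insert_unitary[OF U]])
    also have "\<dots> = Re (tr n (mm n ?c (mm n (adj v) v)))"
      unfolding adjv mm_assoc by (simp add: v_def mm_assoc)
    also have "\<dots> = (\<Sum>j<n. \<Sum>i<n. c j * (cmod (v i j))\<^sup>2)"
      unfolding tr_mm_dg sq[symmetric] by (simp add: mm_def adj_def sum_distrib_left)
    finally show ?thesis by (subst (asm) sum.swap)
  qed
  show ?thesis
    unfolding dual_form_def 1 2 3 4
    by (simp only: sum_distrib_left sum_subtractf[symmetric]) (simp add: algebra_simps)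
qed

text \<open>The two sides differ by D times the squared distance of v from (m / D) w, which yields
  both the bound and its equality case.\<close>

lemma complete_square:
  fixes v w :: complex
  assumes "D > 0"
  shows "2 * m * Re (cnj v * w) - D * (cmod v)\<^sup>2 \<le> (cmod w)\<^sup>2 * (m\<^sup>2 / D)"
    and "v = of_real (m / D) * w \<Longrightarrow>
      2 * m * Re (cnj v * w) - D * (cmod v)\<^sup>2 = (cmod w)\<^sup>2 * (m\<^sup>2 / D)"
proof -
  have eq: "(cmod w)\<^sup>2 * (m\<^sup>2 / D) - (2 * m * Re (cnj v * w) - D * (cmod v)\<^sup>2) =
      D * (cmod (v - of_real (m / D) * w))\<^sup>2"
  proof -
    define r where "r = m / D"
    have m: "m = D * r" and "m\<^sup>2 / D = D * r\<^sup>2"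
      using assms by (auto simp: r_def power2_eq_square)
    then show ?thesis
      unfolding r_def[symmetric] cmod_power2 by (simp add: algebra_simps power2_eq_square)
  qed
  then have "(cmod w)\<^sup>2 * (m\<^sup>2 / D) - (2 * m * Re (cnj v * w) - D * (cmod v)\<^sup>2) \<ge> 0"
    using assms by simp
  then show "2 * m * Re (cnj v * w) - D * (cmod v)\<^sup>2 \<le> (cmod w)\<^sup>2 * (m\<^sup>2 / D)"
    by simp
  show "2 * m * Re (cnj v * w) - D * (cmod v)\<^sup>2 = (cmod w)\<^sup>2 * (m\<^sup>2 / D)"
    if "v = of_real (m / D) * w"
    using eq that by simp
qed

lemma overlap_mm: "overlap n U W i j = (cmod (mm n (adj U) W i j))\<^sup>2"
  by (simp add: overlap_def ip_def mm_def adj_def)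

lemma dual_form_le_kernel:
  assumes "spec n Y y U" "spec n C c W" "\<And>i. i < n \<Longrightarrow> y i > 0" "\<And>i. i < n \<Longrightarrow> c i > 0" "s > 0"
  shows "dual_form n V s Y C \<le> kernel n s y U c W"
  unfolding dual_form_spec[OF assms(1,2)] kernel_def overlap_mm
  by (intro sum_mono complete_square) (use assms in \<open>auto intro!: add_pos_pos\<close>)

text \<open>As the form decouples over the entries of v, all entries can be optimal at once;
  changing the bases back gives the maximising V.\<close>

lemma dual_form_eq_kernel:
  assumes "spec n Y y U" "spec n C c W" "\<And>i. i < n \<Longrightarrow> y i > 0" "\<And>i. i < n \<Longrightarrow> c i > 0" "s > 0"
  shows "\<exists>V. dual_form n V s Y C = kernel n s y U c W"
proof -
  note U = specD(1)[OF assms(1)] and W = specD(1)[OF assms(2)]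
  define v where "v = (\<lambda>i j. of_real ((y i - c j) / (y i + s * c j)) * mm n (adj U) W i j)"
  define V where "V = mm n U (mm n v (adj W))"
  have "eqm n (mm n (adj U) (mm n V W)) (mm n (mm n (adj U) U) (mm n v (mm n (adj W) W)))"
    by (simp add: V_def mm_assoc)
  also have "eqm n \<dots> (mm n idm (mm n v idm))"
    by (intro mm_cong unitaryD2 U W eqm_refl)
  also have "eqm n \<dots> (mm n v idm)"
    by (rule mm_idm_left)
  also have "eqm n \<dots> v"
    by (rule mm_idm_right)
  finally have v: "mm n (adj U) (mm n V W) i j = v i j" if "i < n" "j < n" for i j
    using that by (simp add: eqm_def)
  have "dual_form n V s Y C = kernel n s y U c W"
    unfolding dual_form_spec[OF assms(1,2)] kernel_def overlap_mm
    by (intro sum.cong refl complete_square(2), use assms in \<open>auto intro!: add_pos_pos\<close>)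
      (simp add: v, simp add: v_def)
  then show ?thesis by (rule exI[of _ V])
qed

lemma rel_entropy_prod:
  "rel_entropy n y U c W = (\<Sum>(i, j)\<in>{..<n}\<times>{..<n}. overlap n U W i j * kl (y i) (c j))"
  by (simp add: rel_entropy_def sum.cartesian_product)

lemma kernel_prod:
  "kernel n s y U c W = (\<Sum>(i, j)\<in>{..<n}\<times>{..<n}. overlap n U W i j * ((y i - c j)\<^sup>2 / (y i + s * c j)))"
  by (simp add: kernel_def sum.cartesian_product)

text \<open>Take V optimal for the averaged pair. By linearity the form at V is the average of the
  forms of the individual pairs, and each of these is at most its own kernel. This holds for every s
  > 0, so \<open>kl_sum_mono\<close> carries it over to the entropy.\<close>

theorem rel_entropy_jointly_convex:
  assumes Y: "spec n Y y U" "\<And>i. i < n \<Longrightarrow> y i > 0" and C: "spec n C c W" "\<And>i. i < n \<Longrightarrow> c i > 0"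
    and Y': "\<And>x. x \<in> I \<Longrightarrow> spec n (Y' x) (y' x) (U' x)" "\<And>x i. x \<in> I \<Longrightarrow> i < n \<Longrightarrow> y' x i > 0"
    and C': "\<And>x. x \<in> I \<Longrightarrow> spec n (C' x) (c' x) (W' x)" "\<And>x i. x \<in> I \<Longrightarrow> i < n \<Longrightarrow> c' x i > 0"
    and p: "\<And>x. x \<in> I \<Longrightarrow> p x \<ge> 0"
    and eq: "eqm n Y (combination I p Y')" "eqm n C (combination I p C')"
  shows "rel_entropy n y U c W \<le> (\<Sum>x\<in>I. p x * rel_entropy n (y' x) (U' x) (c' x) (W' x))"
proof -
  let ?T = "{..<n} \<times> {..<n}"
  have ker: "kernel n s y U c W \<le> (\<Sum>x\<in>I. p x * kernel n s (y' x) (U' x) (c' x) (W' x))" if s: "s > 0" for s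
  proof -
    obtain V where V: "dual_form n V s Y C = kernel n s y U c W"
      using dual_form_eq_kernel[OF Y(1) C(1) Y(2) C(2) s] by blast
    show ?thesis
      unfolding V[symmetric] dual_form_combination[OF eq]
      by (intro sum_mono mult_left_mono dual_form_le_kernel p Y' C' s)
  qed
  \<comment> \<open>Both sides are written as single sums over tuples, the right one with weight p
    times overlap, to match \<open>kl_sum_mono\<close>.\<close>
  have "(\<Sum>t\<in>?T. overlap n U W (fst t) (snd t) * kl (y (fst t)) (c (snd t))) \<le>
    (\<Sum>t\<in>I \<times> ?T. p (fst t) * overlap n (U' (fst t)) (W' (fst t)) (fst (snd t)) (snd (snd t)) *
      kl (y' (fst t) (fst (snd t))) (c' (fst t) (snd (snd t))))"
  proof (rule kl_sum_mono)
    fix s :: real assume "s > 0"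
    from ker[OF this] show "(\<Sum>t\<in>?T. overlap n U W (fst t) (snd t) *
        ((y (fst t) - c (snd t))\<^sup>2 / (y (fst t) + s * c (snd t)))) \<le>
      (\<Sum>t\<in>I \<times> ?T. p (fst t) * overlap n (U' (fst t)) (W' (fst t)) (fst (snd t)) (snd (snd t)) *
      ((y' (fst t) (fst (snd t)) - c' (fst t) (snd (snd t)))\<^sup>2 /
        (y' (fst t) (fst (snd t)) + s * c' (fst t) (snd (snd t)))))"
      by (simp add: kernel_prod sum_distrib_left sum.cartesian_product split_def mult.assoc)
  qed (use Y(2) C(2) Y'(2) C'(2) in auto)
  then show ?thesis
    by (simp add: rel_entropy_prod sum_distrib_left sum.cartesian_product split_def mult.assoc)
qed

text \<open>Restricting the supremum to Hermitian V diagonal in E can only lower it. Such V see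
  nothing but the diagonals of Y and C in the basis E, and the restricted supremum is the kernel of
  these two families of scalars.\<close>

theorem rel_entropy_pinching:
  assumes Y: "spec n Y y U" "\<And>i. i < n \<Longrightarrow> y i > 0" and C: "spec n C c W" "\<And>i. i < n \<Longrightarrow> c i > 0"
    and E: "unitary n E"
    and pos: "\<And>i. i < n \<Longrightarrow> qf n Y (column E i) > 0" "\<And>i. i < n \<Longrightarrow> qf n C (column E i) > 0"
  shows "(\<Sum>i<n. kl (qf n Y (column E i)) (qf n C (column E i))) \<le> rel_entropy n y U c W"
proof -
  let ?T = "{..<n} \<times> {..<n}"
  let ?y = "\<lambda>i. qf n Y (column E i)" and ?c = "\<lambda>i. qf n C (column E i)"
  have ker: "(\<Sum>i<n. (?y i - ?c i)\<^sup>2 / (?y i + s * ?c i)) \<le> kernel n s y U c W" if s: "s > 0" for s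
  proof -
    \<comment> \<open>The maximiser of the scalar quadratic 2 t (y - c) - t^2 (y + s c) for each
      i.\<close>
    define t where "t i = (?y i - ?c i) / (?y i + s * ?c i)" for i
    let ?V = "spectral n t E"
    have V: "spec n ?V t E"
      by (rule spec_spectral[OF E])
    have adjV: "adj ?V = ?V"
      by (rule adj_spectral)
    have "eqm n (mm n ?V ?V) (mm n E (mm n (dg (\<lambda>i. of_real (t i))) (mm n (dg (\<lambda>i. of_real (t i))) (adj E))))"
      unfolding spectral_def mm_assoc
      by (rule mm_cong[OF eqm_refl mm_insert_unitary[OF unitary_adj[OF E], unfolded adj_adj]])
    also have "\<dots> = mm n E (mm n (mm n (dg (\<lambda>i. of_real (t i))) (dg (\<lambda>i. of_real (t i)))) (adj E))"
      by (simp add: mm_assoc)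
    also have "eqm n \<dots> (spectral n (\<lambda>i. (t i)\<^sup>2) E)"
      unfolding spectral_def
      by (intro mm_cong eqm_refl) (auto simp: eqm_def mm_dg_left, auto simp: dg_def power2_eq_square)
    finally have VV: "spec n (mm n ?V ?V) (\<lambda>i. (t i)\<^sup>2) E"
      using E by (simp add: spec_def spectral_def)
    have "dual_form n ?V s Y C = (\<Sum>i<n. 2 * t i * (?y i - ?c i) - (t i)\<^sup>2 * (?y i + s * ?c i))"
      unfolding dual_form_def adjV rt_comm[of n Y] rt_comm[of n C] rt_spec[OF V] rt_spec[OF VV]
      by (simp only: sum_distrib_left sum_subtractf[symmetric]) (simp add: algebra_simps)
    also have "\<dots> = (\<Sum>i<n. (?y i - ?c i)\<^sup>2 / (?y i + s * ?c i))"
    proof (intro sum.cong refl)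
      fix i assume "i \<in> {..<n}"
      then have D: "?y i + s * ?c i > 0"
        using pos s by (auto intro!: add_pos_pos)
      have "2 * (m / d) * m - (m / d)\<^sup>2 * d = m\<^sup>2 / d" if "d > 0" for m d :: real
        using that by (simp add: field_simps power2_eq_square)
      from this[OF D] show "2 * t i * (?y i - ?c i) - (t i)\<^sup>2 * (?y i + s * ?c i) =
          (?y i - ?c i)\<^sup>2 / (?y i + s * ?c i)"
        unfolding t_def by blast
    qed
    finally show ?thesis
      using dual_form_le_kernel[OF Y(1) C(1) Y(2) C(2) s, of ?V] by simp
  qed
  have "(\<Sum>i<n. 1 * kl (?y i) (?c i)) \<le>
    (\<Sum>t\<in>?T. overlap n U W (fst t) (snd t) * kl (y (fst t)) (c (snd t)))"
  proof (rule kl_sum_mono)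
    fix s :: real assume "s > 0"
    from ker[OF this] show "(\<Sum>i<n. 1 * ((?y i - ?c i)\<^sup>2 / (?y i + s * ?c i))) \<le>
       (\<Sum>t\<in>?T. overlap n U W (fst t) (snd t) *
        ((y (fst t) - c (snd t))\<^sup>2 / (y (fst t) + s * c (snd t))))"
      by (simp add: kernel_prod split_def)
  qed (use Y(2) C(2) pos in auto)
  then show ?thesis
    by (simp add: rel_entropy_prod split_def)
qed

text \<open>After splitting the logarithm of the quotient, double stochasticity sums out one index
  in every term except the cross term, which is tr(Y ln C) by \<open>qf_spec\<close>.\<close>

lemma rel_entropy_eq:
  assumes Y: "spec n Y y U" "\<And>i. i < n \<Longrightarrow> y i > 0" and C: "spec n C c W" "\<And>i. i < n \<Longrightarrow> c i > 0"
  shows "rel_entropy n y U c W =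
    (\<Sum>i<n. y i * ln (y i)) - (\<Sum>j<n. ln (c j) * qf n Y (column W j)) - (\<Sum>i<n. y i) + (\<Sum>j<n. c j)"
proof -
  note U = specD(1)[OF Y(1)] and W = specD(1)[OF C(1)]
  let ?o = "overlap n U W"
  have "rel_entropy n y U c W = (\<Sum>i<n. \<Sum>j<n. ?o i j * (y i * ln (y i) - y i)
      - ln (c j) * (y i * ?o i j) + ?o i j * c j)"
    unfolding rel_entropy_def kl_def
    by (intro sum.cong refl) (simp add: ln_div Y(2) C(2) less_imp_neq[symmetric] algebra_simps)
  also have "\<dots> = (\<Sum>i<n. \<Sum>j<n. ?o i j * (y i * ln (y i) - y i))
      - (\<Sum>j<n. \<Sum>i<n. ln (c j) * (y i * ?o i j)) + (\<Sum>j<n. \<Sum>i<n. ?o i j * c j)"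
    by (simp only: sum.distrib sum_subtractf, subst (2) sum.swap, subst (3) sum.swap) (rule refl)
  also have "\<dots> = (\<Sum>i<n. y i * ln (y i) - y i) - (\<Sum>j<n. ln (c j) * qf n Y (column W j)) + (\<Sum>j<n. c j)"
    using U W
    by (simp add: overlap_sum_left overlap_sum_right qf_spec[OF Y(1)] overlap_def[symmetric]
        flip: sum_distrib_left sum_distrib_right)
  finally show ?thesis
    by (simp add: sum_subtractf)
qed

section \<open>Lieb's inequality and the Golden--Thompson inequality\<close>

definition contraction :: "nat \<Rightarrow> cmatrix \<Rightarrow> bool" where
  "contraction n X \<longleftrightarrow> hermitian n X \<and> (\<forall>u. 0 \<le> qf n X u \<and> qf n X u \<le> nsq n u)"

lemma exp_chord:
  fixes \<theta> x :: real
  assumes "0 \<le> x" "x \<le> 1"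
  shows "exp (\<theta> * x) \<le> 1 + (exp \<theta> - 1) * x"
  using convex_onD[OF convex_on_exp[OF zero_le_one], of x 0 \<theta>] assms by (simp add: algebra_simps)

lemma weighted_sum_pos:
  fixes p h :: "'i \<Rightarrow> real"
  assumes "\<And>x. x \<in> I \<Longrightarrow> p x \<ge> 0" "sum p I = 1" "\<And>x. x \<in> I \<Longrightarrow> h x > 0"
  shows "(\<Sum>x\<in>I. p x * h x) > 0"
proof -
  have "finite I"
    using assms(2) by (metis sum.infinite zero_neq_one)
  obtain x where "x \<in> I" "p x \<noteq> 0"
    using assms(2) by (metis sum.neutral zero_neq_one)
  then have "p x * h x > 0"
    using assms(1,3)[of x] by (simp add: less_le)
  moreover have "p x * h x \<ge> 0" if "x \<in> I" for x
    using assms(1,3)[OF that] by simp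
  ultimately show ?thesis
    using \<open>finite I\<close> \<open>x \<in> I\<close> by (intro sum_pos2) auto
qed

lemma qf_spec_pos:
  assumes "spec n A l U" "\<And>i. i < n \<Longrightarrow> l i > 0" "nsq n u = 1"
  shows "qf n A u > 0"
proof -
  have "(\<Sum>k<n. (cmod (ip n (column U k) u))\<^sup>2 * l k) > 0"
    by (rule weighted_sum_pos) (use assms(2) in \<open>auto simp: parseval[OF specD(1)[OF assms(1)]] assms(3)\<close>)
  then show ?thesis
    unfolding qf_spec[OF assms(1)] by (simp add: mult.commute)
qed

text \<open>Both sums are the trace of A: once the identity written in the basis E is the
  diagonalised factor of \<open>rt\<close>, once A is.\<close>

lemma sum_eigenvalues:
  assumes "spec n A l U" "unitary n E"
  shows "(\<Sum>k<n. qf n A (column E k)) = (\<Sum>k<n. l k)"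
proof -
  have "(\<Sum>k<n. 1 * qf n A (column E k)) = rt n (spectral n (\<lambda>_. 1) E) A"
    by (rule rt_spec[OF spec_spectral[OF assms(2)], symmetric])
  also have "\<dots> = (\<Sum>k<n. l k * qf n (spectral n (\<lambda>_. 1) E) (column U k))"
    unfolding rt_comm[of n "spectral n _ E"] by (rule rt_spec[OF assms(1)])
  also have "\<dots> = (\<Sum>k<n. l k)"
    by (intro sum.cong refl)
      (simp add: qf_spec[OF spec_spectral[OF assms(2)]] parseval[OF assms(2)]
        nsq_column[OF specD(1)[OF assms(1)]])
  finally show ?thesis by simp
qed

lemma sum_eigenvalues_combination:
  assumes "spec n (combination I p X) l U" "\<And>x. x \<in> I \<Longrightarrow> spec n (X x) (l' x) (U' x)"
  shows "(\<Sum>i<n. l i) = (\<Sum>x\<in>I. p x * (\<Sum>i<n. l' x i))"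
proof -
  note U = specD(1)[OF assms(1)]
  have "(\<Sum>i<n. l i) = (\<Sum>i<n. \<Sum>x\<in>I. p x * qf n (X x) (column U i))"
    using sum_eigenvalues[OF assms(1) U] by (simp add: qf_combination)
  also have "\<dots> = (\<Sum>x\<in>I. p x * (\<Sum>i<n. qf n (X x) (column U i)))"
    by (subst sum.swap) (simp add: sum_distrib_left)
  also have "\<dots> = (\<Sum>x\<in>I. p x * (\<Sum>i<n. l' x i))"
    by (intro sum.cong refl) (simp add: sum_eigenvalues[OF assms(2) U])
  finally show ?thesis .
qed

text \<open>The step of Tropp's matrix Chernoff bound that rests on Lieb's theorem. With
  \<open>Y x = exp (H + \<theta> X x)\<close>, \<open>A x = exp (\<theta> X x)\<close> and their means \<open>Y\<close>, \<open>A\<close>, joint convexity of the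
  relative entropy gives \<open>tr (Y ln Y) \<le> tr (Y H) + tr (Y ln A)\<close>; here \<open>ln A \<le> A - 1\<close>, and the chord
  bound for \<open>exp\<close> controls \<open>A\<close>. The claim follows as the relative entropy of \<open>Y\<close> with respect to the
  exponential on the right-hand side is nonnegative.\<close>

theorem trexp_mean_le:
  assumes p: "\<And>x. x \<in> I \<Longrightarrow> p x \<ge> 0" "sum p I = 1"
    and H: "hermitian n H" and X: "\<And>x. x \<in> I \<Longrightarrow> contraction n (X x)"
  shows "(\<Sum>x\<in>I. p x * trexp n (plus_scaled H \<theta> (X x))) \<le>
    trexp n (plus_scaled H (exp \<theta> - 1) (combination I p X))"
proof -
  let ?g = "exp \<theta> - 1" and ?W = "combination I p X"
  let ?B = "plus_scaled H ?g ?W"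
  have hX: "hermitian n (X x)" and cX: "0 \<le> qf n (X x) u" "qf n (X x) u \<le> nsq n u" if "x \<in> I" for x u
    using X[OF that] by (auto simp: contraction_def)
  have "\<forall>x\<in>I. \<exists>lU. spec n (X x) (fst lU) (snd lU)"
    using spectral_theorem[OF hX] by auto
  then obtain f where "\<forall>x\<in>I. spec n (X x) (fst (f x)) (snd (f x))"
    by (rule bchoice[THEN exE])
  then obtain \<xi> W where sX: "\<And>x. x \<in> I \<Longrightarrow> spec n (X x) (\<xi> x) (W x)"
    using that[of "\<lambda>x. fst (f x)" "\<lambda>x. snd (f x)"] by blast
  have "\<forall>x\<in>I. \<exists>lU. spec n (plus_scaled H \<theta> (X x)) (fst lU) (snd lU)"
    using spectral_theorem[OF hermitian_plus_scaled[OF H hX]] by auto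
  then obtain f where "\<forall>x\<in>I. spec n (plus_scaled H \<theta> (X x)) (fst (f x)) (snd (f x))"
    by (rule bchoice[THEN exE])
  then obtain \<eta> U where sH: "\<And>x. x \<in> I \<Longrightarrow> spec n (plus_scaled H \<theta> (X x)) (\<eta> x) (U x)"
    using that[of "\<lambda>x. fst (f x)" "\<lambda>x. snd (f x)"] by blast
  define Y' where "Y' x = spectral n (\<lambda>i. exp (\<eta> x i)) (U x)" for x
  define A' where "A' x = spectral n (\<lambda>i. exp (\<theta> * \<xi> x i)) (W x)" for x
  have sY': "spec n (Y' x) (\<lambda>i. exp (\<eta> x i)) (U x)" if "x \<in> I" for x
    unfolding Y'_def by (rule spec_spectral[OF specD(1)[OF sH[OF that]]])
  have sA': "spec n (A' x) (\<lambda>i. exp (\<theta> * \<xi> x i)) (W x)" if "x \<in> I" for x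
    unfolding A'_def by (rule spec_spectral[OF specD(1)[OF sX[OF that]]])
  define Y where "Y = combination I p Y'"
  define A where "A = combination I p A'"
  have "hermitian n Y" "hermitian n A"
    unfolding Y_def A_def by (auto intro!: hermitian_combination spec_hermitian[OF sY'] spec_hermitian[OF sA'])
  then obtain y F a G where sY: "spec n Y y F" and sA: "spec n A a G"
    using spectral_theorem by blast
  have "hermitian n ?B"
    by (intro hermitian_plus_scaled H hermitian_combination hX)
  then obtain \<beta> E where sB: "spec n ?B \<beta> E"
    using spectral_theorem by blast
  have y: "y i > 0" if "i < n" for i
    unfolding qf_eigenvector[OF sY that, symmetric] Y_def qf_combination
    by (intro weighted_sum_pos[OF p] qf_spec_pos[OF sY']) (use nsq_column[OF specD(1)[OF sY] that] in auto)
  have a: "a i > 0" if "i < n" for i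
    unfolding qf_eigenvector[OF sA that, symmetric] A_def qf_combination
    by (intro weighted_sum_pos[OF p] qf_spec_pos[OF sA']) (use nsq_column[OF specD(1)[OF sA] that] in auto)
  have trY: "(\<Sum>i<n. y i) = (\<Sum>x\<in>I. p x * (\<Sum>i<n. exp (\<eta> x i)))"
    by (rule sum_eigenvalues_combination[OF sY[unfolded Y_def] sY'])
  have trA: "(\<Sum>i<n. a i) = (\<Sum>x\<in>I. p x * (\<Sum>i<n. exp (\<theta> * \<xi> x i)))"
    by (rule sum_eigenvalues_combination[OF sA[unfolded A_def] sA'])
  \<comment> \<open>The logarithms of Y' and A' differ exactly by H: the term with X cancels
    although it need not commute with H. This is the reason for comparing with A'.\<close>
  have single: "rel_entropy n (\<lambda>i. exp (\<eta> x i)) (U x) (\<lambda>i. exp (\<theta> * \<xi> x i)) (W x) =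
      rt n H (Y' x) - (\<Sum>i<n. exp (\<eta> x i)) + (\<Sum>i<n. exp (\<theta> * \<xi> x i))" if x: "x \<in> I" for x
  proof -
    have "(\<Sum>i<n. exp (\<eta> x i) * \<eta> x i) = rt n (Y' x) (plus_scaled H \<theta> (X x))"
      unfolding rt_spec[OF sY'[OF x]] by (intro sum.cong refl) (simp add: qf_eigenvector[OF sH[OF x]])
    also have "\<dots> = rt n (Y' x) H + \<theta> * rt n (Y' x) (X x)"
      unfolding rt_spec[OF sY'[OF x]] qf_plus_scaled
      by (simp add: distrib_left sum.distrib sum_distrib_left mult.left_commute)
    also have "\<theta> * rt n (Y' x) (X x) = (\<Sum>j<n. ln (exp (\<theta> * \<xi> x j)) * qf n (Y' x) (column (W x) j))"
      unfolding rt_comm[of n "Y' x"] rt_spec[OF sX[OF x]] by (simp add: sum_distrib_left mult.assoc)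
    finally show ?thesis
      by (subst rel_entropy_eq[OF sY'[OF x] _ sA'[OF x]]) (auto simp: rt_comm)
  qed
  have "rel_entropy n y F a G \<le> (\<Sum>x\<in>I. p x *
      rel_entropy n (\<lambda>i. exp (\<eta> x i)) (U x) (\<lambda>i. exp (\<theta> * \<xi> x i)) (W x))"
    by (rule rel_entropy_jointly_convex[OF sY y sA a sY' _ sA' _ p(1)]) (auto simp: Y_def A_def)
  also have "\<dots> = rt n H Y - (\<Sum>i<n. y i) + (\<Sum>i<n. a i)"
    unfolding trY trA Y_def rt_combination
    by (simp add: single distrib_left right_diff_distrib sum.distrib sum_subtractf)
  finally have ent: "(\<Sum>i<n. y i * ln (y i)) \<le> rt n H Y + (\<Sum>j<n. ln (a j) * qf n Y (column G j))"
    by (subst (asm) rel_entropy_eq[OF sY y sA a]) auto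
  \<comment> \<open>The chord bound is applied to the eigenvalues of each X, which lie in [0, 1];
    averaging then turns it into A \<le> 1 + (exp \<theta> - 1) E X as quadratic forms.\<close>
  have A_le: "qf n A u \<le> nsq n u + ?g * qf n ?W u" for u
  proof -
    have "qf n (A' x) u \<le> nsq n u + ?g * qf n (X x) u" if x: "x \<in> I" for x
    proof -
      have "qf n (A' x) u \<le> (\<Sum>k<n. (1 + ?g * \<xi> x k) * (cmod (ip n (column (W x) k) u))\<^sup>2)"
        unfolding qf_spec[OF sA'[OF x]]
      proof (intro sum_mono mult_right_mono exp_chord)
        fix k assume k: "k \<in> {..<n}"
        then have "\<xi> x k = qf n (X x) (column (W x) k)"
          by (simp add: qf_eigenvector[OF sX[OF x]])
        with cX[OF x, of "column (W x) k"] show "0 \<le> \<xi> x k" "\<xi> x k \<le> 1"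
          using k by (simp_all add: nsq_column[OF specD(1)[OF sX[OF x]]])
      qed simp
      also have "\<dots> = nsq n u + ?g * qf n (X x) u"
        unfolding qf_spec[OF sX[OF x]] parseval[OF specD(1)[OF sX[OF x]], symmetric]
        by (simp add: distrib_right sum.distrib sum_distrib_left mult.assoc)
      finally show ?thesis .
    qed
    then have "qf n A u \<le> (\<Sum>x\<in>I. p x * (nsq n u + ?g * qf n (X x) u))"
      unfolding A_def qf_combination by (intro sum_mono mult_left_mono p(1))
    also have "\<dots> = sum p I * nsq n u + ?g * qf n ?W u"
      unfolding qf_combination
      by (simp add: distrib_left sum.distrib sum_distrib_left sum_distrib_right mult.left_commute)
    finally show ?thesis by (simp add: p(2))
  qed
  \<comment> \<open>Bounding ln by its tangent at 1 on the eigenvalues of A itself makes operator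
    monotonicity of the logarithm unnecessary. The trace of Y subtracted here cancels the one
    produced by the chord bound.\<close>
  have "(\<Sum>j<n. ln (a j) * qf n Y (column G j)) \<le> (\<Sum>j<n. (a j - 1) * qf n Y (column G j))"
  proof (intro sum_mono mult_right_mono)
    fix j assume j: "j \<in> {..<n}"
    with a show "ln (a j) \<le> a j - 1"
      by (intro ln_le_minus_one) auto
    show "0 \<le> qf n Y (column G j)"
      using qf_spec_pos[OF sY y nsq_column[OF specD(1)[OF sA]]] j by (auto intro: less_imp_le)
  qed
  also have "\<dots> = rt n A Y - (\<Sum>i<n. y i)"
    unfolding rt_spec[OF sA] using sum_eigenvalues[OF sY specD(1)[OF sA]]
    by (simp add: left_diff_distrib sum_subtractf)
  also have "rt n A Y \<le> (\<Sum>i<n. y i * (1 + ?g * qf n ?W (column F i)))"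
    unfolding rt_comm[of n A] rt_spec[OF sY]
  proof (intro sum_mono mult_left_mono)
    fix i assume i: "i \<in> {..<n}"
    show "qf n A (column F i) \<le> 1 + ?g * qf n ?W (column F i)"
      using A_le[of "column F i"] i by (simp add: nsq_column[OF specD(1)[OF sY]])
    show "0 \<le> y i"
      using y i by (auto intro: less_imp_le)
  qed
  also have "\<dots> = (\<Sum>i<n. y i) + ?g * rt n Y ?W"
    unfolding rt_spec[OF sY] by (simp add: distrib_left sum.distrib sum_distrib_left mult.left_commute)
  finally have "(\<Sum>i<n. y i * ln (y i)) \<le> rt n H Y + ?g * rt n Y ?W"
    using ent by simp
  also have "\<dots> = rt n Y ?B"
    unfolding rt_comm[of n H] rt_spec[OF sY] qf_plus_scaled
    by (simp add: distrib_left sum.distrib sum_distrib_left mult.left_commute)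
  finally have ent2: "(\<Sum>i<n. y i * ln (y i)) \<le> rt n Y ?B" .
  let ?C = "spectral n (\<lambda>i. exp (\<beta> i)) E"
  have sC: "spec n ?C (\<lambda>i. exp (\<beta> i)) E"
    by (rule spec_spectral[OF specD(1)[OF sB]])
  \<comment> \<open>The Gibbs variational principle: once tr(Y ln Y) \<le> tr(Y B), nonnegativity of
    the entropy relative to exp B bounds the trace of Y by that of exp B.\<close>
  have "0 \<le> rel_entropy n y F (\<lambda>i. exp (\<beta> i)) E"
    unfolding rel_entropy_def
    by (intro sum_nonneg mult_nonneg_nonneg kl_nonneg) (use y in auto)
  also have "\<dots> = (\<Sum>i<n. y i * ln (y i)) - rt n Y ?B - (\<Sum>i<n. y i) + (\<Sum>j<n. exp (\<beta> j))"
    by (subst rel_entropy_eq[OF sY y sC]) (auto simp: rt_comm[of n Y] rt_spec[OF sB])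
  finally have "(\<Sum>i<n. y i) \<le> (\<Sum>j<n. exp (\<beta> j))"
    using ent2 by simp
  then show ?thesis
    unfolding trexp_spec[OF sB] trY by (simp add: trexp_spec[OF sH])
qed

text \<open>Golden--Thompson, with the exponential of the contraction already bounded by its chord.\<close>

theorem trexp_plus_contraction_le:
  assumes H: "spec n H \<eta> E" and X: "contraction n X"
  shows "trexp n (plus_scaled H \<theta> X) \<le> (\<Sum>k<n. exp (\<eta> k) * (1 + (exp \<theta> - 1) * qf n X (column E k)))"
proof -
  have hX: "hermitian n X" and cX: "0 \<le> qf n X u" "qf n X u \<le> nsq n u" for u
    using X by (auto simp: contraction_def)
  obtain \<xi> W where sX: "spec n X \<xi> W"
    using spectral_theorem[OF hX] by blast
  obtain \<zeta> U where sH: "spec n (plus_scaled H \<theta> X) \<zeta> U"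
    using spectral_theorem[OF hermitian_plus_scaled[OF spec_hermitian[OF H] hX]] by blast
  note uE = specD(1)[OF H] and uW = specD(1)[OF sX] and uU = specD(1)[OF sH]
  let ?Y = "spectral n (\<lambda>i. exp (\<zeta> i)) U" and ?C = "spectral n (\<lambda>i. exp (\<eta> i)) E"
  have sY: "spec n ?Y (\<lambda>i. exp (\<zeta> i)) U" and sC: "spec n ?C (\<lambda>i. exp (\<eta> i)) E"
    by (rule spec_spectral[OF uU], rule spec_spectral[OF uE])
  let ?y = "\<lambda>i. qf n ?Y (column W i)" and ?c = "\<lambda>i. qf n ?C (column W i)"
  have y: "?y i > 0" and c: "?c i > 0" if "i < n" for i
    by (intro qf_spec_pos[OF sY] qf_spec_pos[OF sC] nsq_column[OF uW that]; simp)+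
  have tr: "(\<Sum>i<n. ?y i) = (\<Sum>i<n. exp (\<zeta> i))"  "(\<Sum>i<n. ?c i) = (\<Sum>i<n. exp (\<eta> i))"
    by (rule sum_eigenvalues[OF sY uW], rule sum_eigenvalues[OF sC uW])
  \<comment> \<open>Pinching in the eigenbasis W of X leaves scalars only. The entropy on the right
    is explicit since the logarithms of the two exponentials differ by \<theta> X.\<close>
  have "(\<Sum>i<n. kl (?y i) (?c i)) \<le> rel_entropy n (\<lambda>i. exp (\<zeta> i)) U (\<lambda>i. exp (\<eta> i)) E"
    by (rule rel_entropy_pinching[OF sY _ sC _ uW]) (use y c in auto)
  also have "\<dots> = \<theta> * rt n X ?Y - (\<Sum>i<n. ?y i) + (\<Sum>i<n. ?c i)"
  proof -
    have "(\<Sum>i<n. exp (\<zeta> i) * \<zeta> i) = rt n ?Y (plus_scaled H \<theta> X)"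
      unfolding rt_spec[OF sY] by (intro sum.cong refl) (simp add: qf_eigenvector[OF sH])
    also have "\<dots> = rt n ?Y H + \<theta> * rt n X ?Y"
      unfolding rt_comm[of n X] rt_spec[OF sY] qf_plus_scaled
      by (simp add: distrib_left sum.distrib sum_distrib_left mult.left_commute)
    finally show ?thesis
      unfolding tr by (subst rel_entropy_eq[OF sY _ sC]) (auto simp: rt_comm[of n ?Y] rt_spec[OF H])
  qed
  finally have le: "(\<Sum>i<n. ?y i * ln (?y i / ?c i)) \<le> \<theta> * rt n X ?Y"
    unfolding kl_def by (simp add: sum.distrib sum_subtractf)
  \<comment> \<open>The scalar Gibbs inequality with reference masses c_i exp(\<theta> \<xi>_i). Its
    sum is the Golden--Thompson inequality, with the right-hand trace evaluated in the eigenbasis of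
    X.\<close>
  have "(\<Sum>i<n. ?y i - ?c i * exp (\<theta> * \<xi> i)) \<le> (\<Sum>i<n. ?y i * ln (?y i / ?c i) - \<theta> * (\<xi> i * ?y i))"
  proof (rule sum_mono)
    fix i assume "i \<in> {..<n}"
    then have pos: "?y i > 0" "?c i > 0" using y c by auto
    then have "0 \<le> kl (?y i) (?c i * exp (\<theta> * \<xi> i))"
      by (intro kl_nonneg) auto
    with pos show "?y i - ?c i * exp (\<theta> * \<xi> i) \<le> ?y i * ln (?y i / ?c i) - \<theta> * (\<xi> i * ?y i)"
      by (simp add: kl_def ln_div ln_mult algebra_simps)
  qed
  also have "\<dots> \<le> 0"
    using le unfolding rt_spec[OF sX] by (simp add: sum_subtractf sum_distrib_left)
  finally have "(\<Sum>i<n. exp (\<zeta> i)) \<le> (\<Sum>i<n. exp (\<theta> * \<xi> i) * ?c i)"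
    by (simp add: sum_subtractf tr mult.commute)
  also have "\<dots> \<le> (\<Sum>i<n. (1 + (exp \<theta> - 1) * \<xi> i) * ?c i)"
  proof (intro sum_mono mult_right_mono exp_chord)
    fix i assume i: "i \<in> {..<n}"
    show "0 \<le> \<xi> i" "\<xi> i \<le> 1"
      using cX[of "column W i"] i by (simp_all add: qf_eigenvector[OF sX] nsq_column[OF uW])
    show "0 \<le> ?c i" using c i by (auto intro: less_imp_le)
  qed
  also have "\<dots> = (\<Sum>i<n. exp (\<eta> i)) + (exp \<theta> - 1) * rt n ?C X"
    unfolding rt_comm[of n ?C] rt_spec[OF sX] tr(2)[symmetric]
    by (simp only: distrib_right sum.distrib sum_distrib_left mult.assoc mult_1)
  also have "\<dots> = (\<Sum>k<n. exp (\<eta> k) * (1 + (exp \<theta> - 1) * qf n X (column E k)))"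
    unfolding rt_spec[OF sC]
    by (simp only: distrib_left sum.distrib sum_distrib_left mult.left_commute mult_1_right)
  finally show ?thesis
    unfolding trexp_spec[OF sH] .
qed

section \<open>Matrix Chernoff bound for finite product distributions\<close>

lemma spec_eqm: "eqm n A B \<Longrightarrow> spec n B l U \<Longrightarrow> spec n A l U"
  using eqm_trans by (auto simp: spec_def)

lemma trexp_eqm:
  assumes "eqm n A B" "hermitian n B"
  shows "trexp n A = trexp n B"
proof -
  obtain l U where "spec n B l U"
    using spectral_theorem[OF assms(2)] by blast
  then show ?thesis
    using trexp_spec spec_eqm[OF assms(1)] by metis
qed

lemma trexp_scaled_identity: "trexp n (dg (\<lambda>_. of_real c)) = real n * exp c"
  by (simp add: trexp_spec[OF spec_scaled_identity])

lemma trexp_nonneg: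
  assumes "hermitian n A"
  shows "trexp n A \<ge> 0"
proof -
  obtain l U where "spec n A l U"
    using spectral_theorem[OF assms] by blast
  then show ?thesis
    by (simp add: trexp_spec sum_nonneg)
qed

text \<open>The form at a unit vector is a weighted mean of the eigenvalues, so some eigenvalue is
  at least c; the remaining exponentials are positive. This turns an extreme value of the form into
  a large trace.\<close>

lemma trexp_ge:
  assumes "hermitian n A" "nsq n u = 1" "c \<le> qf n A u"
  shows "exp c \<le> trexp n A"
proof -
  obtain l U where A: "spec n A l U"
    using spectral_theorem[OF assms(1)] by blast
  have "\<exists>k<n. c \<le> l k"
  proof (rule ccontr)
    assume "\<not> ?thesis"
    then have "(\<Sum>k<n. (cmod (ip n (column U k) u))\<^sup>2 * (c - l k)) > 0"
      by (intro weighted_sum_pos) (auto simp: parseval[OF specD(1)[OF A]] assms(2) not_le)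
    also have "\<dots> = c * nsq n u - qf n A u"
      unfolding qf_spec[OF A] parseval[OF specD(1)[OF A], symmetric]
      by (simp add: algebra_simps sum_subtractf sum_distrib_left)
    finally show False using assms by simp
  qed
  then obtain k where k: "k < n" "c \<le> l k" by blast
  then have "exp c \<le> exp (l k)" by simp
  also have "\<dots> \<le> (\<Sum>k<n. exp (l k))"
    using k by (intro member_le_sum) auto
  finally show ?thesis by (simp add: trexp_spec[OF A])
qed

lemma sum_PiE_insert:
  assumes "x \<notin> S"
  shows "(\<Sum>a\<in>PiE (insert x S) T. f a) = (\<Sum>a\<in>PiE S T. \<Sum>i\<in>T x. f (a(x := i)))"
proof -
  have "(\<Sum>a\<in>PiE (insert x S) T. f a) = (\<Sum>(i, a)\<in>T x \<times> PiE S T. f (a(x := i)))"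
    unfolding PiE_insert_eq
    by (subst sum.reindex[OF inj_combinator[OF assms]]) (simp add: split_def)
  also have "\<dots> = (\<Sum>i\<in>T x. \<Sum>a\<in>PiE S T. f (a(x := i)))"
    by (simp add: sum.cartesian_product)
  finally show ?thesis
    by (subst (asm) sum.swap)
qed

definition msum :: "'s set \<Rightarrow> ('s \<Rightarrow> cmatrix) \<Rightarrow> cmatrix" where
  "msum S X = (\<lambda>i j. \<Sum>x\<in>S. X x i j)"

lemma msum_eq_combination: "msum S X = combination S (\<lambda>_. 1) X"
  by (simp add: msum_def combination_def)

lemma hermitian_msum: "(\<And>x. x \<in> S \<Longrightarrow> hermitian n (X x)) \<Longrightarrow> hermitian n (msum S X)"
  unfolding msum_eq_combination by (rule hermitian_combination)

lemma qf_msum: "qf n (msum S X) u = (\<Sum>x\<in>S. qf n (X x) u)"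
  unfolding msum_eq_combination qf_combination by simp

lemma plus_scaled_msum_insert:
  assumes "finite S" "x \<notin> S"
  shows "plus_scaled H t (msum (insert x S) X) = plus_scaled (plus_scaled H t (X x)) t (msum S X)"
  using assms by (simp add: plus_scaled_def msum_def algebra_simps)

lemma plus_scaled_commute: "plus_scaled (plus_scaled H s A) t B = plus_scaled (plus_scaled H t B) s A"
  by (simp add: plus_scaled_def algebra_simps)

text \<open>Tropp's iteration: freeze all coordinates but one in the Hermitian offset, average over
  that one with \<open>trexp_mean_le\<close>, and move the resulting mean into the offset. H has to
  be arbitrary for this, and the induction generalises over it.\<close>

lemma trexp_product_mean_le:
  assumes "finite S"
    and p: "\<And>x i. x \<in> S \<Longrightarrow> i \<in> I \<Longrightarrow> p x i \<ge> 0" "\<And>x. x \<in> S \<Longrightarrow> sum (p x) I = 1"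
    and X: "\<And>x i. x \<in> S \<Longrightarrow> i \<in> I \<Longrightarrow> contraction n (X x i)"
    and H: "hermitian n H"
  shows "(\<Sum>a\<in>PiE S (\<lambda>_. I). (\<Prod>x\<in>S. p x (a x)) * trexp n (plus_scaled H \<theta> (msum S (\<lambda>x. X x (a x)))))
    \<le> trexp n (plus_scaled H (exp \<theta> - 1) (msum S (\<lambda>x. combination I (p x) (X x))))"
  using assms
proof (induction S arbitrary: H rule: finite_induct)
  case empty
  then show ?case by (simp add: msum_def plus_scaled_def)
next
  case (insert x S)
  let ?W = "combination I (p x) (X x)"
  let ?H = "\<lambda>a. plus_scaled H \<theta> (msum S (\<lambda>y. X y (a y)))"
  have hX: "hermitian n (X y i)" if "y \<in> insert x S" "i \<in> I" for y i
    using insert.prems(3)[OF that] by (simp add: contraction_def)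
  have eq: "(\<Prod>y\<in>insert x S. p y ((a(x := i)) y)) *
      trexp n (plus_scaled H \<theta> (msum (insert x S) (\<lambda>y. X y ((a(x := i)) y)))) =
      (\<Prod>y\<in>S. p y (a y)) * (p x i * trexp n (plus_scaled (?H a) \<theta> (X x i)))" for a i
  proof -
    have "(\<Prod>y\<in>insert x S. p y ((a(x := i)) y)) = p x i * (\<Prod>y\<in>S. p y (a y))"
      using insert.hyps by (simp, intro disjI2 prod.cong) auto
    moreover have "msum S (\<lambda>y. X y ((a(x := i)) y)) = msum S (\<lambda>y. X y (a y))"
      unfolding msum_def using insert.hyps by (intro ext sum.cong) auto
    then have "plus_scaled H \<theta> (msum (insert x S) (\<lambda>y. X y ((a(x := i)) y))) = plus_scaled (?H a) \<theta> (X x i)"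
      unfolding plus_scaled_msum_insert[OF insert.hyps(1,2)] plus_scaled_commute[of H \<theta> _ \<theta> "msum S _"]
      by simp
    ultimately show ?thesis by simp
  qed
  have "(\<Sum>a\<in>PiE (insert x S) (\<lambda>_. I). (\<Prod>y\<in>insert x S. p y (a y)) *
        trexp n (plus_scaled H \<theta> (msum (insert x S) (\<lambda>y. X y (a y))))) =
      (\<Sum>a\<in>PiE S (\<lambda>_. I). (\<Prod>y\<in>S. p y (a y)) *
        (\<Sum>i\<in>I. p x i * trexp n (plus_scaled (?H a) \<theta> (X x i))))"
    unfolding sum_PiE_insert[OF insert.hyps(2)] eq sum_distrib_left ..
  also have "\<dots> \<le> (\<Sum>a\<in>PiE S (\<lambda>_. I). (\<Prod>y\<in>S. p y (a y)) *
        trexp n (plus_scaled (?H a) (exp \<theta> - 1) ?W))"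
  proof (intro sum_mono mult_left_mono prod_nonneg trexp_mean_le)
    fix a assume a: "a \<in> PiE S (\<lambda>_. I)"
    then show "hermitian n (?H a)"
      by (intro hermitian_plus_scaled hermitian_msum hX insert.prems) auto
    show "\<And>y. y \<in> S \<Longrightarrow> 0 \<le> p y (a y)"
      using a insert.prems(1) by auto
  qed (use insert.prems in auto)
  \<comment> \<open>The averaged term no longer depends on the draws and becomes part of the offset
    to which the induction hypothesis applies.\<close>
  also have "\<dots> = (\<Sum>a\<in>PiE S (\<lambda>_. I). (\<Prod>y\<in>S. p y (a y)) *
        trexp n (plus_scaled (plus_scaled H (exp \<theta> - 1) ?W) \<theta> (msum S (\<lambda>y. X y (a y)))))"
    unfolding plus_scaled_commute[of H \<theta>] ..
  also have "\<dots> \<le> trexp n (plus_scaled (plus_scaled H (exp \<theta> - 1) ?W) (exp \<theta> - 1)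
        (msum S (\<lambda>y. combination I (p y) (X y))))"
    by (intro insert.IH hermitian_plus_scaled hermitian_combination hX insert.prems) (use insert.prems in auto)
  finally show ?case
    by (simp only: plus_scaled_msum_insert[OF insert.hyps(1,2)])
qed

text \<open>The Laplace transform method with Markov's inequality; the factor n is the trace of the
  identity. Multiplying the event by \<theta> covers the upper tail for \<theta> > 0 and the lower
  tail for \<theta> < 0 at once.\<close>

lemma product_tail_le:
  assumes S: "finite S"
    and p: "\<And>x i. x \<in> S \<Longrightarrow> i \<in> I \<Longrightarrow> p x i \<ge> 0" "\<And>x. x \<in> S \<Longrightarrow> sum (p x) I = 1"
    and X: "\<And>x i. x \<in> S \<Longrightarrow> i \<in> I \<Longrightarrow> contraction n (X x i)"
    and mean: "eqm n (msum S (\<lambda>x. combination I (p x) (X x))) (dg (\<lambda>_. of_real m))"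
  shows "(\<Sum>a\<in>PiE S (\<lambda>_. I). (\<Prod>x\<in>S. p x (a x)) *
      of_bool (\<exists>u. nsq n u = 1 \<and> \<theta> * \<tau> \<le> \<theta> * qf n (msum S (\<lambda>x. X x (a x))) u))
    \<le> real n * exp ((exp \<theta> - 1) * m - \<theta> * \<tau>)"
proof -
  let ?Z = "\<lambda>a. msum S (\<lambda>x. X x (a x))" and ?O = "\<lambda>_ _. 0 :: complex"
  have hO: "hermitian n ?O" by (simp add: hermitian_def)
  have hX: "hermitian n (X y i)" if "y \<in> S" "i \<in> I" for y i
    using X[OF that] by (simp add: contraction_def)
  have bound: "of_bool (\<exists>u. nsq n u = 1 \<and> \<theta> * \<tau> \<le> \<theta> * qf n (?Z a) u)
      \<le> exp (- \<theta> * \<tau>) * trexp n (plus_scaled ?O \<theta> (?Z a))"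
    if a: "a \<in> PiE S (\<lambda>_. I)" for a
  proof -
    have h: "hermitian n (plus_scaled ?O \<theta> (?Z a))"
      using a by (intro hermitian_plus_scaled hO hermitian_msum hX) auto
    show ?thesis
    proof (cases "\<exists>u. nsq n u = 1 \<and> \<theta> * \<tau> \<le> \<theta> * qf n (?Z a) u")
      case True
      then obtain u where u: "nsq n u = 1" "\<theta> * \<tau> \<le> \<theta> * qf n (?Z a) u" by blast
      have "qf n ?O u = 0"
        by (simp add: qf_def ip_def mv_def)
      with u have "exp (\<theta> * \<tau>) \<le> trexp n (plus_scaled ?O \<theta> (?Z a))"
        by (intro trexp_ge[OF h]) (auto simp: qf_plus_scaled)
      then have "exp (- \<theta> * \<tau>) * exp (\<theta> * \<tau>) \<le> exp (- \<theta> * \<tau>) * trexp n (plus_scaled ?O \<theta> (?Z a))"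
        by (intro mult_left_mono) auto
      with True show ?thesis
        by (simp flip: exp_add)
    next
      case False
      then have "of_bool (\<exists>u. nsq n u = 1 \<and> \<theta> * \<tau> \<le> \<theta> * qf n (?Z a) u) = (0 :: real)"
        by simp
      moreover have "0 \<le> exp (- \<theta> * \<tau>) * trexp n (plus_scaled ?O \<theta> (?Z a))"
        using trexp_nonneg[OF h] by simp
      ultimately show ?thesis
        by (simp only:)
    qed
  qed
  have pnn: "(\<Prod>x\<in>S. p x (a x)) \<ge> 0" if "a \<in> PiE S (\<lambda>_. I)" for a
    using that p(1) by (intro prod_nonneg) auto
  have "(\<Sum>a\<in>PiE S (\<lambda>_. I). (\<Prod>x\<in>S. p x (a x)) *
      of_bool (\<exists>u. nsq n u = 1 \<and> \<theta> * \<tau> \<le> \<theta> * qf n (?Z a) u))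
    \<le> (\<Sum>a\<in>PiE S (\<lambda>_. I). (\<Prod>x\<in>S. p x (a x)) * (exp (- \<theta> * \<tau>) * trexp n (plus_scaled ?O \<theta> (?Z a))))"
    by (intro sum_mono mult_left_mono bound pnn)
  also have "\<dots> = exp (- \<theta> * \<tau>) * (\<Sum>a\<in>PiE S (\<lambda>_. I). (\<Prod>x\<in>S. p x (a x)) * trexp n (plus_scaled ?O \<theta> (?Z a)))"
    unfolding sum_distrib_left by (simp only: mult.left_commute)
  also have "\<dots> \<le> exp (- \<theta> * \<tau>) *
      trexp n (plus_scaled ?O (exp \<theta> - 1) (msum S (\<lambda>x. combination I (p x) (X x))))"
    by (intro mult_left_mono trexp_product_mean_le S p X hO) auto
  also have "trexp n (plus_scaled ?O (exp \<theta> - 1) (msum S (\<lambda>x. combination I (p x) (X x)))) =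
      trexp n (dg (\<lambda>_. of_real ((exp \<theta> - 1) * m)))"
    using mean
    by (intro trexp_eqm spec_hermitian[OF spec_scaled_identity]) (auto simp: eqm_def plus_scaled_def dg_def)
  also have "exp (- \<theta> * \<tau>) * \<dots> = real n * exp ((exp \<theta> - 1) * m - \<theta> * \<tau>)"
  proof -
    have "exp (- \<theta> * \<tau>) * exp c = exp (c - \<theta> * \<tau>)" for c
      by (simp flip: exp_add)
    then show ?thesis
      unfolding trexp_scaled_identity by (metis mult.left_commute)
  qed
  finally show ?thesis .
qed

text \<open>The large deviation exponents of a Poisson variable, per unit mean. They are a \<theta>
  - (exp \<theta> - 1) at its maximum \<theta> = ln a, with a = 1 + \<delta> here and a = 1 -
  \<delta> in \<open>rate_lower\<close>.\<close>

definition rate_upper :: "real \<Rightarrow> real" where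
  "rate_upper \<delta> = (1 + \<delta>) * ln (1 + \<delta>) - \<delta>"

definition rate_lower :: "real \<Rightarrow> real" where
  "rate_lower \<delta> = (1 - \<delta>) * ln (1 - \<delta>) + \<delta>"

lemma rate_upper_pos:
  assumes "0 < \<delta>"
  shows "0 < rate_upper \<delta>"
proof -
  have "ln (1 / (1 + \<delta>)) < 1 / (1 + \<delta>) - 1"
    using assms ln_le_minus_one[of "1 / (1 + \<delta>)"] ln_eq_minus_one[of "1 / (1 + \<delta>)"]
    by (force simp: less_le)
  then have "- ln (1 + \<delta>) < - \<delta> / (1 + \<delta>)"
    using assms by (simp add: ln_div field_simps)
  then show ?thesis
    using assms by (simp add: rate_upper_def field_simps)
qed

text \<open>The difference vanishes at 0 and has derivative - ln(1 - x^2) \<ge> 0. Hence the upper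
  tail is the heavier one, and a single condition on k_t covers both.\<close>

lemma rate_upper_le_lower:
  assumes "0 \<le> \<delta>" "\<delta> < 1"
  shows "rate_upper \<delta> \<le> rate_lower \<delta>"
proof -
  define h where "h x = rate_lower x - rate_upper x" for x
  have "h 0 \<le> h \<delta>"
  proof (rule DERIV_nonneg_imp_nondecreasing[OF assms(1)])
    fix x assume x: "0 \<le> x" "x \<le> \<delta>"
    then have x1: "x < 1" using assms by simp
    have "(h has_real_derivative - ln (1 - x) - ln (1 + x)) (at x)"
      unfolding h_def rate_lower_def rate_upper_def
      by (rule derivative_eq_intros refl | use x x1 in simp; fail)+
    moreover have "- ln (1 - x) - ln (1 + x) \<ge> 0"
    proof -
      have "ln (1 - x) + ln (1 + x) = ln ((1 - x) * (1 + x))"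
        using x x1 by (simp add: ln_mult)
      also have "\<dots> \<le> 0"
        using x x1 by (simp add: algebra_simps) (simp add: ln_le_zero_iff abs_square_less_1 flip: power2_eq_square)
      finally show ?thesis by simp
    qed
    ultimately show "\<exists>y. (h has_real_derivative y) (at x) \<and> 0 \<le> y" by blast
  qed
  then show ?thesis
    by (simp add: h_def rate_lower_def rate_upper_def)
qed

lemma cauchy_schwarz_sum:
  fixes u v :: cvector
  shows "(cmod (\<Sum>b<n. u b * v b))\<^sup>2 \<le> (\<Sum>b<n. (cmod (u b))\<^sup>2) * nsq n v"
proof -
  have "cmod (\<Sum>b<n. u b * v b) \<le> (\<Sum>b<n. \<bar>cmod (u b)\<bar> * \<bar>cmod (v b)\<bar>)"
    by (rule order_trans[OF norm_sum]) (simp add: norm_mult)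
  also have "\<dots> \<le> L2_set (\<lambda>b. cmod (u b)) {..<n} * L2_set (\<lambda>b. cmod (v b)) {..<n}"
    by (rule L2_set_mult_ineq)
  finally have "(cmod (\<Sum>b<n. u b * v b))\<^sup>2 \<le>
      (L2_set (\<lambda>b. cmod (u b)) {..<n} * L2_set (\<lambda>b. cmod (v b)) {..<n})\<^sup>2"
    by (intro power_mono) auto
  then show ?thesis
    by (simp add: power_mult_distrib L2_set_def nsq_def sum_nonneg)
qed

text \<open>With s the squared norm of the row q this is an orthogonal projection, as used for the
  draws. On the grid s is a uniform bound of the squared norms, which still gives a
  contraction.\<close>

definition row_projection :: "cvector \<Rightarrow> real \<Rightarrow> cmatrix" where
  "row_projection q s = (\<lambda>a b. cnj (q a) * q b / of_real s)"

lemma qf_row_projection: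
  "qf n (row_projection q s) d = (cmod (\<Sum>b<n. q b * d b))\<^sup>2 / s"
proof -
  have "ip n d (mv n (row_projection q s) d) = cnj (\<Sum>b<n. q b * d b) * (\<Sum>b<n. q b * d b) / of_real s"
    unfolding ip_def mv_def row_projection_def
    unfolding cnj_sum sum_product unfolding sum_distrib_left sum_divide_distrib
    by (intro sum.cong refl) simp
  also have "\<dots> = of_real ((cmod (\<Sum>b<n. q b * d b))\<^sup>2 / s)"
    by (simp add: complex_norm_square mult.commute del: of_real_power)
  finally show ?thesis
    by (simp add: qf_def)
qed

lemma contraction_row_projection:
  assumes "(\<Sum>b<n. (cmod (q b))\<^sup>2) \<le> s"
  shows "contraction n (row_projection q s)"
  unfolding contraction_def qf_row_projection
proof (intro conjI allI)
  have s: "0 \<le> s"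
    by (rule order_trans[OF sum_nonneg assms]) simp
  show "hermitian n (row_projection q s)"
    by (simp add: hermitian_def row_projection_def mult.commute)
  fix d
  show "0 \<le> (cmod (\<Sum>b<n. q b * d b))\<^sup>2 / s"
    using s by simp
  show "(cmod (\<Sum>b<n. q b * d b))\<^sup>2 / s \<le> nsq n d"
  proof (cases "s = 0")
    case False
    have "(cmod (\<Sum>b<n. q b * d b))\<^sup>2 \<le> s * nsq n d"
      by (rule order_trans[OF cauchy_schwarz_sum]) (intro mult_right_mono assms nsq_nonneg)
    with s False show ?thesis
      by (simp add: field_simps)
  qed simp
qed

lemma contraction_zero: "contraction n (\<lambda>_ _. 0)"
  by (simp add: contraction_def hermitian_def qf_def ip_def mv_def)

text \<open>With q the rows of Q and a the table of draws, this is k times the squared norm of A_t d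
  (see \<open>A_norm\<close>).\<close>

definition sample_form :: "(nat \<Rightarrow> cvector) \<Rightarrow> nat \<Rightarrow> nat \<Rightarrow> (nat \<times> nat \<Rightarrow> nat) \<Rightarrow> cvector \<Rightarrow> real" where
  "sample_form q n k a d = (\<Sum>l<n. \<Sum>m<k. (cmod (\<Sum>b<n. q (a (l, m)) b * d b))\<^sup>2 /
     (\<Sum>b<n. (cmod (q (a (l, m)) b))\<^sup>2))"

definition well_sampled :: "(nat \<Rightarrow> cvector) \<Rightarrow> nat \<Rightarrow> nat \<Rightarrow> real \<Rightarrow> (nat \<times> nat \<Rightarrow> nat) \<Rightarrow> bool" where
  "well_sampled q n k \<delta> a \<longleftrightarrow> (\<forall>d. (1 - \<delta>) * real k * nsq n d \<le> sample_form q n k a d \<and>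
     sample_form q n k a d \<le> (1 + \<delta>) * real k * nsq n d)"

lemma exists_normalizing_factor:
  assumes "nsq n d \<noteq> 0"
  shows "\<exists>t>0. t\<^sup>2 * nsq n d = 1 \<and> nsq n (\<lambda>b. of_real t * d b) = 1"
proof -
  have pos: "nsq n d > 0"
    using assms nsq_nonneg[of n d] by linarith
  define t where "t = 1 / sqrt (nsq n d)"
  have t: "t\<^sup>2 * nsq n d = 1" "t > 0"
    using pos by (auto simp: t_def power_divide)
  have "nsq n (\<lambda>b. of_real t * d b) = t\<^sup>2 * nsq n d"
    by (simp add: nsq_def norm_mult power_mult_distrib sum_distrib_left)
  with t show ?thesis by auto
qed

lemma not_well_sampled:
  assumes "\<not> well_sampled q n k \<delta> a"
  shows "\<exists>u. nsq n u = 1 \<and>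
    (sample_form q n k a u < (1 - \<delta>) * real k \<or> sample_form q n k a u > (1 + \<delta>) * real k)"
proof -
  obtain d where d: "sample_form q n k a d < (1 - \<delta>) * real k * nsq n d \<or>
      sample_form q n k a d > (1 + \<delta>) * real k * nsq n d"
    using assms unfolding well_sampled_def by (meson not_le)
  have "nsq n d \<noteq> 0"
  proof
    assume z: "nsq n d = 0"
    then have "d b = 0" if "b < n" for b
      using that by (simp add: nsq_def sum_nonneg_eq_0_iff)
    then have "sample_form q n k a d = 0"
      by (simp add: sample_form_def)
    with d z show False by simp
  qed
  from exists_normalizing_factor[OF this] obtain r
    where r: "r\<^sup>2 * nsq n d = 1" "r > 0" and u1: "nsq n (\<lambda>b. of_real r * d b) = 1"
    by blast
  define u where "u = (\<lambda>b. of_real r * d b)"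
  have "nsq n u = 1"
    using u1 by (simp add: u_def)
  moreover have "sample_form q n k a u = r\<^sup>2 * sample_form q n k a d"
  proof -
    have "(\<Sum>b<n. q i b * u b) = of_real r * (\<Sum>b<n. q i b * d b)" for i
      unfolding u_def sum_distrib_left by (simp only: mult.left_commute)
    then show ?thesis
      unfolding sample_form_def
      by (simp only: norm_mult power_mult_distrib sum_distrib_left[of "r\<^sup>2"]) simp
  qed
  moreover have "r\<^sup>2 * sample_form q n k a d < (1 - \<delta>) * real k * (r\<^sup>2 * nsq n d) \<or>
      r\<^sup>2 * sample_form q n k a d > (1 + \<delta>) * real k * (r\<^sup>2 * nsq n d)"
    using d r(2) by (auto simp: mult.left_commute[of _ "r\<^sup>2"])
  ultimately show ?thesis
    unfolding r(1) by auto
qed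

text \<open>The weights belong to the full table of N k' draws of the last pass, so that the
  failures of all passes become events of one product distribution. The normalisation of the rows
  cancels the total weight of the distributions, hence the mean is k times the identity. Each of the
  two tails gets \<epsilon>/4.\<close>

theorem sampling_failure_le:
  fixes q :: "nat \<Rightarrow> cvector" and \<pi> :: "nat \<Rightarrow> nat \<Rightarrow> real"
  assumes orth: "\<And>a b. a < n \<Longrightarrow> b < n \<Longrightarrow> (\<Sum>i<K. cnj (q i a) * q i b) = (if a = b then 1 else 0)"
    and \<pi>: "\<And>l i. l < N \<Longrightarrow> i < K \<Longrightarrow> \<pi> l i \<ge> 0" "\<And>l. l < N \<Longrightarrow> (\<Sum>i<K. \<pi> l i) = 1"
      "\<And>l i. l < n \<Longrightarrow> i < K \<Longrightarrow> \<pi> l i = (cmod (q i l))\<^sup>2"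
    and le: "n \<le> N" "k \<le> k'" and n: "0 < n"
    and \<delta>: "0 < \<delta>" "\<delta> < 1" and \<epsilon>: "0 < \<epsilon>" and k: "real k \<ge> ln (4 * real n / \<epsilon>) / rate_upper \<delta>"
  shows "(\<Sum>a\<in>PiE ({..<N} \<times> {..<k'}) (\<lambda>_. {..<K}). (\<Prod>x\<in>{..<N} \<times> {..<k'}. \<pi> (fst x) (a x)) *
    of_bool (\<not> well_sampled q n k \<delta> a)) \<le> \<epsilon> / 2"
proof -
  let ?S = "{..<N} \<times> {..<k'}" and ?I = "{..<K}"
  define s where "s i = (\<Sum>b<n. (cmod (q i b))\<^sup>2)" for i
  \<comment> \<open>Draws that the pass does not use contribute the zero matrix, which is also a
    contraction.\<close>
  define X where "X x i = (if fst x < n \<and> snd x < k then row_projection (q i) (s i) else (\<lambda>_ _. 0))" for x :: "nat \<times> nat" and i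
  define p where "p x = \<pi> (fst x)" for x :: "nat \<times> nat"
  have p: "\<And>x i. x \<in> ?S \<Longrightarrow> i \<in> ?I \<Longrightarrow> p x i \<ge> 0" "\<And>x. x \<in> ?S \<Longrightarrow> sum (p x) ?I = 1"
    using \<pi>(1,2) by (auto simp: p_def)
  have X: "contraction n (X x i)" for x i
    by (auto simp: X_def contraction_zero s_def intro!: contraction_row_projection)
  have sub: "?S \<inter> {x. fst x < n \<and> snd x < k} = {..<n} \<times> {..<k}"
    using le by auto
  have mean: "eqm n (msum ?S (\<lambda>x. combination ?I (p x) (X x))) (dg (\<lambda>_. of_real (real k)))"
    unfolding eqm_def
  proof (intro allI impI)
    fix a b assume ab: "a < n" "b < n"
    have "msum ?S (\<lambda>x. combination ?I (p x) (X x)) a b =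
        (\<Sum>x\<in>?S. if fst x < n \<and> snd x < k then \<Sum>i<K. of_real (\<pi> (fst x) i) * row_projection (q i) (s i) a b else 0)"
      unfolding msum_def combination_def by (intro sum.cong refl) (auto simp: X_def p_def)
    also have "\<dots> = (\<Sum>x\<in>{..<n} \<times> {..<k}. \<Sum>i<K. of_real (\<pi> (fst x) i) * row_projection (q i) (s i) a b)"
      unfolding sub[symmetric] by (simp add: sum.If_cases)
    also have "\<dots> = (\<Sum>i<K. \<Sum>x\<in>{..<n} \<times> {..<k}. of_real (\<pi> (fst x) i) * row_projection (q i) (s i) a b)"
      by (rule sum.swap)
    also have "\<dots> = (\<Sum>i<K. of_nat k * (cnj (q i a) * q i b))"
    proof (intro sum.cong refl)
      fix i assume i: "i \<in> {..<K}"
      have "(\<Sum>x\<in>{..<n} \<times> {..<k}. of_real (\<pi> (fst x) i) * row_projection (q i) (s i) a b) =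
          (\<Sum>l<n. \<Sum>m<k. of_real (\<pi> l i) * row_projection (q i) (s i) a b)"
        by (simp only: sum.cartesian_product split_def)
      also have "\<dots> = of_nat k * (of_real (\<Sum>l<n. \<pi> l i) * row_projection (q i) (s i) a b)"
        by (simp add: sum_distrib_left sum_distrib_right)
      \<comment> \<open>Only after summation over l does the total weight equal the normalisation s
        i; for a single l the mean is in general not a multiple of the identity.\<close>
      also have "(\<Sum>l<n. \<pi> l i) = s i"
        unfolding s_def using i by (intro sum.cong refl) (simp add: \<pi>(3))
      also have "of_real (s i) * row_projection (q i) (s i) a b = cnj (q i a) * q i b"
      proof (cases "s i = 0")
        case True
        then have "q i a = 0"
          using ab by (simp add: s_def sum_nonneg_eq_0_iff)
        then show ?thesis by (simp add: row_projection_def)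
      qed (simp add: row_projection_def)
      finally show "(\<Sum>x\<in>{..<n} \<times> {..<k}. of_real (\<pi> (fst x) i) * row_projection (q i) (s i) a b) =
        of_nat k * (cnj (q i a) * q i b)" .
    qed
    also have "\<dots> = of_nat k * (\<Sum>i<K. cnj (q i a) * q i b)"
      by (simp add: sum_distrib_left)
    finally show "msum ?S (\<lambda>x. combination ?I (p x) (X x)) a b = dg (\<lambda>_. of_real (real k)) a b"
      by (simp add: orth[OF ab] dg_def)
  qed
  have form: "qf n (msum ?S (\<lambda>x. X x (a x))) u = sample_form q n k a u" for a u
  proof -
    have "qf n (msum ?S (\<lambda>x. X x (a x))) u =
        (\<Sum>x\<in>?S. if fst x < n \<and> snd x < k then qf n (row_projection (q (a x)) (s (a x))) u else 0)"
      unfolding qf_msum by (intro sum.cong refl) (auto simp: X_def qf_def ip_def mv_def)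
    also have "\<dots> = (\<Sum>x\<in>{..<n} \<times> {..<k}. qf n (row_projection (q (a x)) (s (a x))) u)"
      unfolding sub[symmetric] by (simp add: sum.If_cases)
    finally show ?thesis
      by (simp add: sample_form_def qf_row_projection s_def sum.cartesian_product split_def)
  qed
  \<comment> \<open>The exponents that optimise the two tail bounds.\<close>
  let ?up = "ln (1 + \<delta>)" and ?lo = "ln (1 - \<delta>)"
  let ?bad = "\<lambda>\<theta> \<tau> a. \<exists>u. nsq n u = 1 \<and> \<theta> * \<tau> \<le> \<theta> * sample_form q n k a u"
  have tail: "(\<Sum>a\<in>PiE ?S (\<lambda>_. ?I). (\<Prod>x\<in>?S. p x (a x)) * of_bool (?bad \<theta> \<tau> a))
      \<le> real n * exp ((exp \<theta> - 1) * real k - \<theta> * \<tau>)" for \<theta> \<tau>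
    using product_tail_le[OF _ p X mean, of \<theta> \<tau>] unfolding form by simp
  have log: "ln (4 * real n / \<epsilon>) \<le> real k * rate_upper \<delta>"
    using k rate_upper_pos[OF \<delta>(1)] by (simp add: field_simps)
  have "real n * exp (- (real k * rate_upper \<delta>)) \<le> real n * exp (- ln (4 * real n / \<epsilon>))"
    using log by (intro mult_left_mono) auto
  also have "\<dots> = \<epsilon> / 4"
    using n \<epsilon> by (simp add: exp_minus field_simps)
  finally have num: "real n * exp (- (real k * rate_upper \<delta>)) \<le> \<epsilon> / 4" .
  \<comment> \<open>The lower tail decays at least as fast, so the bound for the upper tail serves
    for both.\<close>
  have "real n * exp (- (real k * rate_lower \<delta>)) \<le> real n * exp (- (real k * rate_upper \<delta>))"
    using rate_upper_le_lower[of \<delta>] \<delta> by (intro mult_left_mono) (auto intro: mult_left_mono)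
  note num2 = order_trans[OF this num]
  have "(\<Sum>a\<in>PiE ?S (\<lambda>_. ?I). (\<Prod>x\<in>?S. p x (a x)) * of_bool (\<not> well_sampled q n k \<delta> a))
    \<le> (\<Sum>a\<in>PiE ?S (\<lambda>_. ?I). (\<Prod>x\<in>?S. p x (a x)) *
        (of_bool (?bad ?up ((1 + \<delta>) * real k) a) + of_bool (?bad ?lo ((1 - \<delta>) * real k) a)))"
  proof (intro sum_mono mult_left_mono prod_nonneg)
    fix a
    have "?bad ?up ((1 + \<delta>) * real k) a \<or> ?bad ?lo ((1 - \<delta>) * real k) a" if "\<not> well_sampled q n k \<delta> a"
    proof -
      note bad = that
      obtain u where u: "nsq n u = 1"
        "sample_form q n k a u < (1 - \<delta>) * real k \<or> sample_form q n k a u > (1 + \<delta>) * real k"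
        using not_well_sampled[OF bad] by blast
      have "?up > 0" "?lo < 0"
        using \<delta> by (auto simp: ln_less_zero_iff)
      with u show ?thesis
        by (auto intro!: exI[of _ u] mult_left_mono mult_left_mono_neg)
    qed
    then show "of_bool (\<not> well_sampled q n k \<delta> a) \<le> (of_bool (?bad ?up ((1 + \<delta>) * real k) a) +
        of_bool (?bad ?lo ((1 - \<delta>) * real k) a) :: real)"
      by (auto simp: of_bool_def)
  qed (use p in auto)
  also have "\<dots> = (\<Sum>a\<in>PiE ?S (\<lambda>_. ?I). (\<Prod>x\<in>?S. p x (a x)) * of_bool (?bad ?up ((1 + \<delta>) * real k) a))
      + (\<Sum>a\<in>PiE ?S (\<lambda>_. ?I). (\<Prod>x\<in>?S. p x (a x)) * of_bool (?bad ?lo ((1 - \<delta>) * real k) a))"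
    by (simp only: distrib_left sum.distrib)
  also have "\<dots> \<le> real n * exp ((exp ?up - 1) * real k - ?up * ((1 + \<delta>) * real k))
      + real n * exp ((exp ?lo - 1) * real k - ?lo * ((1 - \<delta>) * real k))"
    by (intro add_mono tail)
  also have "(exp ?up - 1) * real k - ?up * ((1 + \<delta>) * real k) = - (real k * rate_upper \<delta>)"
    using \<delta> by (simp add: rate_upper_def algebra_simps)
  also have "(exp ?lo - 1) * real k - ?lo * ((1 - \<delta>) * real k) = - (real k * rate_lower \<delta>)"
    using \<delta> by (simp add: rate_lower_def algebra_simps)
  finally show ?thesis
    using num num2 unfolding p_def by linarith
qed

section \<open>Stability of a random grid\<close>

lemma countable_dense_vectors:
  "\<exists>C :: cvector set. countable C \<and>
    (\<forall>d. \<exists>f. range f \<subseteq> C \<and> (\<forall>i<n. (\<lambda>j. f j i) \<longlonglongrightarrow> d i))"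
proof -
  obtain D :: "complex set" where D: "countable D" "\<And>X. open X \<Longrightarrow> X \<noteq> {} \<Longrightarrow> \<exists>d\<in>D. d \<in> X"
    by (rule countable_dense_setE) blast
  define v where "v xs i = (if i < length xs then xs ! i else 0)" for xs :: "complex list" and i
  have "\<exists>f. range f \<subseteq> v ` lists D \<and> (\<forall>i<n. (\<lambda>j. f j i) \<longlonglongrightarrow> d i)" for d :: cvector
  proof -
    have "\<exists>y\<in>D. y \<in> ball (d i) (1 / real (Suc j))" for i j
      by (rule D(2)) auto
    then have ex: "\<exists>y. y \<in> D \<and> y \<in> ball (d i) (1 / real (Suc j))" for i j
      by blast
    define g where "g i j = (SOME y. y \<in> D \<and> y \<in> ball (d i) (1 / real (Suc j)))" for i j
    have g: "g i j \<in> D" "g i j \<in> ball (d i) (1 / real (Suc j))" for i j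
      using someI_ex[OF ex[of i j]] unfolding g_def by blast+
    have "(\<lambda>j. v (map (\<lambda>i. g i j) [0..<n]) i) \<longlonglongrightarrow> d i" if "i < n" for i
    proof -
      have "(\<lambda>j. dist (g i j) (d i)) \<longlonglongrightarrow> 0"
      proof (rule tendsto_sandwich[OF _ _ tendsto_const LIMSEQ_inverse_real_of_nat])
        show "\<forall>\<^sub>F j in sequentially. dist (g i j) (d i) \<le> inverse (real (Suc j))"
          using g(2) by (auto intro!: always_eventually less_imp_le simp: dist_commute inverse_eq_divide)
      qed auto
      then show ?thesis
        using that by (subst tendsto_dist_iff) (simp add: v_def)
    qed
    then show ?thesis
      using g(1) by (intro exI[of _ "\<lambda>j. v (map (\<lambda>i. g i j) [0..<n])"]) (auto intro!: imageI)
  qed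
  moreover have "countable (v ` lists D)"
    using D(1) by simp
  ultimately show ?thesis
    by blast
qed

text \<open>A condition that survives coordinatewise limits has to be tested on a countable dense
  set of vectors only. Without this the quantifier over all coefficient vectors would be an
  uncountable intersection.\<close>

lemma sets_Collect_all_vectors:
  assumes "\<And>d :: cvector. {x \<in> space M. P d x} \<in> sets M"
    and "\<And>x d f. x \<in> space M \<Longrightarrow> (\<And>j. P (f j) x) \<Longrightarrow> (\<And>i. i < n \<Longrightarrow> (\<lambda>j. f j i) \<longlonglongrightarrow> d i) \<Longrightarrow> P d x"
  shows "{x \<in> space M. \<forall>d. P d x} \<in> sets M"
proof -
  obtain C :: "cvector set" where C: "countable C"
    "\<And>d. \<exists>f. range f \<subseteq> C \<and> (\<forall>i<n. (\<lambda>j. f j i) \<longlonglongrightarrow> d i)"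
    using countable_dense_vectors[of n] by blast
  have "P d x" if "x \<in> space M" "\<forall>d\<in>C. P d x" for d x
  proof -
    obtain f where "range f \<subseteq> C" "\<forall>i<n. (\<lambda>j. f j i) \<longlonglongrightarrow> d i"
      using C(2) by blast
    with that show ?thesis
      by (intro assms(2)[of x f d]) auto
  qed
  then have "{x \<in> space M. \<forall>d. P d x} = {x \<in> space M. \<forall>d\<in>C. P d x}"
    by auto
  also have "\<dots> \<in> sets M"
    by (rule sets.sets_Collect_countable_All'[OF assms(1) C(1)])
  finally show ?thesis .
qed

section \<open>Trace exponential of a random grid and the lower tail\<close>

lemma borel_measurable_trexp:
  assumes "\<And>i j. i < n \<Longrightarrow> j < n \<Longrightarrow> (\<lambda>x. A x i j) \<in> borel_measurable M"
  shows "(\<lambda>x. trexp n (A x)) \<in> borel_measurable M"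
proof -
  have "(\<lambda>x. powm n (A x) m i j) \<in> borel_measurable M" if "i < n" "j < n" for m i j
    using that(1)
  proof (induction m arbitrary: i)
    case 0
    then show ?case by (simp add: powm_def)
  next
    case (Suc m)
    have "(\<lambda>x. \<Sum>k<n. A x i k * powm n (A x) m k j) \<in> borel_measurable M"
      by (intro borel_measurable_sum borel_measurable_times assms Suc) (use Suc.prems in auto)
    then show ?case
      by (simp add: powm_def mm_def)
  qed
  then have "(\<lambda>x. Re (tr n (powm n (A x) m)) / fact m) \<in> borel_measurable M" for m
    unfolding tr_def
    by (intro borel_measurable_divide borel_measurable_const borel_measurable_sum
        measurable_compose[OF _ borel_measurable_Re]) auto
  then show ?thesis
    unfolding trexp_def by (rule borel_measurable_suminf)
qed

definition poly_at :: "nat \<Rightarrow> (nat \<Rightarrow> 'a \<Rightarrow> complex) \<Rightarrow> cvector \<Rightarrow> 'a \<Rightarrow> complex" where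
  "poly_at n \<phi> d x = (\<Sum>b<n. \<phi> b x * d b)"

lemma borel_measurable_trexp_rows:
  assumes "\<And>b. b < n \<Longrightarrow> \<phi> b \<in> borel_measurable \<rho>"
  shows "(\<lambda>z. trexp n (plus_scaled (\<lambda>_ _. 0) \<theta> (msum S (\<lambda>i. row_projection (\<lambda>b. \<phi> b (z i)) B))))
    \<in> borel_measurable (\<Pi>\<^sub>M i\<in>S. \<rho>)"
proof (rule borel_measurable_trexp)
  fix a b assume ab: "a < n" "b < n"
  have *: "(\<lambda>z. \<phi> a (z i)) \<in> borel_measurable (\<Pi>\<^sub>M i\<in>S. \<rho>)" if "a < n" "i \<in> S" for a i
    using assms[OF that(1)] measurable_component_singleton[OF that(2), of "\<lambda>_. \<rho>"]
    by (rule measurable_compose[rotated])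
  have "(\<lambda>z. cnj (\<phi> a (z i))) \<in> borel_measurable (\<Pi>\<^sub>M i\<in>S. \<rho>)" if "i \<in> S" for i
    by (rule measurable_compose[OF *[OF ab(1) that] borel_measurable_continuous_onI])
      (intro continuous_intros)
  with *[OF ab(2)] show "(\<lambda>z. plus_scaled (\<lambda>_ _. 0) \<theta> (msum S (\<lambda>i. row_projection (\<lambda>b. \<phi> b (z i)) B)) a b)
      \<in> borel_measurable (\<Pi>\<^sub>M i\<in>S. \<rho>)"
    unfolding plus_scaled_def msum_def row_projection_def
    by (intro borel_measurable_add borel_measurable_times borel_measurable_const
        borel_measurable_sum borel_measurable_divide) auto
qed

text \<open>One grid point is integrated out at a time. Isometry makes the mean of X equal to the
  identity divided by B, so the bound of \<open>trexp_plus_contraction_le\<close> integrates to the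
  old trace times the scalar 1 + (exp \<theta> - 1)/B. Here \<rho> is arbitrary, whereas
  \<open>trexp_mean_le\<close> concerns finite averages.\<close>

lemma iid_trexp_le:
  assumes \<rho>: "prob_space \<rho>" and \<phi>: "\<And>b. b < n \<Longrightarrow> \<phi> b \<in> borel_measurable \<rho>"
    and int: "\<And>d. integrable \<rho> (\<lambda>x. (cmod (poly_at n \<phi> d x))\<^sup>2)"
    and iso: "\<And>d. (\<integral>x. (cmod (poly_at n \<phi> d x))\<^sup>2 \<partial>\<rho>) = nsq n d"
    and B: "\<And>x. x \<in> space \<rho> \<Longrightarrow> (\<Sum>b<n. (cmod (\<phi> b x))\<^sup>2) \<le> B" "0 < B"
    and S: "finite S"
  defines "X \<equiv> \<lambda>x. row_projection (\<lambda>b. \<phi> b x) B"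
  shows "(\<integral>\<^sup>+z. ennreal (trexp n (plus_scaled (\<lambda>_ _. 0) \<theta> (msum S (\<lambda>i. X (z i))))) \<partial>(\<Pi>\<^sub>M i\<in>S. \<rho>))
    \<le> ennreal (real n * exp (real (card S) * ((exp \<theta> - 1) / B)))"
  using S
proof (induction S)
  case empty
  have "eqm n (plus_scaled (\<lambda>_ _. 0) \<theta> (msum {} (\<lambda>i. X (z i)))) (dg (\<lambda>_. of_real 0))" for z :: "'b \<Rightarrow> 'a"
    by (simp add: eqm_def plus_scaled_def msum_def dg_def)
  from trexp_eqm[OF this spec_hermitian[OF spec_scaled_identity]]
  have "trexp n (plus_scaled (\<lambda>_ _. 0) \<theta> (msum {} (\<lambda>i. X (z i)))) = real n" for z :: "'b \<Rightarrow> 'a"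
    unfolding trexp_scaled_identity by simp
  then show ?case
    by (simp add: prob_space.emeasure_space_1[OF prob_space_PiM[OF \<rho>]])
next
  case (insert s S)
  interpret prob_space \<rho> by fact
  interpret product_sigma_finite "\<lambda>_. \<rho>" by standard
  let ?O = "\<lambda>_ _. 0 :: complex" and ?g = "exp \<theta> - 1"
  let ?H = "\<lambda>z. plus_scaled ?O \<theta> (msum S (\<lambda>i. X (z i)))"
  have hX: "hermitian n (X x)" for x
    by (simp add: X_def hermitian_def row_projection_def mult.commute)
  have cX: "contraction n (X x)" if "x \<in> space \<rho>" for x
    unfolding X_def by (intro contraction_row_projection B that)
  have hH: "hermitian n (?H z)" for z
    by (intro hermitian_plus_scaled hermitian_msum hX) (simp add: hermitian_def)
  have "(\<integral>\<^sup>+z. ennreal (trexp n (plus_scaled ?O \<theta> (msum (insert s S) (\<lambda>i. X (z i))))) \<partial>(\<Pi>\<^sub>M i\<in>insert s S. \<rho>))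
    = (\<integral>\<^sup>+z. (\<integral>\<^sup>+x. ennreal (trexp n (plus_scaled ?O \<theta> (msum (insert s S) (\<lambda>i. X ((z(s := x)) i))))) \<partial>\<rho>) \<partial>(\<Pi>\<^sub>M i\<in>S. \<rho>))"
  proof (rule product_nn_integral_insert[OF insert.hyps])
    show "(\<lambda>z. ennreal (trexp n (plus_scaled ?O \<theta> (msum (insert s S) (\<lambda>i. X (z i)))))) \<in>
        borel_measurable (\<Pi>\<^sub>M i\<in>insert s S. \<rho>)"
      unfolding X_def by (intro measurable_compose[OF _ measurable_ennreal] borel_measurable_trexp_rows \<phi>)
  qed
  also have "\<dots> = (\<integral>\<^sup>+z. (\<integral>\<^sup>+x. ennreal (trexp n (plus_scaled (?H z) \<theta> (X x))) \<partial>\<rho>) \<partial>(\<Pi>\<^sub>M i\<in>S. \<rho>))"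
  proof -
    have "msum S (\<lambda>i. X ((z(s := x)) i)) = msum S (\<lambda>i. X (z i))" for z x
      unfolding msum_def using insert.hyps by (intro ext sum.cong) auto
    then have "plus_scaled ?O \<theta> (msum (insert s S) (\<lambda>i. X ((z(s := x)) i))) = plus_scaled (?H z) \<theta> (X x)" for z x
      unfolding plus_scaled_msum_insert[OF insert.hyps] plus_scaled_commute[of ?O \<theta> _ \<theta> "msum S _"] by simp
    then show ?thesis by simp
  qed
  also have "\<dots> \<le> (\<integral>\<^sup>+z. ennreal (trexp n (?H z)) * ennreal (exp (?g / B)) \<partial>(\<Pi>\<^sub>M i\<in>S. \<rho>))"
  proof (rule nn_integral_mono)
    fix z
    \<comment> \<open>The eigendecomposition is chosen separately for each z and occurs only inside
      a pointwise estimate, so it need not depend measurably on z.\<close>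
    obtain \<eta> E where H: "spec n (?H z) \<eta> E"
      using spectral_theorem[OF hH] by blast
    let ?h = "\<lambda>x. \<Sum>k<n. exp (\<eta> k) * (1 + ?g * qf n (X x) (column E k))"
    have qfX: "qf n (X x) u = (cmod (poly_at n \<phi> u x))\<^sup>2 / B" for x u
      by (simp add: X_def qf_row_projection poly_at_def)
    have le: "trexp n (plus_scaled (?H z) \<theta> (X x)) \<le> ?h x" if "x \<in> space \<rho>" for x
      by (rule trexp_plus_contraction_le[OF H cX[OF that]])
    have ih: "integrable \<rho> ?h"
      unfolding qfX
      by (intro Bochner_Integration.integrable_sum integrable_mult_right Bochner_Integration.integrable_add
          integrable_const integrable_divide int)
    have "(\<integral>\<^sup>+x. ennreal (trexp n (plus_scaled (?H z) \<theta> (X x))) \<partial>\<rho>) \<le> (\<integral>\<^sup>+x. ennreal (?h x) \<partial>\<rho>)"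
      by (intro nn_integral_mono ennreal_leI le)
    also have "\<dots> = ennreal (\<integral>x. ?h x \<partial>\<rho>)"
      by (intro nn_integral_eq_integral[OF ih] AE_I2
          order_trans[OF trexp_nonneg[OF hermitian_plus_scaled[OF hH hX]] le])
    also have "(\<integral>x. ?h x \<partial>\<rho>) = (\<Sum>k<n. exp (\<eta> k) * (1 + ?g * (nsq n (column E k) / B)))"
    proof -
      have i: "integrable \<rho> (\<lambda>x. 1 + ?g * qf n (X x) u)" for u
        unfolding qfX
        by (intro integrable_mult_right Bochner_Integration.integrable_add
            integrable_const integrable_divide int)
      have "(\<integral>x. 1 + ?g * qf n (X x) u \<partial>\<rho>) = 1 + ?g * (nsq n u / B)" for u
        unfolding qfX using int[of u]
        by (subst Bochner_Integration.integral_add) (auto simp: iso prob_space)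
      then show ?thesis
        by (subst Bochner_Integration.integral_sum) (auto intro!: integrable_mult_right i)
    qed
    also have "\<dots> = trexp n (?H z) * (1 + ?g / B)"
      by (simp add: nsq_column[OF specD(1)[OF H]] trexp_spec[OF H] sum_distrib_right)
    also have "\<dots> \<le> trexp n (?H z) * exp (?g / B)"
      by (intro mult_left_mono exp_ge_add_one_self trexp_nonneg hH)
    finally show "(\<integral>\<^sup>+x. ennreal (trexp n (plus_scaled (?H z) \<theta> (X x))) \<partial>\<rho>) \<le>
        ennreal (trexp n (?H z)) * ennreal (exp (?g / B))"
      using trexp_nonneg[OF hH] by (simp add: ennreal_leI flip: ennreal_mult)
  qed
  also have "\<dots> \<le> ennreal (real n * exp (real (card S) * (?g / B))) * ennreal (exp (?g / B))"
  proof (subst nn_integral_multc)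
    show "(\<lambda>z. ennreal (trexp n (?H z))) \<in> borel_measurable (\<Pi>\<^sub>M i\<in>S. \<rho>)"
      unfolding X_def by (intro measurable_compose[OF _ measurable_ennreal] borel_measurable_trexp_rows \<phi>)
    show "(\<integral>\<^sup>+z. ennreal (trexp n (?H z)) \<partial>(\<Pi>\<^sub>M i\<in>S. \<rho>)) * ennreal (exp (?g / B)) \<le>
      ennreal (real n * exp (real (card S) * (?g / B))) * ennreal (exp (?g / B))"
      by (intro mult_right_mono insert.IH) auto
  qed
  also have "\<dots> = ennreal (real n * exp (real (card (insert s S)) * (?g / B)))"
  proof -
    have "exp (real (card S) * c) * exp c = exp (real (card (insert s S)) * c)" for c
      using insert.hyps by (simp add: algebra_simps exp_add)
    from this[of "?g / B"] show ?thesis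
      by (simp only: ennreal_mult[symmetric] mult.assoc exp_ge_zero of_nat_0_le_iff mult_nonneg_nonneg)
  qed
  finally show ?case .
qed

text \<open>Only the lower half of a norm equivalence: it suffices for full rank and for bounding
  the \<rho>-norm by the grid norm, and it costs a single tail.\<close>

definition stable_grid :: "'a measure \<Rightarrow> nat \<Rightarrow> (nat \<Rightarrow> 'a \<Rightarrow> complex) \<Rightarrow> nat \<Rightarrow> real \<Rightarrow> (nat \<Rightarrow> 'a) \<Rightarrow> bool" where
  "stable_grid \<rho> n \<psi> K \<delta> z \<longleftrightarrow> (\<forall>d. (1 - \<delta>) * real K * (\<integral>x. (cmod (poly_at n \<psi> d x))\<^sup>2 \<partial>\<rho>)
     \<le> (\<Sum>i<K. (cmod (poly_at n \<psi> d (z i)))\<^sup>2))"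

text \<open>The unstable grids are enclosed in a superlevel set of \<open>trexp\<close>, which is
  measurable at once and whose measure Markov's inequality bounds by
  \<open>iid_trexp_le\<close>.\<close>

lemma isometric_grid_failure:
  assumes \<rho>: "prob_space \<rho>" and \<phi>: "\<And>b. b < n \<Longrightarrow> \<phi> b \<in> borel_measurable \<rho>"
    and int: "\<And>d. integrable \<rho> (\<lambda>x. (cmod (poly_at n \<phi> d x))\<^sup>2)"
    and iso: "\<And>d. (\<integral>x. (cmod (poly_at n \<phi> d x))\<^sup>2 \<partial>\<rho>) = nsq n d"
    and B: "\<And>x. x \<in> space \<rho> \<Longrightarrow> (\<Sum>b<n. (cmod (\<phi> b x))\<^sup>2) \<le> B" "0 < B"
    and \<delta>: "0 < \<delta>" "\<delta> < 1"
  shows "\<exists>A\<in>sets (\<Pi>\<^sub>M i\<in>{..<K}. \<rho>). measure (\<Pi>\<^sub>M i\<in>{..<K}. \<rho>) A \<le> real n * exp (- (real K / B * rate_lower \<delta>)) \<and>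
    {z \<in> space (\<Pi>\<^sub>M i\<in>{..<K}. \<rho>). \<not> stable_grid \<rho> n \<phi> K \<delta> z} \<subseteq> A"
proof -
  let ?P = "\<Pi>\<^sub>M i\<in>{..<K}. \<rho>"
  interpret P: prob_space ?P by (rule prob_space_PiM[OF \<rho>])
  define X where "X x = row_projection (\<lambda>b. \<phi> b x) B" for x
  \<comment> \<open>The optimal exponent for the lower tail; \<tau> below is the stability threshold
    divided by B, since the summands carry the factor 1 / B.\<close>
  define \<theta> where "\<theta> = ln (1 - \<delta>)"
  define \<tau> where "\<tau> = (1 - \<delta>) * real K / B"
  let ?O = "\<lambda>_ _. 0 :: complex"
  let ?Z = "\<lambda>z. msum {..<K} (\<lambda>i. X (z i))"
  let ?T = "\<lambda>z. trexp n (plus_scaled ?O \<theta> (?Z z))"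
  define A where "A = {z \<in> space ?P. exp (\<theta> * \<tau>) \<le> ?T z}"
  have \<theta>: "\<theta> < 0" using \<delta> by (simp add: \<theta>_def)
  have hT: "hermitian n (plus_scaled ?O \<theta> (?Z z))" for z
    by (intro hermitian_plus_scaled hermitian_msum)
      (simp_all add: X_def hermitian_def row_projection_def mult.commute)
  have mT: "?T \<in> borel_measurable ?P"
    unfolding X_def by (rule borel_measurable_trexp_rows[OF \<phi>])
  then have A: "A \<in> sets ?P"
    unfolding A_def by measurable
  have "emeasure ?P A \<le> ennreal (exp (- \<theta> * \<tau>)) * (\<integral>\<^sup>+z. ennreal (?T z) \<partial>?P)"
  proof -
    have "A = {z \<in> space ?P. 1 \<le> ennreal (exp (- \<theta> * \<tau>)) * ennreal (?T z)}"
    proof -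
      have "(exp (\<theta> * \<tau>) \<le> t) = (1 \<le> ennreal (exp (- \<theta> * \<tau>)) * ennreal t)" if "t \<ge> 0" for t
      proof -
        have "(1 \<le> ennreal (exp (- \<theta> * \<tau>)) * ennreal t) = (1 \<le> exp (- \<theta> * \<tau>) * t)"
          using that by (simp add: ennreal_mult[symmetric])
        also have "\<dots> = (exp (\<theta> * \<tau>) \<le> t)"
          by (simp add: exp_minus field_simps)
        finally show ?thesis by simp
      qed
      from this[OF trexp_nonneg[OF hT]] show ?thesis
        unfolding A_def by (intro Collect_cong conj_cong refl)
    qed
    moreover have "emeasure ?P {z \<in> space ?P. 1 \<le> ennreal (exp (- \<theta> * \<tau>)) * ennreal (?T z)}
        \<le> ennreal (exp (- \<theta> * \<tau>)) * (\<integral>\<^sup>+z. ennreal (?T z) * indicator (space ?P) z \<partial>?P)"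
      using nn_integral_Markov_inequality[of "\<lambda>z. ennreal (?T z)" "space ?P" ?P "ennreal (exp (- \<theta> * \<tau>))"] mT
      by simp
    moreover have "(\<integral>\<^sup>+z. ennreal (?T z) * indicator (space ?P) z \<partial>?P) = (\<integral>\<^sup>+z. ennreal (?T z) \<partial>?P)"
      by (rule nn_integral_cong) simp
    ultimately show ?thesis
      by (simp only:)
  qed
  also have "\<dots> \<le> ennreal (exp (- \<theta> * \<tau>)) * ennreal (real n * exp (real (card {..<K}) * ((exp \<theta> - 1) / B)))"
    unfolding X_def by (intro mult_left_mono iid_trexp_le \<rho> \<phi> int iso B) auto
  also have "\<dots> = ennreal (real n * exp (- (real K / B * rate_lower \<delta>)))"
  proof -
    have "- \<theta> * \<tau> + real K * ((exp \<theta> - 1) / B) = - (real K / B * rate_lower \<delta>)"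
      using \<delta> B(2) by (simp add: \<theta>_def \<tau>_def rate_lower_def field_simps)
    then show ?thesis
      by (simp only: ennreal_mult[symmetric] mult.left_commute exp_ge_zero of_nat_0_le_iff
          mult_nonneg_nonneg exp_add[symmetric] card_lessThan)
  qed
  finally have "measure ?P A \<le> real n * exp (- (real K / B * rate_lower \<delta>))"
    by (simp add: P.emeasure_eq_measure)
  moreover have "z \<in> A" if z: "z \<in> space ?P" and bad: "\<not> stable_grid \<rho> n \<phi> K \<delta> z" for z
  proof -
    let ?s = "\<lambda>d. \<Sum>i<K. (cmod (poly_at n \<phi> d (z i)))\<^sup>2"
    obtain d where d: "?s d < (1 - \<delta>) * real K * nsq n d"
      using bad unfolding stable_grid_def iso by (auto simp: not_le)
    have "nsq n d \<noteq> 0"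
      using d sum_nonneg[of "{..<K}" "\<lambda>i. (cmod (poly_at n \<phi> d (z i)))\<^sup>2"] by auto
    from exists_normalizing_factor[OF this] obtain t
      where t: "t\<^sup>2 * nsq n d = 1" "t > 0" and u: "nsq n (\<lambda>b. of_real t * d b) = 1"
      by blast
    define u where "u = (\<lambda>b. of_real t * d b)"
    have u1: "nsq n u = 1"
      using u by (simp add: u_def)
    have "poly_at n \<phi> u x = of_real t * poly_at n \<phi> d x" for x
      unfolding poly_at_def u_def sum_distrib_left by (simp only: mult.left_commute)
    then have "?s u = t\<^sup>2 * ?s d"
      by (simp add: norm_mult power_mult_distrib sum_distrib_left)
    also have "\<dots> < t\<^sup>2 * ((1 - \<delta>) * real K * nsq n d)"
      using d t(2) by simp
    also have "\<dots> = (1 - \<delta>) * real K"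
      using t(1) by (simp add: mult.left_commute mult.assoc)
    finally have s: "?s u < (1 - \<delta>) * real K" .
    have "qf n (?Z z) u = ?s u / B"
      unfolding qf_msum by (simp add: X_def qf_row_projection poly_at_def sum_divide_distrib)
    also have "\<dots> < \<tau>"
      using s B(2) by (simp add: \<tau>_def divide_strict_right_mono)
    finally have "\<theta> * \<tau> \<le> \<theta> * qf n (?Z z) u"
      using \<theta> by (intro mult_left_mono_neg) auto
    then have "exp (\<theta> * \<tau>) \<le> ?T z"
      by (intro trexp_ge[OF hT u1]) (simp add: qf_plus_scaled, simp add: qf_def ip_def mv_def)
    with z show ?thesis
      by (simp add: A_def)
  qed
  ultimately show ?thesis
    using A by blast
qed

section \<open>Reduction of a general basis to the isometric case\<close>

lemma gram_matrix:
  assumes \<psi>: "\<And>b. b < n \<Longrightarrow> \<psi> b \<in> borel_measurable \<rho>"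
    and int: "\<And>b. b < n \<Longrightarrow> integrable \<rho> (\<lambda>x. (cmod (\<psi> b x))\<^sup>2)"
  defines "G \<equiv> \<lambda>a b. \<integral>x. cnj (\<psi> a x) * \<psi> b x \<partial>\<rho>"
  shows "hermitian n G" "integrable \<rho> (\<lambda>x. (cmod (poly_at n \<psi> d x))\<^sup>2)"
    "qf n G d = (\<integral>x. (cmod (poly_at n \<psi> d x))\<^sup>2 \<partial>\<rho>)"
proof -
  have prod: "integrable \<rho> (\<lambda>x. cnj (\<psi> a x) * \<psi> b x)" if "a < n" "b < n" for a b
  proof (rule Bochner_Integration.integrable_bound)
    show "integrable \<rho> (\<lambda>x. (cmod (\<psi> a x))\<^sup>2 + (cmod (\<psi> b x))\<^sup>2)"
      by (intro Bochner_Integration.integrable_add int that)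
    have "(\<lambda>x. cnj (\<psi> a x)) \<in> borel_measurable \<rho>"
      by (rule measurable_compose[OF \<psi>[OF that(1)] borel_measurable_continuous_onI]) (intro continuous_intros)
    then show "(\<lambda>x. cnj (\<psi> a x) * \<psi> b x) \<in> borel_measurable \<rho>"
      by (intro borel_measurable_times \<psi> that)
    have "s * t \<le> s\<^sup>2 + t\<^sup>2" for s t :: real
      using sum_squares_bound[of s t] zero_le_power2[of s] zero_le_power2[of t] by linarith
    then show "AE x in \<rho>. norm (cnj (\<psi> a x) * \<psi> b x) \<le> norm ((cmod (\<psi> a x))\<^sup>2 + (cmod (\<psi> b x))\<^sup>2)"
      by (simp add: norm_mult)
  qed
  have "cnj (G a b) = G b a" for a b
    unfolding G_def by (simp add: mult.commute flip: Bochner_Integration.integral_cnj)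
  then show "hermitian n G"
    by (simp add: hermitian_def)
  have sq: "complex_of_real ((cmod (poly_at n \<psi> d x))\<^sup>2) =
      (\<Sum>a<n. \<Sum>b<n. cnj (d a) * d b * (cnj (\<psi> a x) * \<psi> b x))" for x
  proof -
    have "complex_of_real ((cmod (poly_at n \<psi> d x))\<^sup>2) = cnj (poly_at n \<psi> d x) * poly_at n \<psi> d x"
      by (simp add: complex_norm_square mult.commute del: of_real_power)
    also have "\<dots> = (\<Sum>a<n. \<Sum>b<n. cnj (d a) * d b * (cnj (\<psi> a x) * \<psi> b x))"
      unfolding poly_at_def cnj_sum sum_product by (intro sum.cong refl) simp
    finally show ?thesis .
  qed
  have int2: "integrable \<rho> (\<lambda>x. \<Sum>a<n. \<Sum>b<n. cnj (d a) * d b * (cnj (\<psi> a x) * \<psi> b x))"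
    by (intro Bochner_Integration.integrable_sum integrable_mult_right prod) auto
  then have "integrable \<rho> (\<lambda>x. complex_of_real ((cmod (poly_at n \<psi> d x))\<^sup>2))"
    unfolding sq .
  from integrable_Re[OF this] show "integrable \<rho> (\<lambda>x. (cmod (poly_at n \<psi> d x))\<^sup>2)"
    by simp
  have "ip n d (mv n G d) = (\<Sum>a<n. \<Sum>b<n. cnj (d a) * d b * (\<integral>x. cnj (\<psi> a x) * \<psi> b x \<partial>\<rho>))"
    unfolding ip_def mv_def G_def sum_distrib_left by (intro sum.cong refl) simp
  also have "\<dots> = (\<integral>x. (\<Sum>a<n. \<Sum>b<n. cnj (d a) * d b * (cnj (\<psi> a x) * \<psi> b x)) \<partial>\<rho>)"
    by (subst Bochner_Integration.integral_sum,
        intro Bochner_Integration.integrable_sum integrable_mult_right prod, simp, simp,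
        intro sum.cong refl, subst Bochner_Integration.integral_sum,
        intro integrable_mult_right prod, simp, simp, intro sum.cong refl, simp)
  also have "\<dots> = (\<integral>x. complex_of_real ((cmod (poly_at n \<psi> d x))\<^sup>2) \<partial>\<rho>)"
    unfolding sq ..
  also have "\<dots> = of_real (\<integral>x. (cmod (poly_at n \<psi> d x))\<^sup>2 \<partial>\<rho>)"
    by (rule integral_complex_of_real)
  finally show "qf n G d = (\<integral>x. (cmod (poly_at n \<psi> d x))\<^sup>2 \<partial>\<rho>)"
    by (simp add: qf_def)
qed

text \<open>The case of an isometric family applied to the whitened functions
  \<open>\<phi> k = (\<Sum>b. U b k * \<psi> b) / sqrt (l k)\<close>, with \<open>(l, U)\<close> the spectral decomposition of the Gram matrix.\<close>

theorem grid_failure_le: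
  assumes \<rho>: "prob_space \<rho>" and \<psi>: "\<And>b. b < n \<Longrightarrow> \<psi> b \<in> borel_measurable \<rho>"
    and int: "\<And>b. b < n \<Longrightarrow> integrable \<rho> (\<lambda>x. (cmod (\<psi> b x))\<^sup>2)"
    and indep: "\<And>d b. (\<integral>x. (cmod (poly_at n \<psi> d x))\<^sup>2 \<partial>\<rho>) = 0 \<Longrightarrow> b < n \<Longrightarrow> d b = 0"
    and B: "\<And>d x. x \<in> space \<rho> \<Longrightarrow> (cmod (poly_at n \<psi> d x))\<^sup>2 \<le> B * (\<integral>x. (cmod (poly_at n \<psi> d x))\<^sup>2 \<partial>\<rho>)" "0 < B"
    and \<delta>: "0 < \<delta>" "\<delta> < 1"
  shows "\<exists>A\<in>sets (\<Pi>\<^sub>M i\<in>{..<K}. \<rho>). measure (\<Pi>\<^sub>M i\<in>{..<K}. \<rho>) A \<le> real n * exp (- (real K / B * rate_lower \<delta>)) \<and>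
    {z \<in> space (\<Pi>\<^sub>M i\<in>{..<K}. \<rho>). \<not> stable_grid \<rho> n \<psi> K \<delta> z} \<subseteq> A"
proof -
  define G where "G = (\<lambda>a b. \<integral>x. cnj (\<psi> a x) * \<psi> b x \<partial>\<rho>)"
  note gram = gram_matrix[where n = n and \<psi> = \<psi> and \<rho> = \<rho>, OF \<psi> int, folded G_def]
  obtain l U where G: "spec n G l U"
    using spectral_theorem[OF gram(1)] by blast
  note U = specD(1)[OF G]
  \<comment> \<open>An eigenvalue of the Gram matrix is the squared norm of the function with the
    eigenvector as coefficients, and independence excludes 0.\<close>
  have l: "l k > 0" if k: "k < n" for k
  proof -
    have "l k = (\<integral>x. (cmod (poly_at n \<psi> (column U k) x))\<^sup>2 \<partial>\<rho>)"
      using qf_eigenvector[OF G k] gram(3) by simp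
    moreover have "\<dots> \<ge> 0"
      by (intro integral_nonneg_AE) simp
    moreover have "\<dots> \<noteq> 0"
    proof
      assume "(\<integral>x. (cmod (poly_at n \<psi> (column U k) x))\<^sup>2 \<partial>\<rho>) = 0"
      from indep[OF this] have "nsq n (column U k) = 0"
        by (simp add: nsq_def)
      with nsq_column[OF U k] show False by simp
    qed
    ultimately show ?thesis by linarith
  qed
  define \<phi> where "\<phi> k x = poly_at n \<psi> (column U k) x / of_real (sqrt (l k))" for k x
  have poly_\<phi>: "poly_at n \<phi> d x = poly_at n \<psi> (\<lambda>b. \<Sum>k<n. U b k * (d k / of_real (sqrt (l k)))) x" for d x
  proof -
    have "poly_at n \<phi> d x = (\<Sum>k<n. \<Sum>b<n. \<psi> b x * (U b k * (d k / of_real (sqrt (l k)))))"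
      unfolding poly_at_def \<phi>_def by (simp add: sum_divide_distrib sum_distrib_right mult.assoc)
    also have "\<dots> = (\<Sum>b<n. \<Sum>k<n. \<psi> b x * (U b k * (d k / of_real (sqrt (l k)))))"
      by (rule sum.swap)
    finally show ?thesis
      by (simp add: poly_at_def sum_distrib_left)
  qed
  have iso: "(\<integral>x. (cmod (poly_at n \<phi> d x))\<^sup>2 \<partial>\<rho>) = nsq n d" for d
  proof -
    let ?e = "\<lambda>b. \<Sum>k<n. U b k * (d k / of_real (sqrt (l k)))"
    have ip: "ip n (column U j) ?e = d j / of_real (sqrt (l j))" if j: "j < n" for j
    proof -
      have "ip n (column U j) ?e = (\<Sum>b<n. \<Sum>k<n. cnj (U b j) * (U b k * (d k / of_real (sqrt (l k)))))"
        by (simp add: ip_def sum_distrib_left)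
      also have "\<dots> = (\<Sum>k<n. \<Sum>b<n. cnj (U b j) * (U b k * (d k / of_real (sqrt (l k)))))"
        by (rule sum.swap)
      also have "\<dots> = (\<Sum>k<n. ip n (column U j) (column U k) * (d k / of_real (sqrt (l k))))"
        unfolding ip_def sum_distrib_right by (simp only: mult.assoc)
      also have "\<dots> = (\<Sum>k<n. (if j = k then 1 else 0) * (d k / of_real (sqrt (l k))))"
        by (intro sum.cong refl) (simp add: ip_column_unitary[OF U j])
      also have "\<dots> = (\<Sum>k<n. if j = k then d k / of_real (sqrt (l k)) else 0)"
        by (intro sum.cong refl) simp
      finally show ?thesis
        using j by simp
    qed
    have "(\<integral>x. (cmod (poly_at n \<phi> d x))\<^sup>2 \<partial>\<rho>) = qf n G ?e"
      by (simp only: poly_\<phi> gram(3))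
    also have "\<dots> = (\<Sum>k<n. l k * (cmod (d k / of_real (sqrt (l k))))\<^sup>2)"
      unfolding qf_spec[OF G] by (intro sum.cong refl) (simp only: ip lessThan_iff)
    also have "\<dots> = nsq n d"
      unfolding nsq_def using l
      by (intro sum.cong refl) (simp add: norm_divide power_divide less_imp_le less_imp_neq[symmetric])
    finally show ?thesis .
  qed
  \<comment> \<open>The inverse change of coefficients: both families represent the same functions,
    so stability for one is stability for the other.\<close>
  have poly_\<psi>: "poly_at n \<psi> d x = poly_at n \<phi> (\<lambda>k. of_real (sqrt (l k)) * ip n (column U k) d) x" for d x
  proof -
    have "poly_at n \<phi> (\<lambda>k. of_real (sqrt (l k)) * ip n (column U k) d) x =
        (\<Sum>k<n. \<Sum>b<n. \<psi> b x * (U b k * ip n (column U k) d))"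
      unfolding poly_at_def \<phi>_def
    proof (intro sum.cong refl)
      fix k assume "k \<in> {..<n}"
      then have "complex_of_real (sqrt (l k)) \<noteq> 0"
        using l[of k] by simp
      then have cancel: "s / of_real (sqrt (l k)) * (of_real (sqrt (l k)) * y) = s * y" for s y :: complex
        by simp
      show "(\<Sum>b<n. \<psi> b x * U b k) / of_real (sqrt (l k)) * (of_real (sqrt (l k)) * ip n (column U k) d) =
          (\<Sum>b<n. \<psi> b x * (U b k * ip n (column U k) d))"
        unfolding cancel by (simp add: sum_distrib_right mult.assoc)
    qed
    also have "\<dots> = (\<Sum>b<n. \<Sum>k<n. \<psi> b x * (U b k * ip n (column U k) d))"
      by (rule sum.swap)
    also have "\<dots> = (\<Sum>b<n. \<psi> b x * d b)"
    proof (intro sum.cong refl)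
      fix b assume b: "b \<in> {..<n}"
      have "(\<Sum>k<n. U b k * ip n (column U k) d) = (\<Sum>k<n. \<Sum>a<n. U b k * cnj (U a k) * d a)"
        by (simp add: ip_def sum_distrib_left mult.assoc)
      also have "\<dots> = (\<Sum>a<n. mm n U (adj U) b a * d a)"
        by (subst sum.swap) (simp add: mm_def adj_def sum_distrib_right)
      also have "\<dots> = (\<Sum>a<n. (if b = a then 1 else 0) * d a)"
        using unitaryD1[OF U] b by (intro sum.cong refl) (simp add: eqm_def dg_def)
      finally have "(\<Sum>k<n. U b k * ip n (column U k) d) = d b"
        using b by (simp add: if_distrib[of "\<lambda>x. x * _"] cong: if_cong)
      then show "(\<Sum>k<n. \<psi> b x * (U b k * ip n (column U k) d)) = \<psi> b x * d b"
        by (simp flip: sum_distrib_left)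
    qed
    finally show ?thesis
      by (simp add: poly_at_def)
  qed
  have bound: "(\<Sum>b<n. (cmod (\<phi> b x))\<^sup>2) \<le> B" if x: "x \<in> space \<rho>" for x
  proof -
    \<comment> \<open>The coefficients \<open>?d\<close> are extremal for evaluation at x: the
      pointwise bound then reads s^2 \<le> B s, which bounds the reciprocal Christoffel function s
      by B.\<close>
    let ?s = "\<Sum>b<n. (cmod (\<phi> b x))\<^sup>2" and ?d = "\<lambda>b. cnj (\<phi> b x)"
    have "poly_at n \<phi> ?d x = of_real ?s"
      by (simp add: poly_at_def complex_norm_square del: of_real_power)
    then have "?s\<^sup>2 = (cmod (poly_at n \<phi> ?d x))\<^sup>2"
      by (simp only: norm_of_real power2_abs)
    also have "\<dots> \<le> B * nsq n ?d"
      using B(1)[OF x] unfolding iso[symmetric] poly_\<phi> .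
    also have "nsq n ?d = ?s"
      by (simp add: nsq_def)
    finally have "?s * ?s \<le> B * ?s"
      by (simp add: power2_eq_square)
    moreover have "?s \<ge> 0"
      by (intro sum_nonneg) simp
    ultimately show ?thesis
      using B(2) by (cases "?s = 0") (auto simp: mult_le_cancel_right)
  qed
  have stable: "stable_grid \<rho> n \<psi> K \<delta> z" if "stable_grid \<rho> n \<phi> K \<delta> z" for z
    using that unfolding stable_grid_def poly_\<psi> by blast
  have m\<phi>: "\<phi> b \<in> borel_measurable \<rho>" if "b < n" for b
    unfolding \<phi>_def poly_at_def
    by (intro borel_measurable_divide borel_measurable_sum borel_measurable_times borel_measurable_const \<psi>) auto
  have int\<phi>: "integrable \<rho> (\<lambda>x. (cmod (poly_at n \<phi> d x))\<^sup>2)" for d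
    unfolding poly_\<phi> by (rule gram(2))
  obtain A where "A \<in> sets (\<Pi>\<^sub>M i\<in>{..<K}. \<rho>)"
    "measure (\<Pi>\<^sub>M i\<in>{..<K}. \<rho>) A \<le> real n * exp (- (real K / B * rate_lower \<delta>))"
    "{z \<in> space (\<Pi>\<^sub>M i\<in>{..<K}. \<rho>). \<not> stable_grid \<rho> n \<phi> K \<delta> z} \<subseteq> A"
    using isometric_grid_failure[OF \<rho> m\<phi> int\<phi> iso bound B(2) \<delta>, of K] by blast
  then show ?thesis
    using stable by blast
qed

section \<open>Least squares and QR decompositions\<close>

lemma mat_adjoint_carrier [simp]: "A \<in> carrier_mat m n \<Longrightarrow> mat_adjoint A \<in> carrier_mat n m"
  unfolding mat_adjoint_def by (auto simp: mat_of_rows_def)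

lemma mat_adjoint_dim [simp]: "dim_row (mat_adjoint A) = dim_col A" "dim_col (mat_adjoint A) = dim_row A"
  unfolding mat_adjoint_def by (auto simp: mat_of_rows_def)

lemma mat_adjoint_index [simp]:
  assumes "i < dim_col A" "j < dim_row A"
  shows "mat_adjoint A $$ (i, j) = cnj (A $$ (j, i))"
  using assms unfolding mat_adjoint_def by (simp add: mat_of_rows_index)

lemma mat_adjoint_mult:
  assumes A: "A \<in> carrier_mat m n" and B: "B \<in> carrier_mat n p"
  shows "mat_adjoint (A * B) = mat_adjoint B * mat_adjoint (A :: complex mat)"
proof (rule eq_matI)
  fix i j assume "i < dim_row (mat_adjoint B * mat_adjoint A)" "j < dim_col (mat_adjoint B * mat_adjoint A)"
  then have ij: "i < p" "j < m" using A B by auto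
  then show "mat_adjoint (A * B) $$ (i, j) = (mat_adjoint B * mat_adjoint A) $$ (i, j)"
    using A B by (simp add: scalar_prod_def mult.commute)
qed (use A B in auto)

lemma mat_adjoint_adjoint [simp]: "mat_adjoint (mat_adjoint A) = (A :: complex mat)"
  by (rule eq_matI) auto

definition vip :: "complex Matrix.vec \<Rightarrow> complex Matrix.vec \<Rightarrow> complex" where
  "vip u v = (\<Sum>i<dim_vec u. cnj (vec_index u i) * vec_index v i)"

lemma vec_norm2_sq: "(vec_norm2 v)\<^sup>2 = (\<Sum>i<dim_vec v. (cmod (vec_index v i))\<^sup>2)"
  unfolding vec_norm2_def L2_set_def by (simp add: sum_nonneg)

lemma vec_norm2_nonneg [simp]: "0 \<le> vec_norm2 v"
  unfolding vec_norm2_def by (rule L2_set_nonneg)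

lemma vip_self: "vip v v = of_real ((vec_norm2 v)\<^sup>2)"
  unfolding vip_def vec_norm2_sq by (simp add: complex_norm_square mult.commute del: of_real_power)

lemma vec_norm2_eq_0:
  assumes "v \<in> carrier_vec n"
  shows "vec_norm2 v = 0 \<longleftrightarrow> v = 0\<^sub>v n"
proof
  assume "vec_norm2 v = 0"
  then have "(\<Sum>i<dim_vec v. (cmod (vec_index v i))\<^sup>2) = 0"
    by (simp flip: vec_norm2_sq)
  then show "v = 0\<^sub>v n"
    using assms by (intro eq_vecI) (auto simp: sum_nonneg_eq_0_iff)
qed (simp add: vec_norm2_def L2_set_def)

lemma vec_norm2_zero [simp]: "vec_norm2 (0\<^sub>v n) = 0"
  by (simp add: vec_norm2_def L2_set_def)

lemma vip_adjoint:
  assumes A: "A \<in> carrier_mat m n" and u: "u \<in> carrier_vec n" and v: "v \<in> carrier_vec m"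
  shows "vip (A *\<^sub>v u) v = vip u (mat_adjoint A *\<^sub>v v)"
proof -
  have "vip (A *\<^sub>v u) v = (\<Sum>i<m. \<Sum>j<n. cnj (A $$ (i, j)) * cnj (vec_index u j) * vec_index v i)"
    using A u v unfolding vip_def
    by (auto simp: scalar_prod_def atLeast0LessThan sum_distrib_right intro!: sum.cong)
  also have "\<dots> = (\<Sum>j<n. \<Sum>i<m. cnj (A $$ (i, j)) * cnj (vec_index u j) * vec_index v i)"
    by (rule sum.swap)
  also have "\<dots> = vip u (mat_adjoint A *\<^sub>v v)"
    using A u v unfolding vip_def
    by (auto simp: scalar_prod_def atLeast0LessThan sum_distrib_left mult_ac intro!: sum.cong)
  finally show ?thesis .
qed

lemma vip_le:
  assumes "dim_vec u = dim_vec v"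
  shows "Re (vip u v) \<le> vec_norm2 u * vec_norm2 v"
proof -
  have "Re (vip u v) \<le> cmod (vip u v)"
    by (rule complex_Re_le_cmod)
  also have "\<dots> \<le> (\<Sum>i<dim_vec u. \<bar>cmod (vec_index u i)\<bar> * \<bar>cmod (vec_index v i)\<bar>)"
    unfolding vip_def by (rule order_trans[OF norm_sum]) (simp add: norm_mult)
  also have "\<dots> \<le> vec_norm2 u * vec_norm2 v"
    unfolding vec_norm2_def assms[symmetric] by (rule L2_set_mult_ineq)
  finally show ?thesis .
qed

lemma mat_vec_unit:
  fixes A :: "complex mat"
  assumes "A \<in> carrier_mat m n" "i < n"
  shows "A *\<^sub>v unit_vec n i = col A i"
  using assms by (intro eq_vecI) auto

lemma rank_injective:
  fixes A :: "complex mat"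
  assumes A: "A \<in> carrier_mat m n" and inj: "\<And>x. x \<in> carrier_vec n \<Longrightarrow> A *\<^sub>v x = 0\<^sub>v m \<Longrightarrow> x = 0\<^sub>v n"
  shows "vec_space.rank m A = n"
proof -
  interpret vec_space "TYPE(complex)" m .
  \<comment> \<open>Linear dependence is a property of the set of columns and does not see
    repetitions, so distinctness is shown separately; equal columns would put a difference of two
    unit vectors into the kernel.\<close>
  have dist: "distinct (cols A)"
  proof (rule ccontr)
    assume "\<not> distinct (cols A)"
    then obtain i j where ij: "i < n" "j < n" "i \<noteq> j" "col A i = col A j"
      using A by (auto simp: distinct_conv_nth)
    define x where "x = unit_vec n i - (unit_vec n j :: complex Matrix.vec)"
    have x: "x \<in> carrier_vec n" by (simp add: x_def)
    have "A *\<^sub>v x = col A i - col A j"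
      unfolding x_def using A ij
      by (simp add: mult_minus_distrib_mat_vec[of A m n] mat_vec_unit[of A m n])
    also have "\<dots> = 0\<^sub>v m"
      using ij A by auto
    finally have "x = 0\<^sub>v n"
      using inj[OF x] by simp
    then have "vec_index x i = 0" using ij by simp
    with ij show False by (simp add: x_def)
  qed
  moreover have "\<not> lin_dep (set (cols A))"
    using lin_depE[OF A _ dist] inj by metis
  ultimately show ?thesis
    using lin_indpt_full_rank[OF A] by simp
qed

lemma invertible_injective:
  fixes A :: "complex mat"
  assumes A: "A \<in> carrier_mat n n" and inj: "\<And>x. x \<in> carrier_vec n \<Longrightarrow> A *\<^sub>v x = 0\<^sub>v n \<Longrightarrow> x = 0\<^sub>v n"
  shows "\<exists>B. mat_inverse A = Some B \<and> A * B = 1\<^sub>m n \<and> B * A = 1\<^sub>m n \<and> B \<in> carrier_mat n n"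
proof -
  have "Determinant.det A \<noteq> 0"
    using inj det_0_iff_vec_prod_zero_field[OF A] by blast
  then have "A \<in> Units (ring_mat TYPE(complex) n ())"
    by (rule det_non_zero_imp_unit[OF A])
  then obtain B where "mat_inverse A = Some B"
    using mat_inverse(1)[OF A, where b = "()"] by (cases "mat_inverse A") auto
  then show ?thesis
    using mat_inverse(2)[OF A] by blast
qed

section \<open>Matrices with two-sided norm bounds: pseudoinverse, condition number, least
  squares\<close>

locale frame_matrix =
  fixes A :: "complex mat" and m n :: nat and lo hi :: real
  assumes A: "A \<in> carrier_mat m n" and nm: "n \<le> m" and lo: "0 < lo" and hi: "0 \<le> hi"
    and lower: "\<And>x. x \<in> carrier_vec n \<Longrightarrow> lo * (vec_norm2 x)\<^sup>2 \<le> (vec_norm2 (A *\<^sub>v x))\<^sup>2"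
    and upper: "\<And>x. x \<in> carrier_vec n \<Longrightarrow> (vec_norm2 (A *\<^sub>v x))\<^sup>2 \<le> hi * (vec_norm2 x)\<^sup>2"
begin

lemma injective:
  assumes x: "x \<in> carrier_vec n" and "vec_norm2 (A *\<^sub>v x) = 0"
  shows "x = 0\<^sub>v n"
proof -
  have "(vec_norm2 x)\<^sup>2 \<le> 0"
    using lower[OF x] assms(2) lo by (simp add: mult_le_0_iff)
  then show ?thesis
    using vec_norm2_eq_0[OF x] by simp
qed

lemma rank_eq: "vec_space.rank m A = n"
  by (rule rank_injective[OF A injective]) (auto simp: vec_norm2_eq_0)

text \<open>The witness is the inverse Gram matrix times the adjoint of A; the Gram matrix is
  injective because its quadratic form is the squared norm of A x. The two stated properties of X
  are all that the later arguments use.\<close>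

lemma pseudoinverse_exists:
  "\<exists>X. X \<in> carrier_mat n m \<and> X * A = 1\<^sub>m n \<and> mat_adjoint (A * X) = A * X"
proof -
  let ?G = "mat_adjoint A * A"
  have A': "mat_adjoint A \<in> carrier_mat n m" using A by simp
  have G: "?G \<in> carrier_mat n n" using A A' by auto
  have "x = 0\<^sub>v n" if x: "x \<in> carrier_vec n" and Gx: "?G *\<^sub>v x = 0\<^sub>v n" for x
  proof (rule injective[OF x])
    have Ax: "A *\<^sub>v x \<in> carrier_vec m" using A x by auto
    have "vip (A *\<^sub>v x) (A *\<^sub>v x) = vip x (?G *\<^sub>v x)"
      unfolding vip_adjoint[OF A x Ax] by (simp only: assoc_mult_mat_vec[OF A' A x])
    also have "\<dots> = 0"
      using x by (simp add: Gx vip_def)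
    finally show "vec_norm2 (A *\<^sub>v x) = 0"
      by (simp add: vip_self del: of_real_power)
  qed
  then obtain H where H: "H \<in> carrier_mat n n" "?G * H = 1\<^sub>m n" "H * ?G = 1\<^sub>m n"
    using invertible_injective[OF G] by blast
  have adjG: "mat_adjoint ?G = ?G"
    using mat_adjoint_mult[OF A' A] by simp
  have one: "mat_adjoint (1\<^sub>m n :: complex mat) = 1\<^sub>m n"
    by (rule eq_matI) auto
  have H': "mat_adjoint H \<in> carrier_mat n n" using H by simp
  \<comment> \<open>The adjoint of H inverts the self-adjoint Gram matrix as well, so H is
    self-adjoint by uniqueness of inverses.\<close>
  have "mat_adjoint H * ?G = 1\<^sub>m n"
    using mat_adjoint_mult[OF G H(1)] H(2) adjG one by simp
  then have "mat_adjoint H = mat_adjoint H * (?G * H)"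
    using H' H by simp
  also have "\<dots> = (mat_adjoint H * ?G) * H"
    by (rule assoc_mult_mat[OF H' G H(1), symmetric])
  also have "\<dots> = H"
    using \<open>mat_adjoint H * ?G = 1\<^sub>m n\<close> H(1) by simp
  finally have adjH: "mat_adjoint H = H" .
  let ?X = "H * mat_adjoint A"
  have X: "?X \<in> carrier_mat n m" using H(1) A' by auto
  have "?X * A = 1\<^sub>m n"
    unfolding assoc_mult_mat[OF H(1) A' A] by (rule H(3))
  moreover have "mat_adjoint (A * ?X) = A * ?X"
  proof -
    have "mat_adjoint (A * ?X) = mat_adjoint ?X * mat_adjoint A"
      by (rule mat_adjoint_mult[OF A X])
    also have "mat_adjoint ?X = A * H"
      using mat_adjoint_mult[OF H(1) A'] by (simp add: adjH)
    finally show ?thesis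
      by (simp add: assoc_mult_mat[OF A H(1) A'])
  qed
  ultimately show ?thesis using X by blast
qed

text \<open>A X is a self-adjoint idempotent, hence does not increase norms; the lower bound for A
  then passes from A X y to X y.\<close>

lemma left_inverse_norm:
  assumes X: "X \<in> carrier_mat n m" "X * A = 1\<^sub>m n" "mat_adjoint (A * X) = A * X" and y: "y \<in> carrier_vec m"
  shows "sqrt lo * vec_norm2 (X *\<^sub>v y) \<le> vec_norm2 y"
proof -
  let ?c = "X *\<^sub>v y" and ?P = "A * X"
  have c: "?c \<in> carrier_vec n" using X(1) y by auto
  have P: "?P \<in> carrier_mat m m" using A X(1) by auto
  have Py: "?P *\<^sub>v y = A *\<^sub>v ?c" using A X(1) y by (simp add: assoc_mult_mat_vec)
  have PP: "?P * ?P = ?P"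
  proof -
    have "?P * ?P = A * ((X * A) * X)"
      unfolding assoc_mult_mat[OF A X(1) P] assoc_mult_mat[OF X(1) A X(1)] ..
    then show ?thesis using X by simp
  qed
  have "(vec_norm2 (A *\<^sub>v ?c))\<^sup>2 = Re (vip (?P *\<^sub>v y) (?P *\<^sub>v y))"
    unfolding Py vip_self by simp
  also have "\<dots> = Re (vip y (?P *\<^sub>v y))"
    using P y vip_adjoint[OF P y, of "?P *\<^sub>v y"] by (simp add: X(3) PP flip: assoc_mult_mat_vec)
  also have "\<dots> \<le> vec_norm2 y * vec_norm2 (A *\<^sub>v ?c)"
    unfolding Py by (rule vip_le) (use A y in auto)
  finally have "vec_norm2 (A *\<^sub>v ?c) * vec_norm2 (A *\<^sub>v ?c) \<le> vec_norm2 y * vec_norm2 (A *\<^sub>v ?c)"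
    by (simp add: power2_eq_square)
  then have Ac: "vec_norm2 (A *\<^sub>v ?c) \<le> vec_norm2 y"
    using vec_norm2_nonneg[of "A *\<^sub>v ?c"] vec_norm2_nonneg[of y] by (cases "vec_norm2 (A *\<^sub>v ?c) = 0") (auto simp: mult_le_cancel_right)
  have "(sqrt lo * vec_norm2 ?c)\<^sup>2 \<le> (vec_norm2 (A *\<^sub>v ?c))\<^sup>2"
    using lower[OF c] lo by (simp add: power_mult_distrib)
  then have "sqrt lo * vec_norm2 ?c \<le> vec_norm2 (A *\<^sub>v ?c)"
    by (rule power2_le_imp_le) simp
  with Ac show ?thesis by simp
qed

lemma pseudoinverse_eq:
  assumes X: "X \<in> carrier_mat n m" "X * A = 1\<^sub>m n" "mat_adjoint (A * X) = A * X"
  shows "pseudoinverse A = X"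
  unfolding pseudoinverse_def
proof (rule the_equality)
  have one: "mat_adjoint (1\<^sub>m n :: complex mat) = 1\<^sub>m n"
    by (rule eq_matI) auto
  show "is_pseudoinverse A X"
    unfolding is_pseudoinverse_def using A X one
    by (simp add: assoc_mult_mat[of A m n X m A n])
  fix Y assume "is_pseudoinverse A Y"
  then have Y: "Y \<in> carrier_mat n m" "A * Y * A = A" "Y * A * Y = Y" "mat_adjoint (A * Y) = A * Y"
    using A by (auto simp: is_pseudoinverse_def)
  have AX: "A * X \<in> carrier_mat m m" and AY: "A * Y \<in> carrier_mat m m" using A X(1) Y(1) by auto
  \<comment> \<open>Both products are orthogonal projections onto the range of A. Taking adjoints
    reverses the order of the product and identifies them.\<close>
  have "A * X = (A * Y) * (A * X)"
    unfolding assoc_mult_mat[OF AY A X(1), symmetric] Y(2) ..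
  then have "A * X = mat_adjoint ((A * Y) * (A * X))"
    using X(3) by simp
  also have "\<dots> = (A * X) * (A * Y)"
    unfolding mat_adjoint_mult[OF AY AX] X(3) Y(4) ..
  also have "\<dots> = A * ((X * A) * Y)"
    unfolding assoc_mult_mat[OF A X(1) AY] assoc_mult_mat[OF X(1) A Y(1)] ..
  also have "\<dots> = A * Y"
    using X(2) Y(1) by simp
  finally have eq: "A * X = A * Y" .
  have "X = (X * A) * X" using X by simp
  also have "\<dots> = X * (A * X)" by (rule assoc_mult_mat[OF X(1) A X(1)])
  also have "\<dots> = (X * A) * Y" unfolding eq by (rule assoc_mult_mat[OF X(1) A Y(1), symmetric])
  also have "\<dots> = Y" using X(2) Y(1) by simp
  finally show "Y = X" ..
qed

lemma cond2_le: "cond2 A \<le> ereal (sqrt (hi / lo))"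
proof -
  obtain X where X: "X \<in> carrier_mat n m" "X * A = 1\<^sub>m n" "mat_adjoint (A * X) = A * X"
    using pseudoinverse_exists by blast
  have "mat_norm2 A \<le> sqrt hi"
    unfolding mat_norm2_def
  proof (rule cSup_least)
    show "{vec_norm2 (A *\<^sub>v x) |x. x \<in> carrier_vec (dim_col A) \<and> vec_norm2 x \<le> 1} \<noteq> {}"
      by (auto intro!: exI[of _ "0\<^sub>v (dim_col A)"])
    fix v assume "v \<in> {vec_norm2 (A *\<^sub>v x) |x. x \<in> carrier_vec (dim_col A) \<and> vec_norm2 x \<le> 1}"
    then obtain x where x: "x \<in> carrier_vec n" "vec_norm2 x \<le> 1" "v = vec_norm2 (A *\<^sub>v x)"
      using A by auto
    have "v\<^sup>2 \<le> hi * (vec_norm2 x)\<^sup>2"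
      using upper[OF x(1)] x(3) by simp
    also have "\<dots> \<le> hi"
      using hi x(2) by (intro mult_right_le_one_le) (auto simp: power_le_one)
    finally show "v \<le> sqrt hi"
      by (rule real_le_rsqrt)
  qed
  moreover have "mat_norm2 X \<le> 1 / sqrt lo" "0 \<le> mat_norm2 X"
  proof -
    let ?V = "{vec_norm2 (X *\<^sub>v x) |x. x \<in> carrier_vec (dim_col X) \<and> vec_norm2 x \<le> 1}"
    have le: "v \<le> 1 / sqrt lo" if v: "v \<in> ?V" for v
    proof -
      obtain x where x: "x \<in> carrier_vec m" "vec_norm2 x \<le> 1" "v = vec_norm2 (X *\<^sub>v x)"
        using v X(1) by auto
      show ?thesis
        using left_inverse_norm[OF X x(1)] x(2,3) lo by (simp add: field_simps)
    qed
    have ne: "0 \<in> ?V"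
    proof -
      have "X *\<^sub>v 0\<^sub>v m = 0\<^sub>v n"
        using X(1) by (intro eq_vecI) auto
      then show ?thesis
        using X(1) by (auto intro!: exI[of _ "0\<^sub>v m"])
    qed
    show "mat_norm2 X \<le> 1 / sqrt lo"
      unfolding mat_norm2_def by (rule cSup_least) (use le ne in blast)+
    show "0 \<le> mat_norm2 X"
      unfolding mat_norm2_def by (rule cSup_upper[OF ne]) (use le in \<open>auto simp: bdd_above_def\<close>)
  qed
  ultimately have "mat_norm2 A * mat_norm2 X \<le> sqrt hi * (1 / sqrt lo)"
    using hi by (intro mult_mono) auto
  then have "mat_norm2 A * mat_norm2 (pseudoinverse A) \<le> sqrt (hi / lo)"
    unfolding pseudoinverse_eq[OF X] by (simp add: real_sqrt_divide)
  then show ?thesis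
    unfolding cond2_def using A nm rank_eq by simp
qed

text \<open>The projection A X fixes the range of A and kills the residual of X b, so the two are
  orthogonal. Pythagoras then shows minimality, and injectivity of A shows uniqueness.\<close>

lemma least_squares_iff:
  assumes X: "X \<in> carrier_mat n m" "X * A = 1\<^sub>m n" "mat_adjoint (A * X) = A * X"
    and b: "b \<in> carrier_vec m"
  shows "is_least_squares A b c \<longleftrightarrow> c = X *\<^sub>v b"
proof -
  let ?c = "X *\<^sub>v b"
  have c: "?c \<in> carrier_vec n" using X(1) b by auto
  have pyth: "(vec_norm2 (A *\<^sub>v x - b))\<^sup>2 = (vec_norm2 (A *\<^sub>v (x - ?c)))\<^sup>2 + (vec_norm2 (A *\<^sub>v ?c - b))\<^sup>2"
    if x: "x \<in> carrier_vec n" for x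
  proof -
    let ?d = "x - ?c" and ?e = "A *\<^sub>v ?c - b"
    have d: "?d \<in> carrier_vec n" using x c by auto
    have Ad: "A *\<^sub>v ?d \<in> carrier_vec m" and e: "?e \<in> carrier_vec m" using A d c b by auto
    have P: "A * X \<in> carrier_mat m m" using A X(1) by auto
    have "A *\<^sub>v ?d = (A * X) *\<^sub>v (A *\<^sub>v ?d)"
    proof -
      have "(A * X) *\<^sub>v (A *\<^sub>v ?d) = A *\<^sub>v ((X * A) *\<^sub>v ?d)"
        using A X(1) d by simp
      then show ?thesis using X(2) d by simp
    qed
    then have "vip (A *\<^sub>v ?d) ?e = vip ((A * X) *\<^sub>v (A *\<^sub>v ?d)) ?e"
      by simp
    also have "\<dots> = vip (A *\<^sub>v ?d) ((A * X) *\<^sub>v ?e)"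
      unfolding vip_adjoint[OF P Ad e] X(3) ..
    also have "(A * X) *\<^sub>v ?e = 0\<^sub>v m"
    proof -
      have Ac: "A *\<^sub>v ?c \<in> carrier_vec m" using A c by auto
      have "(A * X) *\<^sub>v ?e = A *\<^sub>v (X *\<^sub>v (A *\<^sub>v ?c)) - A *\<^sub>v ?c"
        unfolding mult_minus_distrib_mat_vec[OF P Ac b] assoc_mult_mat_vec[OF A X(1) Ac]
          assoc_mult_mat_vec[OF A X(1) b] ..
      also have "X *\<^sub>v (A *\<^sub>v ?c) = ?c"
        unfolding assoc_mult_mat_vec[OF X(1) A c, symmetric] X(2) using c by simp
      finally show ?thesis using Ac by simp
    qed
    also have "vip (A *\<^sub>v ?d) (0\<^sub>v m) = 0"
      using A by (simp add: vip_def)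
    finally have orth: "vip (A *\<^sub>v ?d) ?e = 0" .
    have sum: "A *\<^sub>v x - b = A *\<^sub>v ?d + ?e"
      using A x c b by (intro eq_vecI) (auto simp: mult_minus_distrib_mat_vec[OF A x c])
    have "complex_of_real ((vec_norm2 (u + v))\<^sup>2) = vip u u + vip v v + vip u v + cnj (vip u v)"
      if "u \<in> carrier_vec m" "v \<in> carrier_vec m" for u v
      using that unfolding vip_self[symmetric] vip_def by (simp add: algebra_simps sum.distrib)
    from this[OF Ad e] have "complex_of_real ((vec_norm2 (A *\<^sub>v ?d + ?e))\<^sup>2) =
        of_real ((vec_norm2 (A *\<^sub>v ?d))\<^sup>2 + (vec_norm2 ?e)\<^sup>2)"
      by (simp add: orth vip_self)
    then show ?thesis
      unfolding sum of_real_eq_iff .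
  qed
  have dim: "dim_col A = n" using A by simp
  have "is_least_squares A b ?c"
    unfolding is_least_squares_def dim
  proof (intro conjI ballI c)
    fix x :: "complex Matrix.vec" assume x: "x \<in> carrier_vec n"
    show "vec_norm2 (A *\<^sub>v ?c - b) \<le> vec_norm2 (A *\<^sub>v x - b)"
      by (rule power2_le_imp_le) (simp_all add: pyth[OF x])
  qed
  moreover have "c = ?c" if ls: "is_least_squares A b c"
  proof -
    have x: "c \<in> carrier_vec n" and le: "vec_norm2 (A *\<^sub>v c - b) \<le> vec_norm2 (A *\<^sub>v ?c - b)"
      using ls \<open>?c \<in> carrier_vec n\<close> by (auto simp: is_least_squares_def dim)
    have "(vec_norm2 (A *\<^sub>v c - b))\<^sup>2 \<le> (vec_norm2 (A *\<^sub>v ?c - b))\<^sup>2"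
      using le by (intro power_mono) auto
    then have "vec_norm2 (A *\<^sub>v (c - ?c)) = 0"
      unfolding pyth[OF x] by simp
    from injective[OF _ this] have d0: "c - ?c = 0\<^sub>v n"
      using x \<open>?c \<in> carrier_vec n\<close> by simp
    show "c = ?c"
    proof (rule eq_vecI)
      fix i assume "i < dim_vec ?c"
      then have i: "i < n" using X(1) by simp
      then have "vec_index (c - ?c) i = 0" unfolding d0 by simp
      with i x X(1) show "vec_index c i = vec_index ?c i" by simp
    qed (use x X(1) in auto)
  qed
  ultimately show ?thesis by blast
qed

lemma least_squares_unique: "b \<in> carrier_vec m \<Longrightarrow> \<exists>!c. is_least_squares A b c"
  using pseudoinverse_exists least_squares_iff by metis

text \<open>Since X is a left inverse of A, the error c - x is X applied to the residual at
  x.\<close>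

lemma least_squares_error:
  assumes b: "b \<in> carrier_vec m" and c: "is_least_squares A b c" and x: "x \<in> carrier_vec n"
  shows "sqrt lo * vec_norm2 (c - x) \<le> vec_norm2 (b - A *\<^sub>v x)"
proof -
  obtain X where X: "X \<in> carrier_mat n m" "X * A = 1\<^sub>m n" "mat_adjoint (A * X) = A * X"
    using pseudoinverse_exists by blast
  have Ax: "A *\<^sub>v x \<in> carrier_vec m" using A x by auto
  have "X *\<^sub>v (b - A *\<^sub>v x) = X *\<^sub>v b - (X * A) *\<^sub>v x"
    unfolding mult_minus_distrib_mat_vec[OF X(1) b Ax] assoc_mult_mat_vec[OF X(1) A x] ..
  also have "\<dots> = c - x"
    using c x unfolding least_squares_iff[OF X b] X(2) by simp
  finally show ?thesis
    using left_inverse_norm[OF X, of "b - A *\<^sub>v x"] b Ax by simp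
qed

end

text \<open>Induction over the rows: the earlier rows are already diagonal, so column l has only its
  diagonal entry. Normalisation gives that entry modulus 1, and normalisation of row l then leaves
  nothing else in the row.\<close>

lemma unitary_upper_triangular_diagonal:
  assumes U: "unitary n T" and tri: "\<And>m l. l < m \<Longrightarrow> m < n \<Longrightarrow> T m l = 0" and l: "l < n"
  shows "cmod (T l l) = 1 \<and> (\<forall>j<n. j \<noteq> l \<longrightarrow> T l j = 0)"
  using l
proof (induction l rule: less_induct)
  case (less l)
  have one: "(\<Sum>m<n. (cmod (T m l))\<^sup>2) = 1"
    using nsq_column[OF U less.prems] by (simp add: nsq_def)
  have "(\<Sum>m<n. (cmod (T m l))\<^sup>2) = (\<Sum>m<n. if m = l then (cmod (T l l))\<^sup>2 else 0)"
  proof (intro sum.cong refl)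
    fix m assume "m \<in> {..<n}"
    then show "(cmod (T m l))\<^sup>2 = (if m = l then (cmod (T l l))\<^sup>2 else 0)"
      using less.IH[of m] less.prems tri[of l m] by (cases m l rule: linorder_cases) auto
  qed
  then have "(cmod (T l l))\<^sup>2 = 1"
    using less.prems one by simp
  then have 1: "cmod (T l l) = 1"
    using norm_ge_zero[of "T l l"] by (auto simp: power2_eq_1_iff simp del: norm_ge_zero)
  have "(\<Sum>m<n. (cmod (T l m))\<^sup>2) = 1"
    using nsq_column[OF unitary_adj[OF U] less.prems] by (simp add: nsq_def adj_def)
  then have "(\<Sum>m\<in>{..<n} - {l}. (cmod (T l m))\<^sup>2) = 0"
    using less.prems 1 by (simp add: sum.remove[of "{..<n}" l])
  then have "\<forall>m\<in>{..<n} - {l}. (cmod (T l m))\<^sup>2 = 0"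
    by (subst (asm) sum_nonneg_eq_0_iff) auto
  with 1 show ?case by auto
qed

section \<open>Reduced QR decompositions and their uniqueness up to phases\<close>

locale reduced_QR =
  fixes B Q R :: "complex mat" and K n :: nat
  assumes B: "B \<in> carrier_mat K n" and QR: "is_reduced_QR B Q R"
    and inj: "\<And>x. x \<in> carrier_vec n \<Longrightarrow> B *\<^sub>v x = 0\<^sub>v K \<Longrightarrow> x = 0\<^sub>v n"
begin

lemma Q: "Q \<in> carrier_mat K n" and R: "R \<in> carrier_mat n n" and QQ: "mat_adjoint Q * Q = 1\<^sub>m n"
  and tri: "upper_triangular R" and B_eq: "B = Q * R"
  using QR B by (auto simp: is_reduced_QR_def)

lemma orthonormal:
  assumes "a < n" "b < n"
  shows "(\<Sum>i<K. cnj (Q $$ (i, a)) * Q $$ (i, b)) = (if a = b then 1 else 0)"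
proof -
  have "(mat_adjoint Q * Q) $$ (a, b) = (\<Sum>i<K. cnj (Q $$ (i, a)) * Q $$ (i, b))"
    using assms Q by (simp add: scalar_prod_def atLeast0LessThan)
  then show ?thesis
    using assms by (simp add: QQ)
qed

definition Ri where "Ri = the (mat_inverse R)"

lemma Ri: "Ri \<in> carrier_mat n n" "R * Ri = 1\<^sub>m n" "Ri * R = 1\<^sub>m n"
proof -
  have "x = 0\<^sub>v n" if x: "x \<in> carrier_vec n" and Rx: "R *\<^sub>v x = 0\<^sub>v n" for x
  proof (rule inj[OF x])
    show "B *\<^sub>v x = 0\<^sub>v K"
      unfolding B_eq assoc_mult_mat_vec[OF Q R x] Rx using Q by (intro eq_vecI) auto
  qed
  from invertible_injective[OF R this]
  show "Ri \<in> carrier_mat n n" "R * Ri = 1\<^sub>m n" "Ri * R = 1\<^sub>m n"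
    by (auto simp: Ri_def)
qed

lemma R_diag: "i < n \<Longrightarrow> R $$ (i, i) \<noteq> 0"
proof
  assume i: "i < n" "R $$ (i, i) = 0"
  have "Determinant.det R * Determinant.det Ri = 1"
    using det_mult[OF R Ri(1)] Ri(2) by simp
  moreover have "Determinant.det R = 0"
    using det_upper_triangular[OF tri R] i R by (auto simp: diag_mat_def prod_list_zero_iff image_iff)
  ultimately show False by simp
qed

text \<open>Induction from the last row upwards: in row m of R Ri the terms left of the diagonal
  vanish by triangularity of R and those right of it by induction, leaving a nonzero diagonal entry
  of R times the entry in question.\<close>

lemma Ri_triangular:
  assumes "l < m" "m < n"
  shows "Ri $$ (m, l) = 0"
  using assms
proof (induction "n - m" arbitrary: m rule: less_induct)
  case less
  have "(R * Ri) $$ (m, l) = (\<Sum>j<n. R $$ (m, j) * Ri $$ (j, l))"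
    using less.prems R Ri(1) by (simp add: scalar_prod_def atLeast0LessThan)
  also have "\<dots> = (\<Sum>j<n. if j = m then R $$ (m, m) * Ri $$ (m, l) else 0)"
  proof (intro sum.cong refl)
    fix j assume "j \<in> {..<n}"
    then show "R $$ (m, j) * Ri $$ (j, l) = (if j = m then R $$ (m, m) * Ri $$ (m, l) else 0)"
      using less.hyps[of j] less.prems tri R by (cases j m rule: linorder_cases) (auto simp: upper_triangular_def)
  qed
  also have "\<dots> = R $$ (m, m) * Ri $$ (m, l)"
    using less.prems by simp
  finally show ?case
    using R_diag[OF less.prems(2)] less.prems Ri(2) by simp
qed

lemma norm_Q:
  assumes x: "x \<in> carrier_vec n"
  shows "vec_norm2 (Q *\<^sub>v x) = vec_norm2 x"
proof -
  have Qx: "Q *\<^sub>v x \<in> carrier_vec K" using Q x by auto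
  have Q': "mat_adjoint Q \<in> carrier_mat n K" using Q by simp
  have "complex_of_real ((vec_norm2 (Q *\<^sub>v x))\<^sup>2) = vip x (mat_adjoint Q *\<^sub>v (Q *\<^sub>v x))"
    unfolding vip_self[symmetric] by (rule vip_adjoint[OF Q x Qx])
  also have "mat_adjoint Q *\<^sub>v (Q *\<^sub>v x) = x"
    unfolding assoc_mult_mat_vec[OF Q' Q x, symmetric] QQ using x by simp
  finally have "(vec_norm2 (Q *\<^sub>v x))\<^sup>2 = (vec_norm2 x)\<^sup>2"
    unfolding vip_self of_real_eq_iff .
  then show ?thesis
    by (simp add: power2_eq_iff_nonneg)
qed

text \<open>The transposed inverse in \<open>phi\<close> means that coefficients c for
  \<open>phi\<close> become Ri c for \<psi>. Triangularity allows the inner sum to run over all j <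
  n.\<close>

lemma phi_combination:
  assumes c: "c \<in> carrier_vec n"
  shows "(\<Sum>i<n. vec_index c i * phi \<psi> R i x) = poly_at n \<psi> (\<lambda>j. vec_index (Ri *\<^sub>v c) j) x"
proof -
  have phi: "phi \<psi> R i x = (\<Sum>j<n. Ri $$ (j, i) * \<psi> j x)" if i: "i < n" for i
  proof -
    have "phi \<psi> R i x = (\<Sum>j\<le>i. Ri $$ (j, i) * \<psi> j x)"
      unfolding phi_def Ri_def[symmetric] using i Ri(1) by (intro sum.cong refl) auto
    also have "\<dots> = (\<Sum>j<n. Ri $$ (j, i) * \<psi> j x)"
      using i by (intro sum.mono_neutral_left) (auto simp: Ri_triangular)
    finally show ?thesis .
  qed
  have "(\<Sum>i<n. vec_index c i * phi \<psi> R i x) = (\<Sum>i<n. \<Sum>j<n. \<psi> j x * (Ri $$ (j, i) * vec_index c i))"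
    by (intro sum.cong refl) (simp add: phi sum_distrib_left mult_ac)
  also have "\<dots> = (\<Sum>j<n. \<Sum>i<n. \<psi> j x * (Ri $$ (j, i) * vec_index c i))"
    by (rule sum.swap)
  also have "\<dots> = poly_at n \<psi> (\<lambda>j. vec_index (Ri *\<^sub>v c) j) x"
    unfolding poly_at_def using Ri(1) c
    by (intro sum.cong refl) (simp add: scalar_prod_def atLeast0LessThan sum_distrib_left)
  finally show ?thesis .
qed

end

text \<open>The change of basis between the two orthonormal systems is upper triangular and unitary,
  hence diagonal with unimodular entries. This is why the distributions \<pi> do not depend on the
  pass that computes them.\<close>

lemma reduced_QR_prefix:
  assumes "reduced_QR B Q R K n" and "reduced_QR B' Q' R' K n'" and nn: "n \<le> n'"
    and pre: "\<And>i j. i < K \<Longrightarrow> j < n \<Longrightarrow> B' $$ (i, j) = B $$ (i, j)" and l: "l < n" and i: "i < K"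
  shows "cmod (Q $$ (i, l)) = cmod (Q' $$ (i, l))"
proof -
  interpret QR1: reduced_QR B Q R K n by fact
  interpret QR2: reduced_QR B' Q' R' K n' by fact
  \<comment> \<open>Only columns l < n matter; for these the rows m \<ge> n of T vanish, and the
    rest is the leading block of R' times the inverse of R.\<close>
  define T where "T m l = (\<Sum>j<n. R' $$ (m, j) * QR1.Ri $$ (j, l))" for m l
  have R'0: "R' $$ (m, j) = 0" if "j < m" "m < n'" for m j
    using that QR2.tri QR2.R by (auto simp: upper_triangular_def)
  have T0: "T m l = 0" if "l < m" "m < n'" for m l
    unfolding T_def
  proof (intro sum.neutral ballI)
    fix j assume j: "j \<in> {..<n}"
    show "R' $$ (m, j) * QR1.Ri $$ (j, l) = 0"
      using R'0[of j m] QR1.Ri_triangular[of l j] that j by (cases "j < m") auto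
  qed
  have Q_eq: "Q $$ (i, l) = (\<Sum>m<n. Q' $$ (i, m) * T m l)" if i: "i < K" and l: "l < n" for i l
  proof -
    have "Q = Q * (R * QR1.Ri)"
      using QR1.Q QR1.Ri by simp
    also have "\<dots> = B * QR1.Ri"
      unfolding QR1.B_eq by (rule assoc_mult_mat[OF QR1.Q QR1.R QR1.Ri(1), symmetric])
    finally have "Q $$ (i, l) = (\<Sum>j<n. B $$ (i, j) * QR1.Ri $$ (j, l))"
      using i l QR1.B QR1.Ri(1) by (simp add: scalar_prod_def atLeast0LessThan)
    also have "\<dots> = (\<Sum>j<n. \<Sum>m<n'. Q' $$ (i, m) * (R' $$ (m, j) * QR1.Ri $$ (j, l)))"
    proof (intro sum.cong refl)
      fix j assume j: "j \<in> {..<n}"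
      then have "B $$ (i, j) = (Q' * R') $$ (i, j)"
        using pre[OF i, of j] QR2.B_eq by simp
      also have "\<dots> = (\<Sum>m<n'. Q' $$ (i, m) * R' $$ (m, j))"
        using i j nn QR2.Q QR2.R by (simp add: scalar_prod_def atLeast0LessThan)
      finally show "B $$ (i, j) * QR1.Ri $$ (j, l) = (\<Sum>m<n'. Q' $$ (i, m) * (R' $$ (m, j) * QR1.Ri $$ (j, l)))"
        by (simp add: sum_distrib_right mult.assoc)
    qed
    also have "\<dots> = (\<Sum>m<n'. Q' $$ (i, m) * T m l)"
      unfolding T_def by (subst sum.swap) (simp add: sum_distrib_left)
    also have "\<dots> = (\<Sum>m<n. Q' $$ (i, m) * T m l)"
      using nn l T0 by (intro sum.mono_neutral_right) auto
    finally show ?thesis .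
  qed
  have "eqm n (mm n (adj T) T) idm"
    unfolding eqm_def
  proof (intro allI impI)
    fix a b assume ab: "a < n" "b < n"
    have "(if a = b then 1 else 0) = (\<Sum>i<K. cnj (Q $$ (i, a)) * Q $$ (i, b))"
      using QR1.orthonormal[OF ab] by simp
    also have "\<dots> = (\<Sum>i<K. \<Sum>m<n. \<Sum>m'<n. cnj (T m a) * T m' b * (cnj (Q' $$ (i, m)) * Q' $$ (i, m')))"
    proof (intro sum.cong refl)
      fix i assume "i \<in> {..<K}"
      then have i: "i < K" by simp
      show "cnj (Q $$ (i, a)) * Q $$ (i, b) =
          (\<Sum>m<n. \<Sum>m'<n. cnj (T m a) * T m' b * (cnj (Q' $$ (i, m)) * Q' $$ (i, m')))"
        unfolding Q_eq[OF i ab(1)] Q_eq[OF i ab(2)] cnj_sum sum_product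
        by (intro sum.cong refl) simp
    qed
    also have "\<dots> = (\<Sum>m<n. \<Sum>i<K. \<Sum>m'<n. cnj (T m a) * T m' b * (cnj (Q' $$ (i, m)) * Q' $$ (i, m')))"
      by (rule sum.swap)
    also have "\<dots> = (\<Sum>m<n. \<Sum>m'<n. \<Sum>i<K. cnj (T m a) * T m' b * (cnj (Q' $$ (i, m)) * Q' $$ (i, m')))"
      by (intro sum.cong refl sum.swap)
    also have "\<dots> = (\<Sum>m<n. \<Sum>m'<n. cnj (T m a) * T m' b * (if m = m' then 1 else 0))"
      unfolding sum_distrib_left[symmetric] using nn
      by (intro sum.cong refl) (simp add: QR2.orthonormal)
    also have "\<dots> = (\<Sum>m<n. \<Sum>m'<n. if m' = m then cnj (T m a) * T m b else 0)"
      by (intro sum.cong refl) auto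
    also have "\<dots> = mm n (adj T) T a b"
      by (simp add: mm_def adj_def)
    finally show "mm n (adj T) T a b = idm a b"
      by (simp add: dg_def)
  qed
  from unitary_upper_triangular_diagonal[OF orthonormal_imp_unitary[OF this]]
  have T: "cmod (T l l) = 1" "\<And>m j. m < n \<Longrightarrow> j < n \<Longrightarrow> j \<noteq> m \<Longrightarrow> T m j = 0"
    using T0 nn l by (meson less_le_trans)+
  have "Q $$ (i, l) = (\<Sum>m<n. if m = l then Q' $$ (i, l) * T l l else 0)"
    unfolding Q_eq[OF i l] using l by (intro sum.cong refl) (auto simp: T(2))
  then show ?thesis
    using l by (simp add: norm_mult T(1))
qed

section \<open>One pass of the method\<close>

lemma sum_list_concat_map:
  fixes F :: "'x \<Rightarrow> 'b :: comm_monoid_add"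
  shows "sum_list (map F (concat (map (\<lambda>l. map (J l) [a..<b]) [c..<d]))) = (\<Sum>l\<in>{c..<d}. \<Sum>m\<in>{a..<b}. F (J l m))"
proof -
  have "sum_list (map F (concat xss)) = sum_list (map (\<lambda>xs. sum_list (map F xs)) xss)" for xss
    by (induction xss) auto
  then show ?thesis
    by (simp add: comp_def sum_list_distinct_conv_sum_set)
qed

text \<open>The order of the draws enters nowhere except through sums over the list, which are sums
  over the rectangle l < N t, m < k t. A pass adds a strip of new m for the old l and full strips
  for the new l. Choosing F gives the length of the list, the norm of A_t x and the range of the
  entries.\<close>

lemma sum_drawn:
  fixes F :: "nat \<Rightarrow> 'b :: comm_monoid_add"
  assumes "N 0 = 0" "\<And>s. s < t \<Longrightarrow> N s \<le> N (Suc s)" "\<And>s. s < t \<Longrightarrow> k s \<le> k (Suc s)"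
  shows "sum_list (map F (drawn N k J t)) = (\<Sum>l<N t. \<Sum>m<k t. F (J l m))"
  using assms(2,3)
proof (induction t)
  case 0
  then show ?case by (simp add: assms(1))
next
  case (Suc t)
  have N: "{..<N (Suc t)} = {..<N t} \<union> {N t..<N (Suc t)}" "{..<N t} \<inter> {N t..<N (Suc t)} = {}"
    using Suc.prems(1)[of t] by auto
  have k: "{..<k (Suc t)} = {..<k t} \<union> {k t..<k (Suc t)}" "{..<k t} \<inter> {k t..<k (Suc t)} = {}"
    using Suc.prems(2)[of t] by auto
  have "sum_list (map F (drawn N k J (Suc t))) = (\<Sum>l<N t. \<Sum>m<k t. F (J l m)) +
      (\<Sum>l\<in>{0..<N t}. \<Sum>m\<in>{k t..<k (Suc t)}. F (J l m)) + (\<Sum>l\<in>{N t..<N (Suc t)}. \<Sum>m\<in>{0..<k (Suc t)}. F (J l m))"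
    using Suc by (simp only: drawn.simps map_append sum_list_append sum_list_concat_map) (simp add: add.assoc)
  also have "(\<Sum>l<N t. \<Sum>m<k t. F (J l m)) + (\<Sum>l\<in>{0..<N t}. \<Sum>m\<in>{k t..<k (Suc t)}. F (J l m)) =
      (\<Sum>l<N t. \<Sum>m<k (Suc t). F (J l m))"
    unfolding k(1) by (subst sum.union_disjoint[OF _ _ k(2)]) (simp_all add: sum.distrib atLeast0LessThan)
  also have "\<dots> + (\<Sum>l\<in>{N t..<N (Suc t)}. \<Sum>m\<in>{0..<k (Suc t)}. F (J l m)) =
      (\<Sum>l<N (Suc t). \<Sum>m<k (Suc t). F (J l m))"
    unfolding N(1) by (subst sum.union_disjoint[OF _ _ N(2)]) (simp_all add: atLeast0LessThan)
  finally show ?case .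
qed

lemma length_drawn:
  assumes "N 0 = 0" "\<And>s. s < t \<Longrightarrow> N s \<le> N (Suc s)" "\<And>s. s < t \<Longrightarrow> k s \<le> k (Suc s)"
  shows "length (drawn N k J t) = num_samples N k t"
  using sum_drawn[where N = N and k = k and t = t and F = "\<lambda>_. 1 :: nat" and J = J, OF assms]
  by (simp add: sum_list_triv num_samples_def mult.commute)

lemma sum_drawn_nth:
  fixes F :: "nat \<Rightarrow> 'b :: comm_monoid_add"
  assumes "N 0 = 0" "\<And>s. s < t \<Longrightarrow> N s \<le> N (Suc s)" "\<And>s. s < t \<Longrightarrow> k s \<le> k (Suc s)"
  shows "(\<Sum>j<num_samples N k t. F (drawn N k J t ! j)) = (\<Sum>l<N t. \<Sum>m<k t. F (J l m))"
proof -
  let ?d = "drawn N k J t"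
  have "(\<Sum>j<num_samples N k t. F (?d ! j)) = (\<Sum>j<length ?d. F (?d ! j))"
    using length_drawn[where N = N and k = k and t = t and J = J, OF assms] by simp
  also have "\<dots> = sum_list (map F ?d)"
    by (simp add: sum_list_sum_nth atLeast0LessThan)
  also have "\<dots> = (\<Sum>l<N t. \<Sum>m<k t. F (J l m))"
    by (rule sum_drawn[where N = N and k = k and t = t, OF assms])
  finally show ?thesis .
qed

lemma mult_mat_vec_index:
  fixes A :: "complex mat"
  assumes "A \<in> carrier_mat m n" "x \<in> carrier_vec n" "i < m"
  shows "vec_index (A *\<^sub>v x) i = (\<Sum>b<n. A $$ (i, b) * vec_index x b)"
  using assms by (simp add: scalar_prod_def atLeast0LessThan)

lemma vec_norm2_minus_commute:
  assumes "u \<in> carrier_vec n" "v \<in> carrier_vec n"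
  shows "vec_norm2 (u - v) = vec_norm2 (v - u)"
  unfolding vec_norm2_def L2_set_def using assms
  by (intro arg_cong[of _ _ sqrt] sum.cong) (auto simp: norm_minus_commute)

lemma B_mat_mult:
  assumes "e \<in> carrier_vec n" "i < K"
  shows "vec_index (B_mat \<psi> K n z *\<^sub>v e) i = poly_at n \<psi> (vec_index e) (z i) / of_real (sqrt (real K))"
  using assms by (simp add: B_mat_def scalar_prod_def atLeast0LessThan poly_at_def sum_divide_distrib)

lemma B_mat_norm:
  assumes "e \<in> carrier_vec n" "0 < K"
  shows "real K * (vec_norm2 (B_mat \<psi> K n z *\<^sub>v e))\<^sup>2 = (\<Sum>i<K. (cmod (poly_at n \<psi> (vec_index e) (z i)))\<^sup>2)"
proof -
  have "(vec_norm2 (B_mat \<psi> K n z *\<^sub>v e))\<^sup>2 =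
      (\<Sum>i<K. (cmod (poly_at n \<psi> (vec_index e) (z i) / of_real (sqrt (real K))))\<^sup>2)"
    unfolding vec_norm2_sq by (intro sum.cong) (auto simp: B_mat_mult[OF assms(1)], simp add: B_mat_def)
  also have "\<dots> = (\<Sum>i<K. (cmod (poly_at n \<psi> (vec_index e) (z i)))\<^sup>2) / real K"
    by (simp add: norm_divide power_divide sum_divide_distrib)
  finally show ?thesis
    using assms(2) by simp
qed

section \<open>Deterministic analysis of a pass with a well-sampled table\<close>

locale sampling_pass =
  fixes \<psi> :: "nat \<Rightarrow> 'a \<Rightarrow> complex" and K :: nat and N k :: "nat \<Rightarrow> nat" and Q R :: "nat \<Rightarrow> complex mat"
    and z :: "nat \<Rightarrow> 'a" and J :: "nat \<Rightarrow> nat \<Rightarrow> nat" and t :: nat and \<delta> :: real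
  assumes N0: "N 0 = 0" and N_mono: "\<And>s. s < t \<Longrightarrow> N s \<le> N (Suc s)" and k_mono: "\<And>s. s < t \<Longrightarrow> k s \<le> k (Suc s)"
    and pos: "0 < N t" "0 < k t" "0 < K" and \<delta>: "0 < \<delta>" "\<delta> < 1"
    and QR: "reduced_QR (B_mat \<psi> K (N t)  z) (Q t) (R t) K (N t)"
    and samp: "\<And>i. i < K \<Longrightarrow> (\<Sum>l<N t. samp_prob N Q l i) = (\<Sum>b<N t. (cmod (Q t $$ (i, b)))\<^sup>2)"
    and J: "\<And>l m. l < N t \<Longrightarrow> m < k t \<Longrightarrow> J l m < K"
    and well: "well_sampled (\<lambda>i b. Q t $$ (i, b)) (N t) (k t) \<delta> (\<lambda>(l, m). J l m)"
begin

sublocale qr: reduced_QR "B_mat \<psi> K (N t) z" "Q t" "R t" K "N t"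
  by (rule QR)

abbreviation "A \<equiv> A_mat N k Q J t"

abbreviation "b f \<equiv> b_vec K N k Q z J t f"

definition weight :: "nat \<Rightarrow> real" where
  "weight i = (\<Sum>l<N t. samp_prob N Q l i)"

lemmas sum_nth = sum_drawn_nth[where N = N and k = k and t = t, OF N0 N_mono k_mono]
lemmas sum_list_drawn = sum_drawn[where N = N and k = k and t = t, OF N0 N_mono k_mono]
lemmas length_drawn' = length_drawn[where N = N and k = k and t = t, OF N0 N_mono k_mono]

lemma ratio: "real (num_samples N k t) / real (N t) = real (k t)"
  using pos by (simp add: num_samples_def)

lemma weight_nonneg: "0 \<le> weight i"
  unfolding weight_def samp_prob_def by (intro sum_nonneg) simp

lemma A_carrier: "A \<in> carrier_mat (num_samples N k t) (N t)"
  by (simp add: A_mat_def)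

lemma A_mult:
  assumes x: "x \<in> carrier_vec (N t)" and j: "j < num_samples N k t"
  defines "i \<equiv> drawn N k J t ! j"
  shows "vec_index (A *\<^sub>v x) j = (\<Sum>b<N t. Q t $$ (i, b) * vec_index x b) / of_real (sqrt (real (k t) * weight i))"
  using x j unfolding i_def
  by (simp add: A_mat_def ratio scalar_prod_def atLeast0LessThan sum_divide_distrib Let_def flip: weight_def)

lemma A_norm:
  assumes x: "x \<in> carrier_vec (N t)"
  shows "(vec_norm2 (A *\<^sub>v x))\<^sup>2 =
    sample_form (\<lambda>i b. Q t $$ (i, b)) (N t) (k t) (\<lambda>(l, m). J l m) (vec_index x) / real (k t)"
proof -
  let ?F = "\<lambda>i. (cmod (\<Sum>b<N t. Q t $$ (i, b) * vec_index x b))\<^sup>2 / (real (k t) * weight i)"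
  have "(vec_norm2 (A *\<^sub>v x))\<^sup>2 = (\<Sum>j<num_samples N k t. ?F (drawn N k J t ! j))"
    unfolding vec_norm2_sq
  proof (intro sum.cong)
    show "{..<dim_vec (A *\<^sub>v x)} = {..<num_samples N k t}"
      using A_carrier by simp
    fix j assume "j \<in> {..<num_samples N k t}"
    then have j: "j < num_samples N k t" by simp
    show "(cmod (vec_index (A *\<^sub>v x) j))\<^sup>2 = ?F (drawn N k J t ! j)"
      unfolding A_mult[OF x j] using weight_nonneg by (simp add: norm_divide power_divide abs_mult)
  qed
  also have "\<dots> = (\<Sum>l<N t. \<Sum>m<k t. ?F (J l m))"
    by (rule sum_nth)
  also have "\<dots> = (\<Sum>l<N t. \<Sum>m<k t. (cmod (\<Sum>b<N t. Q t $$ (J l m, b) * vec_index x b))\<^sup>2 /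
      (\<Sum>b<N t. (cmod (Q t $$ (J l m, b)))\<^sup>2) / real (k t))"
    by (intro sum.cong refl) (simp add: weight_def samp J)
  finally show ?thesis
    by (simp add: sample_form_def sum_divide_distrib)
qed

sublocale frame: frame_matrix A "num_samples N k t" "N t" "1 - \<delta>" "1 + \<delta>"
proof
  show "A \<in> carrier_mat (num_samples N k t) (N t)"
    by (rule A_carrier)
  show "N t \<le> num_samples N k t"
    using pos by (simp add: num_samples_def)
  fix x :: "complex Matrix.vec" assume x: "x \<in> carrier_vec (N t)"
  have "nsq (N t) (vec_index x) = (vec_norm2 x)\<^sup>2"
    using x by (simp add: vec_norm2_sq nsq_def)
  then show "(1 - \<delta>) * (vec_norm2 x)\<^sup>2 \<le> (vec_norm2 (A *\<^sub>v x))\<^sup>2"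
    and "(vec_norm2 (A *\<^sub>v x))\<^sup>2 \<le> (1 + \<delta>) * (vec_norm2 x)\<^sup>2"
    using well[unfolded well_sampled_def, rule_format, of "vec_index x"] pos
    unfolding A_norm[OF x] by (simp_all add: pos_le_divide_eq pos_divide_le_eq mult_ac)
qed (use \<delta> in auto)

lemma b_carrier: "b f \<in> carrier_vec (num_samples N k t)"
  by (simp add: b_vec_def)

lemma unique_output: "\<exists>!g. is_output \<psi> K N k Q R z J t f g"
  using frame.least_squares_unique[OF b_carrier[of f]] unfolding is_output_def by blast

text \<open>There are k_t N_t rows, and each contributes at most C^2 / (k_t N_t) to the squared
  residual. The scaling by K / N_t in the hypothesis is chosen to produce exactly this. The vector R
  e contains the coefficients in the orthonormal system of the function with \<psi>-coefficients
  e.\<close>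

lemma residual_le:
  assumes e: "e \<in> carrier_vec (N t)"
    and C: "\<And>i. i < K \<Longrightarrow> cmod (f (z i) - poly_at (N t) \<psi> (vec_index e) (z i)) / sqrt (real K / real (N t) * weight i) \<le> C"
  shows "vec_norm2 (b f - A *\<^sub>v (R t *\<^sub>v e)) \<le> C"
proof -
  let ?h = "\<lambda>i. f (z i) - poly_at (N t) \<psi> (vec_index e) (z i)"
  have Re: "R t *\<^sub>v e \<in> carrier_vec (N t)" using qr.R e by auto
  have QRe: "(\<Sum>b<N t. Q t $$ (i, b) * vec_index (R t *\<^sub>v e) b) =
      poly_at (N t) \<psi> (vec_index e) (z i) / of_real (sqrt (real K))" if "i < K" for i
  proof -
    have "vec_index (Q t *\<^sub>v (R t *\<^sub>v e)) i = vec_index (B_mat \<psi> K (N t) z *\<^sub>v e) i"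
      unfolding qr.B_eq assoc_mult_mat_vec[OF qr.Q qr.R e] ..
    moreover have "vec_index (Q t *\<^sub>v (R t *\<^sub>v e)) i = (\<Sum>b<N t. Q t $$ (i, b) * vec_index (R t *\<^sub>v e) b)"
      by (rule mult_mat_vec_index[OF qr.Q Re that])
    ultimately show ?thesis
      using B_mat_mult[OF e that] by simp
  qed
  have S: "set (drawn N k J t) \<subseteq> {..<K}"
  proof -
    \<comment> \<open>Counting the entries outside the range with \<open>sum_drawn\<close> avoids
      describing the set of list entries.\<close>
    have "sum_list (map (\<lambda>i. if i < K then 0 else 1 :: nat) (drawn N k J t)) = 0"
    proof -
      have "sum_list (map (\<lambda>i. if i < K then 0 else 1 :: nat) (drawn N k J t)) =
          (\<Sum>l<N t. \<Sum>m<k t. if J l m < K then 0 else 1)"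
        by (rule sum_list_drawn)
      then show ?thesis
        using J by simp
    qed
    then show ?thesis
      by (auto simp: sum_list_eq_0_iff split: if_splits)
  qed
  have drawn: "drawn N k J t ! j < K" if "j < num_samples N k t" for j
  proof -
    have "drawn N k J t ! j \<in> set (drawn N k J t)"
      using that by (intro nth_mem) (simp add: length_drawn')
    then show ?thesis using S by auto
  qed
  \<comment> \<open>The bound at grid point 0, which exists because K > 0.\<close>
  have C0: "0 \<le> C"
    by (rule order_trans[OF _ C[OF pos(3)]]) (simp add: weight_nonneg)
  have "(vec_norm2 (b f - A *\<^sub>v (R t *\<^sub>v e)))\<^sup>2 =
      (\<Sum>j<num_samples N k t. (cmod (?h (drawn N k J t ! j)))\<^sup>2 / (real (k t) * real K * weight (drawn N k J t ! j)))"
    unfolding vec_norm2_sq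
  proof (intro sum.cong)
    show "{..<dim_vec (b f - A *\<^sub>v (R t *\<^sub>v e))} = {..<num_samples N k t}"
      using A_carrier by simp
    fix j assume "j \<in> {..<num_samples N k t}"
    then have j: "j < num_samples N k t" by simp
    let ?i = "drawn N k J t ! j"
    have "real (num_samples N k t) * real K / real (N t) = real (k t) * real K"
      using pos by (simp add: num_samples_def)
    then have "vec_index (b f) j = f (z ?i) / of_real (sqrt (real (k t) * real K * weight ?i))"
      using j by (simp add: b_vec_def Let_def weight_def)
    moreover have "vec_index (A *\<^sub>v (R t *\<^sub>v e)) j =
        poly_at (N t) \<psi> (vec_index e) (z ?i) / of_real (sqrt (real (k t) * real K * weight ?i))"
      unfolding A_mult[OF Re j] QRe[OF drawn[OF j]] by (simp add: real_sqrt_mult mult_ac)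
    ultimately have "vec_index (b f - A *\<^sub>v (R t *\<^sub>v e)) j = ?h ?i / of_real (sqrt (real (k t) * real K * weight ?i))"
      using j A_carrier by (simp add: diff_divide_distrib)
    then show "(cmod (vec_index (b f - A *\<^sub>v (R t *\<^sub>v e)) j))\<^sup>2 =
        (cmod (?h ?i))\<^sup>2 / (real (k t) * real K * weight ?i)"
      using weight_nonneg by (simp add: norm_divide power_divide abs_mult)
  qed
  also have "\<dots> = (\<Sum>l<N t. \<Sum>m<k t. (cmod (?h (J l m)))\<^sup>2 / (real (k t) * real K * weight (J l m)))"
    by (rule sum_nth)
  also have "\<dots> \<le> (\<Sum>l<N t. \<Sum>m<k t. C\<^sup>2 / (real (k t) * real (N t)))"
  proof (intro sum_mono)
    fix l m assume "l \<in> {..<N t}" "m \<in> {..<k t}"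
    then have i: "J l m < K" using J by auto
    have "(cmod (?h (J l m)) / sqrt (real K / real (N t) * weight (J l m)))\<^sup>2 \<le> C\<^sup>2"
      using C[OF i] weight_nonneg by (intro power_mono) auto
    then have "(cmod (?h (J l m)))\<^sup>2 / (real K / real (N t) * weight (J l m)) \<le> C\<^sup>2"
      using weight_nonneg by (simp add: power_divide)
    then have "(cmod (?h (J l m)))\<^sup>2 / (real K / real (N t) * weight (J l m)) / (real (k t) * real (N t))
        \<le> C\<^sup>2 / (real (k t) * real (N t))"
      by (intro divide_right_mono) auto
    then show "(cmod (?h (J l m)))\<^sup>2 / (real (k t) * real K * weight (J l m)) \<le> C\<^sup>2 / (real (k t) * real (N t))"
      using pos by (simp add: mult_ac)
  qed
  also have "\<dots> = C\<^sup>2"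
    using pos by simp
  finally show ?thesis
    by (rule power2_le_imp_le[OF _ C0])
qed

text \<open>The factor 1 / (1 - \<delta>) is a product of two factors 1 / sqrt(1 - \<delta>): the
  stable grid bounds the \<rho>-norm by the grid norm, which Q turns into the norm of c - R e, and
  the lower frame bound of A_t bounds that by the residual.\<close>

lemma output_error:
  assumes out: "is_output \<psi> K N k Q R z J t f g" and e: "e \<in> carrier_vec (N t)"
    and C: "\<And>i. i < K \<Longrightarrow> cmod (f (z i) - poly_at (N t) \<psi> (vec_index e) (z i)) / sqrt (real K / real (N t) * weight i) \<le> C"
    and stable: "stable_grid \<rho> (N t) \<psi> K \<delta> z"
  shows "\<exists>e'. g = poly_at (N t) \<psi> e' \<and>
    sqrt (\<integral>x. (cmod (poly_at (N t) \<psi> (vec_index e) x - g x))\<^sup>2 \<partial>\<rho>) \<le> 1 / (1 - \<delta>) * C"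
proof -
  obtain c where c: "is_least_squares A (b f) c" and g: "g = (\<lambda>x. \<Sum>i<N t. vec_index c i * phi \<psi> (R t) i x)"
    using out unfolding is_output_def by blast
  have cc: "c \<in> carrier_vec (N t)"
    using c A_carrier by (auto simp: is_least_squares_def)
  have Re: "R t *\<^sub>v e \<in> carrier_vec (N t)" using qr.R e by auto
  let ?e = "qr.Ri *\<^sub>v c"
  have e': "?e \<in> carrier_vec (N t)" using qr.Ri(1) cc by auto
  have g': "g = poly_at (N t) \<psi> (vec_index ?e)"
    unfolding g qr.phi_combination[OF cc] ..
  let ?d = "e - ?e"
  have d: "?d \<in> carrier_vec (N t)" using e e' by auto
  have diff: "poly_at (N t) \<psi> (vec_index e) x - g x = poly_at (N t) \<psi> (vec_index ?d) x" for x
    unfolding g' poly_at_def using e e' qr.Ri(1) by (simp add: right_diff_distrib flip: sum_subtractf)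
  let ?I = "\<integral>x. (cmod (poly_at (N t) \<psi> (vec_index ?d) x))\<^sup>2 \<partial>\<rho>"
  have "(1 - \<delta>) * real K * ?I \<le> real K * (vec_norm2 (B_mat \<psi> K (N t) z *\<^sub>v ?d))\<^sup>2"
    unfolding B_mat_norm[OF d pos(3)] using stable by (simp add: stable_grid_def)
  also have "B_mat \<psi> K (N t) z *\<^sub>v ?d = Q t *\<^sub>v (R t *\<^sub>v ?d)"
    unfolding qr.B_eq by (rule assoc_mult_mat_vec[OF qr.Q qr.R d])
  also have "vec_norm2 \<dots> = vec_norm2 (R t *\<^sub>v ?d)"
    using qr.R d by (intro qr.norm_Q) auto
  also have "R t *\<^sub>v ?d = R t *\<^sub>v e - c"
  proof -
    have "R t *\<^sub>v ?e = c"
      unfolding assoc_mult_mat_vec[OF qr.R qr.Ri(1) cc, symmetric] qr.Ri(2) using cc by simp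
    then show ?thesis
      unfolding mult_minus_distrib_mat_vec[OF qr.R e e'] by simp
  qed
  also have "vec_norm2 (R t *\<^sub>v e - c) = vec_norm2 (c - R t *\<^sub>v e)"
    by (rule vec_norm2_minus_commute[OF Re cc])
  finally have "(1 - \<delta>) * ?I \<le> (vec_norm2 (c - R t *\<^sub>v e))\<^sup>2"
    using pos(3) by (simp add: mult_ac)
  then have "(1 - \<delta>) * ((1 - \<delta>) * ?I) \<le> (1 - \<delta>) * (vec_norm2 (c - R t *\<^sub>v e))\<^sup>2"
    using \<delta> by (intro mult_left_mono) auto
  also have "\<dots> = (sqrt (1 - \<delta>) * vec_norm2 (c - R t *\<^sub>v e))\<^sup>2"
    using \<delta> by (simp add: power_mult_distrib)
  also have "\<dots> \<le> C\<^sup>2"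
    using frame.least_squares_error[OF b_carrier c Re] residual_le[OF e C] \<delta>
    by (intro power_mono) auto
  finally have "?I * (1 - \<delta>)\<^sup>2 \<le> C\<^sup>2"
    by (simp only: power2_eq_square mult_ac)
  then have "?I \<le> (1 / (1 - \<delta>) * C)\<^sup>2"
    using \<delta> by (simp add: power_divide pos_le_divide_eq)
  moreover have "0 \<le> C"
    using residual_le[OF e C] vec_norm2_nonneg order_trans by blast
  ultimately have "sqrt ?I \<le> 1 / (1 - \<delta>) * C"
    using \<delta> by (intro real_le_lsqrt) auto
  then show ?thesis
    unfolding diff using g' by blast
qed

end

text \<open>Integrate (u + v)^2 \<le> (a + b)/a u^2 + (a + b)/b v^2 with a and b slightly above the
  two norms; the right-hand side then integrates to at most (a + b)^2. The slack keeps the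
  denominators positive.\<close>

lemma L2_norm_triangle:
  assumes f: "f \<in> L2_fun \<rho>" and g: "g \<in> L2_fun \<rho>"
  shows "L2_norm \<rho> (\<lambda>x. f x + g x) \<le> L2_norm \<rho> f + L2_norm \<rho> g"
proof (rule field_le_epsilon)
  fix \<epsilon> :: real assume \<epsilon>: "0 < \<epsilon>"
  have mf: "f \<in> borel_measurable \<rho>" "integrable \<rho> (\<lambda>x. (cmod (f x))\<^sup>2)"
    and mg: "g \<in> borel_measurable \<rho>" "integrable \<rho> (\<lambda>x. (cmod (g x))\<^sup>2)"
    using f g by (auto simp: L2_fun_def)
  define a where "a = L2_norm \<rho> f + \<epsilon> / 2"
  define b where "b = L2_norm \<rho> g + \<epsilon> / 2"
  have nn: "0 \<le> L2_norm \<rho> f" "0 \<le> L2_norm \<rho> g"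
    by (simp_all add: L2_norm_def integral_nonneg_AE)
  then have ab: "0 < a" "0 < b" using \<epsilon> by (auto simp: a_def b_def)
  have sq: "(\<integral>x. (cmod (f x))\<^sup>2 \<partial>\<rho>) \<le> a\<^sup>2" "(\<integral>x. (cmod (g x))\<^sup>2 \<partial>\<rho>) \<le> b\<^sup>2"
  proof -
    have "(\<integral>x. (cmod (f x))\<^sup>2 \<partial>\<rho>) = (L2_norm \<rho> f)\<^sup>2" "(\<integral>x. (cmod (g x))\<^sup>2 \<partial>\<rho>) = (L2_norm \<rho> g)\<^sup>2"
      by (simp_all add: L2_norm_def integral_nonneg_AE)
    then show "(\<integral>x. (cmod (f x))\<^sup>2 \<partial>\<rho>) \<le> a\<^sup>2" "(\<integral>x. (cmod (g x))\<^sup>2 \<partial>\<rho>) \<le> b\<^sup>2"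
      using nn \<epsilon> by (auto simp: a_def b_def intro!: power_mono)
  qed
  have pt: "(cmod (f x + g x))\<^sup>2 \<le> (a + b) / a * (cmod (f x))\<^sup>2 + (a + b) / b * (cmod (g x))\<^sup>2" for x
  proof -
    have "(cmod (f x + g x))\<^sup>2 \<le> (cmod (f x) + cmod (g x))\<^sup>2"
      by (intro power_mono norm_triangle_ineq) simp
    also have "\<dots> \<le> (a + b) / a * (cmod (f x))\<^sup>2 + (a + b) / b * (cmod (g x))\<^sup>2"
    proof -
      have "(u + v)\<^sup>2 \<le> (a + b) / a * u\<^sup>2 + (a + b) / b * v\<^sup>2" for u v :: real
      proof -
        have "(a + b) / a * u\<^sup>2 + (a + b) / b * v\<^sup>2 - (u + v)\<^sup>2 = (b * u - a * v)\<^sup>2 / (a * b)"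
          using ab by (simp add: field_simps power2_eq_square)
        also have "\<dots> \<ge> 0" using ab by simp
        finally show ?thesis by simp
      qed
      then show ?thesis .
    qed
    finally show ?thesis .
  qed
  have int: "integrable \<rho> (\<lambda>x. (a + b) / a * (cmod (f x))\<^sup>2 + (a + b) / b * (cmod (g x))\<^sup>2)"
    by (intro Bochner_Integration.integrable_add integrable_mult_right mf mg)
  have "integrable \<rho> (\<lambda>x. (cmod (f x + g x))\<^sup>2)"
  proof (rule Bochner_Integration.integrable_bound[OF int])
    show "(\<lambda>x. (cmod (f x + g x))\<^sup>2) \<in> borel_measurable \<rho>"
      using mf(1) mg(1) by measurable
    show "AE x in \<rho>. norm ((cmod (f x + g x))\<^sup>2) \<le>
        norm ((a + b) / a * (cmod (f x))\<^sup>2 + (a + b) / b * (cmod (g x))\<^sup>2)"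
      unfolding real_norm_def abs_power2 by (intro AE_I2 order_trans[OF pt abs_ge_self])
  qed
  then have "(\<integral>x. (cmod (f x + g x))\<^sup>2 \<partial>\<rho>) \<le> (\<integral>x. (a + b) / a * (cmod (f x))\<^sup>2 + (a + b) / b * (cmod (g x))\<^sup>2 \<partial>\<rho>)"
    by (intro integral_mono int pt)
  also have "\<dots> = (a + b) / a * (\<integral>x. (cmod (f x))\<^sup>2 \<partial>\<rho>) + (a + b) / b * (\<integral>x. (cmod (g x))\<^sup>2 \<partial>\<rho>)"
    by (subst Bochner_Integration.integral_add) (auto intro!: integrable_mult_right mf mg)
  also have "\<dots> \<le> (a + b) / a * a\<^sup>2 + (a + b) / b * b\<^sup>2"
    using ab sq by (intro add_mono mult_left_mono) auto
  also have "\<dots> = (a + b)\<^sup>2"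
    using ab by (simp add: field_simps power2_eq_square)
  finally have "L2_norm \<rho> (\<lambda>x. f x + g x) \<le> a + b"
    unfolding L2_norm_def using ab by (intro real_le_lsqrt) auto
  then show "L2_norm \<rho> (\<lambda>x. f x + g x) \<le> L2_norm \<rho> f + L2_norm \<rho> g + \<epsilon>"
    by (simp add: a_def b_def)
qed

lemma sum_prod_PiE_point:
  fixes p :: "'x \<Rightarrow> 'i \<Rightarrow> real"
  assumes S: "finite S" and I: "finite I" and p: "\<And>x. x \<in> S \<Longrightarrow> sum (p x) I = 1"
  shows "(\<Sum>a\<in>PiE S (\<lambda>_. I). \<Prod>x\<in>S. p x (a x)) = 1"
    and "x0 \<in> S \<Longrightarrow> i0 \<in> I \<Longrightarrow> (\<Sum>a\<in>PiE S (\<lambda>_. I). (\<Prod>x\<in>S. p x (a x)) * of_bool (a x0 = i0)) = p x0 i0"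
proof -
  show "(\<Sum>a\<in>PiE S (\<lambda>_. I). \<Prod>x\<in>S. p x (a x)) = 1"
    using prod_sum_PiE[of S "\<lambda>_. I" p] S I p by simp
  assume x0: "x0 \<in> S" and i0: "i0 \<in> I"
  \<comment> \<open>The indicator of the marginal event is absorbed into the factor of x0, so the
    sum factorises again.\<close>
  define f where "f x i = p x i * (if x = x0 then of_bool (i = i0) else 1)" for x i
  have "(\<Prod>x\<in>S. f x (a x)) = (\<Prod>x\<in>S. p x (a x)) * of_bool (a x0 = i0)" for a
    unfolding f_def prod.distrib using S x0 by simp
  then have "(\<Sum>a\<in>PiE S (\<lambda>_. I). (\<Prod>x\<in>S. p x (a x)) * of_bool (a x0 = i0)) = (\<Prod>x\<in>S. sum (f x) I)"
    using prod_sum_PiE[of S "\<lambda>_. I" f] S I by simp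
  also have "\<dots> = (\<Prod>x\<in>S. if x = x0 then p x0 i0 else 1)"
    by (intro prod.cong refl) (use p I i0 in \<open>auto simp: f_def of_bool_def if_distrib[of "\<lambda>x. _ * x"] cong: if_cong\<close>)
  finally show "(\<Sum>a\<in>PiE S (\<lambda>_. I). (\<Prod>x\<in>S. p x (a x)) * of_bool (a x0 = i0)) = p x0 i0"
    using S x0 by simp
qed

lemma poly_at_extend:
  assumes "m \<le> n"
  shows "poly_at n \<psi> (\<lambda>b. if b < m then d b else 0) x = poly_at m \<psi> d x"
proof -
  have "poly_at n \<psi> (\<lambda>b. if b < m then d b else 0) x = (\<Sum>b<n. if b < m then \<psi> b x * d b else 0)"
    unfolding poly_at_def by (intro sum.cong refl) auto
  also have "\<dots> = (\<Sum>b\<in>{..<n} \<inter> {b. b < m}. \<psi> b x * d b)"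
    by (simp add: sum.If_cases)
  also have "{..<n} \<inter> {b. b < m} = {..<m}"
    using assms by auto
  finally show ?thesis
    by (simp add: poly_at_def)
qed

lemma poly_at_cong: "(\<And>b. b < n \<Longrightarrow> d b = d' b) \<Longrightarrow> poly_at n \<psi> d x = poly_at n \<psi> d' x"
  by (simp add: poly_at_def)

lemma stable_grid_mono:
  assumes "m \<le> n" "stable_grid \<rho> n \<psi> K \<delta> z"
  shows "stable_grid \<rho> m \<psi> K \<delta> z"
  unfolding stable_grid_def
proof
  fix d
  show "(1 - \<delta>) * real K * (\<integral>x. (cmod (poly_at m \<psi> d x))\<^sup>2 \<partial>\<rho>) \<le> (\<Sum>i<K. (cmod (poly_at m \<psi> d (z i)))\<^sup>2)"
    using assms(2)[unfolded stable_grid_def, rule_format, of "\<lambda>b. if b < m then d b else 0"]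
    by (simp add: poly_at_extend[OF assms(1)])
qed

text \<open>The condition of \<open>well_sampled\<close> at the vector R e, multiplied by K and
  expressed through the function with \<psi>-coefficients e. The weights s take the place of the
  squared row norms of Q.\<close>

definition grid_sampled :: "(nat \<Rightarrow> 'a \<Rightarrow> complex) \<Rightarrow> nat \<Rightarrow> nat \<Rightarrow> nat \<Rightarrow> real \<Rightarrow> (nat \<Rightarrow> 'a) \<Rightarrow> (nat \<Rightarrow> real)
    \<Rightarrow> (nat \<times> nat \<Rightarrow> nat) \<Rightarrow> cvector \<Rightarrow> bool" where
  "grid_sampled \<psi> K n k \<delta> z s a d \<longleftrightarrow>
     (1 - \<delta>) * real k * (\<Sum>i<K. (cmod (poly_at n \<psi> d (z i)))\<^sup>2) \<le>
       (\<Sum>l<n. \<Sum>m<k. (cmod (poly_at n \<psi> d (z (a (l, m)))))\<^sup>2 / s (a (l, m))) \<and>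
     (\<Sum>l<n. \<Sum>m<k. (cmod (poly_at n \<psi> d (z (a (l, m)))))\<^sup>2 / s (a (l, m))) \<le>
       (1 + \<delta>) * real k * (\<Sum>i<K. (cmod (poly_at n \<psi> d (z i)))\<^sup>2)"

text \<open>In terms of the functions \<open>\<psi>\<close> the sampling condition no longer depends on the choice of
  the QR decomposition, which need not be measurable in the grid.\<close>

lemma well_sampled_iff:
  assumes QR: "reduced_QR (B_mat \<psi> K n z) Q R K n" and K: "0 < K"
    and a: "\<And>l m. l < n \<Longrightarrow> m < k \<Longrightarrow> a (l, m) < K"
    and s: "\<And>i. i < K \<Longrightarrow> s i = (\<Sum>b<n. (cmod (Q $$ (i, b)))\<^sup>2)"
  shows "well_sampled (\<lambda>i b. Q $$ (i, b)) n k \<delta> a \<longleftrightarrow> (\<forall>d. grid_sampled \<psi> K n k \<delta> z s a d)"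
proof -
  interpret reduced_QR "B_mat \<psi> K n z" Q R K n by fact
  let ?q = "\<lambda>i b. Q $$ (i, b)"
  have nsq_eq: "nsq n (vec_index v) = (vec_norm2 v)\<^sup>2" if "v \<in> carrier_vec n" for v
    using that by (simp add: vec_norm2_sq nsq_def)
  have Bv: "B_mat \<psi> K n z *\<^sub>v e = Q *\<^sub>v (R *\<^sub>v e)" if "e \<in> carrier_vec n" for e
    unfolding B_eq by (rule assoc_mult_mat_vec[OF Q R that])
  have norm: "real K * nsq n (vec_index (R *\<^sub>v e)) = (\<Sum>i<K. (cmod (poly_at n \<psi> (vec_index e) (z i)))\<^sup>2)"
    and form: "real K * sample_form ?q n k a (vec_index (R *\<^sub>v e)) =
      (\<Sum>l<n. \<Sum>m<k. (cmod (poly_at n \<psi> (vec_index e) (z (a (l, m)))))\<^sup>2 / s (a (l, m)))"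
    if e: "e \<in> carrier_vec n" for e
  proof -
    have Re: "R *\<^sub>v e \<in> carrier_vec n" using R e by auto
    show "real K * nsq n (vec_index (R *\<^sub>v e)) = (\<Sum>i<K. (cmod (poly_at n \<psi> (vec_index e) (z i)))\<^sup>2)"
      unfolding nsq_eq[OF Re] B_mat_norm[OF e K, symmetric] Bv[OF e] norm_Q[OF Re] ..
    have q: "(cmod (\<Sum>b<n. Q $$ (i, b) * vec_index (R *\<^sub>v e) b))\<^sup>2 =
        (cmod (poly_at n \<psi> (vec_index e) (z i)))\<^sup>2 / real K" if "i < K" for i
    proof -
      have "(\<Sum>b<n. Q $$ (i, b) * vec_index (R *\<^sub>v e) b) = vec_index (B_mat \<psi> K n z *\<^sub>v e) i"
        unfolding Bv[OF e] by (rule mult_mat_vec_index[OF Q Re that, symmetric])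
      also have "\<dots> = poly_at n \<psi> (vec_index e) (z i) / of_real (sqrt (real K))"
        by (rule B_mat_mult[OF e that])
      finally show ?thesis
        by (simp add: norm_divide power_divide)
    qed
    show "real K * sample_form ?q n k a (vec_index (R *\<^sub>v e)) =
      (\<Sum>l<n. \<Sum>m<k. (cmod (poly_at n \<psi> (vec_index e) (z (a (l, m)))))\<^sup>2 / s (a (l, m)))"
      unfolding sample_form_def sum_distrib_left
    proof (intro sum.cong refl)
      fix l m assume "l \<in> {..<n}" "m \<in> {..<k}"
      then have i: "a (l, m) < K" using a by simp
      show "real K * ((cmod (\<Sum>b<n. Q $$ (a (l, m), b) * vec_index (R *\<^sub>v e) b))\<^sup>2 / (\<Sum>b<n. (cmod (Q $$ (a (l, m), b)))\<^sup>2)) =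
        (cmod (poly_at n \<psi> (vec_index e) (z (a (l, m)))))\<^sup>2 / s (a (l, m))"
        unfolding q[OF i] s[OF i] using K by simp
    qed
  qed
  have key: "grid_sampled \<psi> K n k \<delta> z s a (vec_index e) \<longleftrightarrow>
     (1 - \<delta>) * real k * nsq n (vec_index (R *\<^sub>v e)) \<le> sample_form ?q n k a (vec_index (R *\<^sub>v e)) \<and>
     sample_form ?q n k a (vec_index (R *\<^sub>v e)) \<le> (1 + \<delta>) * real k * nsq n (vec_index (R *\<^sub>v e))"
    if e: "e \<in> carrier_vec n" for e
  proof -
    have c: "(x * y * (real K * u) \<le> real K * v) = (x * y * u \<le> v)"
      "(real K * v \<le> x * y * (real K * u)) = (v \<le> x * y * u)" for x y u v :: real
      using K by (simp_all add: mult.left_commute[of _ "real K"] mult.assoc)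
    show ?thesis
      unfolding grid_sampled_def norm[OF e, symmetric] form[OF e, symmetric] c ..
  qed
  show ?thesis
  proof
    assume w: "well_sampled ?q n k \<delta> a"
    show "\<forall>d. grid_sampled \<psi> K n k \<delta> z s a d"
    proof
      fix d
      have "poly_at n \<psi> d x = poly_at n \<psi> (vec_index (Matrix.vec n d)) x" for x
        by (rule poly_at_cong) simp
      then have "grid_sampled \<psi> K n k \<delta> z s a d = grid_sampled \<psi> K n k \<delta> z s a (vec_index (Matrix.vec n d))"
        unfolding grid_sampled_def by simp
      then show "grid_sampled \<psi> K n k \<delta> z s a d"
        using w key[of "Matrix.vec n d"] unfolding well_sampled_def by simp
    qed
  next
    assume g: "\<forall>d. grid_sampled \<psi> K n k \<delta> z s a d"
    show "well_sampled ?q n k \<delta> a"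
      unfolding well_sampled_def
    proof
      fix d :: cvector
      let ?v = "Matrix.vec n d"
      \<comment> \<open>Surjectivity of R: every vector d is R e for some coefficient vector
        e.\<close>
      let ?e = "Ri *\<^sub>v ?v"
      have e: "?e \<in> carrier_vec n" using Ri(1) by auto
      have Re: "R *\<^sub>v ?e = ?v"
        unfolding assoc_mult_mat_vec[OF R Ri(1) vec_carrier, symmetric] Ri(2) by simp
      have "nsq n d = nsq n (vec_index ?v)" "sample_form ?q n k a d = sample_form ?q n k a (vec_index ?v)"
        by (simp_all add: nsq_def sample_form_def)
      then show "(1 - \<delta>) * real k * nsq n d \<le> sample_form ?q n k a d \<and>
          sample_form ?q n k a d \<le> (1 + \<delta>) * real k * nsq n d"
        using key[OF e] g unfolding Re by simp
    qed
  qed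
qed

lemma well_sampled_cong:
  assumes "\<And>l m. l < n \<Longrightarrow> m < k \<Longrightarrow> a (l, m) = a' (l, m)"
  shows "well_sampled q n k \<delta> a = well_sampled q n k \<delta> a'"
proof -
  have "sample_form q n k a d = sample_form q n k a' d" for d
    unfolding sample_form_def using assms by (intro sum.cong refl) simp
  then show ?thesis by (simp add: well_sampled_def)
qed

lemma L2_fun_add:
  assumes f: "f \<in> L2_fun \<rho>" and g: "g \<in> L2_fun \<rho>"
  shows "(\<lambda>x. f x + g x) \<in> L2_fun \<rho>"
proof -
  have mf: "f \<in> borel_measurable \<rho>" "integrable \<rho> (\<lambda>x. (cmod (f x))\<^sup>2)"
    and mg: "g \<in> borel_measurable \<rho>" "integrable \<rho> (\<lambda>x. (cmod (g x))\<^sup>2)"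
    using f g by (auto simp: L2_fun_def)
  have "integrable \<rho> (\<lambda>x. (cmod (f x + g x))\<^sup>2)"
  proof (rule Bochner_Integration.integrable_bound)
    show "integrable \<rho> (\<lambda>x. 2 * (cmod (f x))\<^sup>2 + 2 * (cmod (g x))\<^sup>2)"
      by (intro Bochner_Integration.integrable_add integrable_mult_right mf mg)
    show "(\<lambda>x. (cmod (f x + g x))\<^sup>2) \<in> borel_measurable \<rho>"
      using mf(1) mg(1) by measurable
    have "(cmod (u + v))\<^sup>2 \<le> 2 * (cmod u)\<^sup>2 + 2 * (cmod v)\<^sup>2" for u v
    proof -
      have "(cmod (u + v))\<^sup>2 \<le> (cmod u + cmod v)\<^sup>2"
        by (intro power_mono norm_triangle_ineq) simp
      also have "\<dots> \<le> 2 * (cmod u)\<^sup>2 + 2 * (cmod v)\<^sup>2"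
        using sum_squares_bound[of "cmod u" "cmod v"] by (simp add: power2_sum)
      finally show ?thesis .
    qed
    then show "AE x in \<rho>. norm ((cmod (f x + g x))\<^sup>2) \<le> norm (2 * (cmod (f x))\<^sup>2 + 2 * (cmod (g x))\<^sup>2)"
      by simp
  qed
  then show ?thesis
    using mf(1) mg(1) by (simp add: L2_fun_def)
qed

lemma L2_fun_diff:
  assumes "f \<in> L2_fun \<rho>" "g \<in> L2_fun \<rho>"
  shows "(\<lambda>x. f x - g x) \<in> L2_fun \<rho>"
proof -
  have "(\<lambda>x. - g x) \<in> L2_fun \<rho>"
    using assms(2) by (simp add: L2_fun_def)
  from L2_fun_add[OF assms(1) this] show ?thesis by simp
qed

lemma Linf_fun_L2_fun:
  assumes "prob_space \<rho>" "f \<in> Linf_fun \<rho>"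
  shows "f \<in> L2_fun \<rho>"
proof -
  interpret prob_space \<rho> by fact
  obtain C where C: "\<And>x. x \<in> space \<rho> \<Longrightarrow> cmod (f x) \<le> C"
    using assms(2) by (auto simp: Linf_fun_def bounded_iff)
  have m: "f \<in> borel_measurable \<rho>"
    using assms(2) by (simp add: Linf_fun_def)
  have "integrable \<rho> (\<lambda>x. (cmod (f x))\<^sup>2)"
  proof (rule integrable_const_bound)
    show "AE x in \<rho>. norm ((cmod (f x))\<^sup>2) \<le> C\<^sup>2"
      using C by (intro AE_I2) (simp add: power_mono)
    show "(\<lambda>x. (cmod (f x))\<^sup>2) \<in> borel_measurable \<rho>"
      using m by measurable
  qed
  with m show ?thesis
    by (simp add: L2_fun_def)
qed

lemma L2_subspaceD:
  assumes "L2_subspace \<rho> P"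
  shows "P \<subseteq> L2_fun \<rho>" "(\<And>j. j < n \<Longrightarrow> \<psi> j \<in> P) \<Longrightarrow> poly_at n \<psi> d \<in> P"
proof -
  interpret fm: Modules.module "\<lambda>(c :: complex) (p :: 'a \<Rightarrow> complex) x. c * p x"
    by unfold_locales (auto simp: fun_eq_iff algebra_simps)
  show "P \<subseteq> L2_fun \<rho>"
    using assms by (simp add: L2_subspace_def)
  assume \<psi>: "\<And>j. j < n \<Longrightarrow> \<psi> j \<in> P"
  have sub: "fm.subspace P"
    using assms by (simp add: L2_subspace_def)
  have "(\<Sum>b<n. (\<lambda>x. d b * \<psi> b x)) \<in> P"
    by (intro fm.subspace_sum[OF sub] fm.subspace_scale[OF sub] \<psi>) simp
  also have "(\<Sum>b<n. (\<lambda>x. d b * \<psi> b x)) = poly_at n \<psi> d"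
  proof
    fix x
    have "(\<Sum>b\<in>T. (\<lambda>x. d b * \<psi> b x)) x = (\<Sum>b\<in>T. d b * \<psi> b x)" for T
      by (induction T rule: infinite_finite_induct) auto
    then show "(\<Sum>b<n. (\<lambda>x. d b * \<psi> b x)) x = poly_at n \<psi> d x"
      by (simp add: poly_at_def mult.commute)
  qed
  finally show "poly_at n \<psi> d \<in> P" .
qed

text \<open>Every number above the infimum exceeds an admissible constant, so the bound holds with
  arbitrarily small slack. Dividing \<epsilon> by the norm plus 1 handles a vanishing norm as
  well.\<close>

lemma nikolskii_bound:
  assumes fin: "nikolskii P \<rho> < \<infinity>" and p: "p \<in> P" and x: "x \<in> space \<rho>"
  shows "cmod (p x) \<le> enn2real (nikolskii P \<rho>) * L2_norm \<rho> p"
proof (rule field_le_epsilon)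
  fix \<epsilon> :: real assume \<epsilon>: "0 < \<epsilon>"
  let ?N = "enn2real (nikolskii P \<rho>)" and ?L = "L2_norm \<rho> p"
  have L: "0 \<le> ?L" by (simp add: L2_norm_def integral_nonneg_AE)
  define \<eta> where "\<eta> = \<epsilon> / (?L + 1)"
  have \<eta>: "0 < \<eta>" using \<epsilon> L by (simp add: \<eta>_def)
  have "nikolskii P \<rho> < ennreal (?N + \<eta>)"
  proof -
    have "nikolskii P \<rho> = ennreal ?N" using fin by (simp add: ennreal_enn2real_if less_top)
    also have "\<dots> < ennreal (?N + \<eta>)" using \<eta> by (intro ennreal_lessI) (auto intro: add_nonneg_pos)
    finally show ?thesis .
  qed
  then obtain C where C: "C < ennreal (?N + \<eta>)" "Linf_norm \<rho> p \<le> C * ennreal ?L"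
    unfolding nikolskii_def Inf_less_iff using p by auto
  have "ennreal (cmod (p x)) \<le> Linf_norm \<rho> p"
    unfolding Linf_norm_def using x by (intro SUP_upper)
  also have "\<dots> \<le> ennreal (?N + \<eta>) * ennreal ?L"
    using C by (meson mult_right_mono order_trans less_imp_le zero_le)
  also have "\<dots> = ennreal ((?N + \<eta>) * ?L)"
    using \<eta> L by (intro ennreal_mult[symmetric]) auto
  finally have "cmod (p x) \<le> (?N + \<eta>) * ?L"
    using \<eta> L by (simp add: mult_nonneg_nonneg)
  also have "\<dots> \<le> ?N * ?L + \<epsilon>"
  proof -
    have "\<eta> * ?L \<le> \<eta> * (?L + 1)" using \<eta> by simp
    also have "\<dots> = \<epsilon>" using L by (simp add: \<eta>_def)
    finally show ?thesis by (simp add: distrib_right)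
  qed
  finally show "cmod (p x) \<le> ?N * ?L + \<epsilon>" .
qed

section \<open>The random experiment\<close>

locale method2_setting =
  fixes \<rho> :: "'a measure" and P :: "nat \<Rightarrow> ('a \<Rightarrow> complex) set" and \<psi> :: "nat \<Rightarrow> 'a \<Rightarrow> complex"
    and r K :: nat and N k :: "nat \<Rightarrow> nat" and \<gamma> \<delta> :: real and \<gamma>s :: "nat \<Rightarrow> real"
    and Q R :: "(nat \<Rightarrow> 'a) \<Rightarrow> nat \<Rightarrow> complex mat" and M :: "'w measure"
    and Z :: "nat \<Rightarrow> 'w \<Rightarrow> 'a" and J :: "nat \<Rightarrow> nat \<Rightarrow> 'w \<Rightarrow> nat"
  assumes rho: "prob_space \<rho>"
    and r_pos: "1 \<le> r"
    and P_subspace: "\<And>t. t \<in> {1..r} \<Longrightarrow> L2_subspace \<rho> (P t)"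
    and N_0: "N 0 = 0"
    and N_increasing: "\<And>t. t < r \<Longrightarrow> N t < N (Suc t)"
    and basis: "\<And>t. t \<in> {1..r} \<Longrightarrow> is_basis \<rho> \<psi> (N t) (P t)"
    and k_0: "k 0 = 0"
    and k_pos: "\<And>t. t \<in> {1..r} \<Longrightarrow> 0 < k t"
    and k_mono: "\<And>t. t \<in> {1..<r} \<Longrightarrow> k t \<le> k (Suc t)"
    and K_ge_N: "N r \<le> K"
    and qr: "QR_choice \<psi> \<rho> K N r Q R"
    and draw: "method2_draw M \<psi> \<rho> K N k r Q Z J"
    and gamma: "\<gamma> \<in> {0<..<1}"
    and delta: "\<delta> \<in> {0<..<1}"
    and gammas: "\<And>t. t \<in> {1..r} \<Longrightarrow> \<gamma>s t \<in> {0<..<1}"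
    and gammas_sum: "(\<Sum>t = 1..r. \<gamma>s t) = \<gamma>"
    and k_large: "\<And>t. t \<in> {1..r} \<Longrightarrow>
           real (k t) \<ge> ln (4 * real (N t) / \<gamma>s t) * inverse ((1 + \<delta>) * ln (1 + \<delta>) - \<delta>)"
    and K_large: "of_nat K \<ge> (nikolskii (P r) \<rho>)\<^sup>2
           * ennreal (ln (2 * real (N r) / \<gamma>) * inverse ((1 - \<delta>) * ln (1 - \<delta>) + \<delta>))"
begin

lemma \<delta>: "0 < \<delta>" "\<delta> < 1"
  using delta by auto

lemma \<gamma>: "0 < \<gamma>" "\<gamma> < 1"
  using gamma by auto

lemma N_mono: "s \<le> t \<Longrightarrow> t \<le> r \<Longrightarrow> N s \<le> N t"
proof (induction t)
  case (Suc t)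
  then show ?case
    using N_increasing[of t] by (cases "s = Suc t") auto
qed simp

lemma k_mono': "s \<le> t \<Longrightarrow> t \<le> r \<Longrightarrow> k s \<le> k t"
proof (induction t)
  case (Suc t)
  have "k t \<le> k (Suc t)"
    using Suc.prems k_mono[of t] k_0 by (cases "t = 0") auto
  with Suc show ?case
    by (cases "s = Suc t") auto
qed simp

lemma N_pos: "t \<in> {1..r} \<Longrightarrow> 0 < N t"
  using N_increasing[of 0] N_mono[of 1 t] by auto

lemma K_pos: "0 < K"
  using N_pos[of r] r_pos K_ge_N by simp

lemma r_in: "r \<in> {1..r}"
  using r_pos by simp

lemma psi: "b < N r \<Longrightarrow> \<psi> b \<in> borel_measurable \<rho>" "b < N r \<Longrightarrow> integrable \<rho> (\<lambda>x. (cmod (\<psi> b x))\<^sup>2)"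
proof -
  have "\<psi> b \<in> L2_fun \<rho>" if "b < N r"
    using basis[OF r_in] L2_subspaceD(1)[OF P_subspace[OF r_in]] that by (auto simp: is_basis_def)
  then show "b < N r \<Longrightarrow> \<psi> b \<in> borel_measurable \<rho>" "b < N r \<Longrightarrow> integrable \<rho> (\<lambda>x. (cmod (\<psi> b x))\<^sup>2)"
    by (auto simp: L2_fun_def)
qed

lemma poly_in_P: "t \<in> {1..r} \<Longrightarrow> poly_at (N t) \<psi> d \<in> P t"
  by (rule L2_subspaceD(2)[OF P_subspace]) (use basis[of t] in \<open>unfold is_basis_def, blast+\<close>)

lemma poly_L2: "t \<in> {1..r} \<Longrightarrow> poly_at (N t) \<psi> d \<in> L2_fun \<rho>"
  using subsetD[OF L2_subspaceD(1)[OF P_subspace] poly_in_P] .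

lemma independent:
  assumes t: "t \<in> {1..r}" and 0: "(\<integral>x. (cmod (poly_at (N t) \<psi> d x))\<^sup>2 \<partial>\<rho>) = 0" and b: "b < N t"
  shows "d b = 0"
proof -
  have "integrable \<rho> (\<lambda>x. (cmod (poly_at (N t) \<psi> d x))\<^sup>2)"
    using poly_L2[OF t] by (simp add: L2_fun_def)
  then have "AE x in \<rho>. (cmod (poly_at (N t) \<psi> d x))\<^sup>2 = 0"
    using 0 by (subst (asm) integral_nonneg_eq_0_iff_AE) auto
  then have "AE x in \<rho>. (\<Sum>j<N t. d j * \<psi> j x) = 0"
    by eventually_elim (simp add: poly_at_def mult.commute)
  then show ?thesis
    using basis[OF t] b unfolding is_basis_def by blast
qed

definition B :: real where
  "B = (enn2real (nikolskii (P r) \<rho>))\<^sup>2"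

lemma log_factor_pos: "0 < ln (2 * real (N r) / \<gamma>)" "0 < rate_lower \<delta>"
proof -
  have "2 * real (N r) / \<gamma> > 1"
    using N_pos[OF r_in] \<gamma> by (simp add: field_simps)
  then show "0 < ln (2 * real (N r) / \<gamma>)" by simp
  show "0 < rate_lower \<delta>"
    using rate_upper_pos[OF \<delta>(1)] rate_upper_le_lower[of \<delta>] \<delta> by linarith
qed

text \<open>The logarithmic factor is positive, so an infinite constant would turn
  \<open>K_large\<close> into the impossible \<infinity> \<le> K.\<close>

lemma nikolskii_finite: "nikolskii (P r) \<rho> < \<infinity>"
proof (rule ccontr)
  assume "\<not> ?thesis"
  then have top: "nikolskii (P r) \<rho> = \<top>"
    by (metis less_top infinity_ennreal_def)
  define c where "c = ln (2 * real (N r) / \<gamma>) * inverse (rate_lower \<delta>)"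
  have c: "0 < c"
    using log_factor_pos by (simp add: c_def)
  have "(\<top> :: ennreal) \<le> of_nat K"
    using K_large[folded rate_lower_def, folded c_def] c
    by (simp add: top power2_eq_square ennreal_top_mult)
  then show False
    by (simp add: top_unique)
qed

lemma poly_bound:
  assumes "x \<in> space \<rho>"
  shows "(cmod (poly_at (N r) \<psi> d x))\<^sup>2 \<le> B * (\<integral>x. (cmod (poly_at (N r) \<psi> d x))\<^sup>2 \<partial>\<rho>)"
proof -
  let ?I = "\<integral>x. (cmod (poly_at (N r) \<psi> d x))\<^sup>2 \<partial>\<rho>"
  have "(cmod (poly_at (N r) \<psi> d x))\<^sup>2 \<le> (enn2real (nikolskii (P r) \<rho>) * L2_norm \<rho> (poly_at (N r) \<psi> d))\<^sup>2"
    by (intro power_mono nikolskii_bound[OF nikolskii_finite poly_in_P[OF r_in] assms]) simp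
  also have "\<dots> = B * ?I"
    by (simp add: B_def L2_norm_def power_mult_distrib integral_nonneg_AE)
  finally show ?thesis .
qed

text \<open>With B = 0 every function in the span of the basis would vanish identically, against
  independence.\<close>

lemma B_pos: "0 < B"
proof (rule ccontr)
  assume "\<not> ?thesis"
  then have "B = 0" by (simp add: B_def)
  let ?d = "\<lambda>_. 1 :: complex"
  have "(\<integral>x. (cmod (poly_at (N r) \<psi> ?d x))\<^sup>2 \<partial>\<rho>) = (\<integral>x. 0 \<partial>\<rho>)"
    using poly_bound[of _ ?d] \<open>B = 0\<close> by (intro Bochner_Integration.integral_cong refl) simp
  then have "?d 0 = 0"
    using independent[OF r_in, of ?d 0] N_pos[OF r_in] by simp
  then show False by simp
qed

lemma K_rate: "ln (2 * real (N r) / \<gamma>) \<le> real K / B * rate_lower \<delta>"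
proof -
  let ?n = "enn2real (nikolskii (P r) \<rho>)" and ?c = "ln (2 * real (N r) / \<gamma>) * inverse (rate_lower \<delta>)"
  have c: "0 \<le> ?c" using log_factor_pos by (intro mult_nonneg_nonneg) auto
  have "nikolskii (P r) \<rho> = ennreal ?n"
    using nikolskii_finite by (simp add: ennreal_enn2real_if less_top)
  from arg_cong[OF this, of "\<lambda>x. x\<^sup>2"] have "(nikolskii (P r) \<rho>)\<^sup>2 = ennreal (?n\<^sup>2)"
    by (simp only: ennreal_power enn2real_nonneg)
  then have "ennreal (?n\<^sup>2) * ennreal ?c \<le> ennreal (real K)"
    using K_large unfolding rate_lower_def[symmetric]
    by (simp only: ennreal_of_nat_eq_real_of_nat)
  then have "ennreal (B * ?c) \<le> ennreal (real K)"
    using c by (simp add: B_def ennreal_mult)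
  then have "B * ?c \<le> real K"
    using ennreal_le_iff[of "real K"] by simp
  then show ?thesis
    using B_pos log_factor_pos(2) by (simp add: field_simps)
qed

sublocale M: prob_space M
  using draw by (simp add: method2_draw_def)

abbreviation "G \<equiv> grid K Z"

abbreviation "PK \<equiv> (\<Pi>\<^sub>M i\<in>{..<K}. \<rho>)"

abbreviation "F \<equiv> vimage_algebra (space M) G PK"

lemma Z_measurable: "i < K \<Longrightarrow> Z i \<in> measurable M \<rho>"
  using draw by (auto simp: method2_draw_def M.indep_vars_def)

lemma G_measurable: "G \<in> measurable M PK"
  unfolding grid_def by (intro measurable_restrict) (simp add: Z_measurable)

lemma G_distr: "distr M PK G = PK"
proof -
  have "M.indep_vars (\<lambda>_. \<rho>) Z {..<K}"
    using draw by (simp add: method2_draw_def)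
  then have "distr M PK (\<lambda>x. \<lambda>i\<in>{..<K}. Z i x) = (\<Pi>\<^sub>M i\<in>{..<K}. distr M \<rho> (Z i))"
    using K_pos Z_measurable by (subst (asm) M.indep_vars_iff_distr_eq_PiM') auto
  also have "\<dots> = PK"
    using draw by (intro PiM_cong) (auto simp: method2_draw_def)
  finally show ?thesis
    unfolding grid_def .
qed

lemma subalgebra_F: "subalgebra M F"
proof -
  have "sets F \<subseteq> sets M"
    unfolding sets_vimage_algebra
    by (intro sets.sigma_sets_subset) (use measurable_sets[OF G_measurable] in auto)
  then show ?thesis
    by (simp add: subalgebra_def)
qed

sublocale FM: finite_measure_subalgebra M F
  by unfold_locales (rule subalgebra_F)

lemma G_space: "\<omega> \<in> space M \<Longrightarrow> G \<omega> \<in> {..<K} \<rightarrow>\<^sub>E space \<rho>"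
  using measurable_space[OF G_measurable] by (simp add: space_PiM)

lemma Z_F_measurable: "i < K \<Longrightarrow> Z i \<in> measurable F \<rho>"
proof -
  assume i: "i < K"
  have "G \<in> measurable F PK"
    using measurable_space[OF G_measurable] by (intro measurable_vimage_algebra1) auto
  then have "(\<lambda>\<omega>. G \<omega> i) \<in> measurable F \<rho>"
    using measurable_component_singleton[of i "{..<K}" "\<lambda>_. \<rho>"] i by (auto intro: measurable_compose)
  moreover have "(\<lambda>\<omega>. G \<omega> i) = Z i"
    using i by (simp add: grid_def)
  ultimately show ?thesis by simp
qed

definition stable :: "'w \<Rightarrow> bool" where
  "stable \<omega> \<longleftrightarrow> stable_grid \<rho> (N r) \<psi> K \<delta> (G \<omega>)"

text \<open>The event is a preimage under the grid map and so lies in \<open>F\<close>, as the later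
  conditioning requires; stability itself is only implied by it.\<close>

lemma stable_event:
  "\<exists>E\<in>sets F. measure M E \<ge> 1 - \<gamma> / 2 \<and> (\<forall>\<omega>\<in>E. stable \<omega>)"
proof -
  interpret PK: prob_space PK
    by (rule prob_space_PiM[OF rho])
  obtain A where A: "A \<in> sets PK" "measure PK A \<le> real (N r) * exp (- (real K / B * rate_lower \<delta>))"
    "{z \<in> space PK. \<not> stable_grid \<rho> (N r) \<psi> K \<delta> z} \<subseteq> A"
  proof -
    have "\<exists>A\<in>sets PK. measure PK A \<le> real (N r) * exp (- (real K / B * rate_lower \<delta>)) \<and>
        {z \<in> space PK. \<not> stable_grid \<rho> (N r) \<psi> K \<delta> z} \<subseteq> A"
      by (rule grid_failure_le) (rule rho psi independent[OF r_in] poly_bound B_pos \<delta> | assumption)+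
    then show ?thesis using that by blast
  qed
  let ?E = "G -` (space PK - A) \<inter> space M"
  have "measure M ?E = measure (distr M PK G) (space PK - A)"
    using A(1) by (intro measure_distr[symmetric] G_measurable) auto
  also have "\<dots> = 1 - measure PK A"
    unfolding G_distr by (rule PK.prob_compl[OF A(1)])
  also have "\<dots> \<ge> 1 - \<gamma> / 2"
  proof -
    have "real (N r) * exp (- (real K / B * rate_lower \<delta>)) \<le> real (N r) * exp (- ln (2 * real (N r) / \<gamma>))"
      using K_rate by (intro mult_left_mono) auto
    also have "\<dots> = \<gamma> / 2"
      using N_pos[OF r_in] \<gamma> by (simp add: exp_minus field_simps)
    finally show ?thesis using A(2) by simp
  qed
  finally have "measure M ?E \<ge> 1 - \<gamma> / 2" .
  moreover have "?E \<in> sets F"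
    using A(1) by (intro in_vimage_algebra) auto
  moreover have "stable \<omega>" if "\<omega> \<in> ?E" for \<omega>
    using that A(3) by (auto simp: stable_def)
  ultimately show ?thesis by blast
qed

lemma B_injective:
  assumes st: "stable \<omega>" and t: "t \<in> {1..r}" and x: "x \<in> carrier_vec (N t)"
    and 0: "B_mat \<psi> K (N t) (G \<omega>) *\<^sub>v x = 0\<^sub>v K"
  shows "x = 0\<^sub>v (N t)"
proof -
  have "stable_grid \<rho> (N t) \<psi> K \<delta> (G \<omega>)"
    by (rule stable_grid_mono[OF N_mono[of t r]]) (use st t in \<open>auto simp: stable_def\<close>)
  then have "(1 - \<delta>) * real K * (\<integral>y. (cmod (poly_at (N t) \<psi> (vec_index x) y))\<^sup>2 \<partial>\<rho>) \<le>
      (\<Sum>i<K. (cmod (poly_at (N t) \<psi> (vec_index x) (G \<omega> i)))\<^sup>2)"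
    unfolding stable_grid_def by blast
  also have "\<dots> = 0"
    using B_mat_norm[OF x K_pos, of \<psi> "G \<omega>"] unfolding 0 by simp
  finally have le: "(1 - \<delta>) * real K * (\<integral>y. (cmod (poly_at (N t) \<psi> (vec_index x) y))\<^sup>2 \<partial>\<rho>) \<le> 0" .
  have "v = 0" if "u * v \<le> 0" "0 < u" "0 \<le> v" for u v :: real
    using that by (simp add: mult_le_0_iff)
  from this[OF le] have "(\<integral>y. (cmod (poly_at (N t) \<psi> (vec_index x) y))\<^sup>2 \<partial>\<rho>) = 0"
    using \<delta> K_pos by (simp add: integral_nonneg_AE)
  from independent[OF t this] show ?thesis
    using x by (intro eq_vecI) auto
qed

lemma B_carrier: "B_mat \<psi> K n z \<in> carrier_mat K n"
  by (simp add: B_mat_def)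

lemma rank_B: "stable \<omega> \<Longrightarrow> t \<in> {1..r} \<Longrightarrow> vec_space.rank K (B_mat \<psi> K (N t) (G \<omega>)) = N t"
  by (rule rank_injective[OF B_carrier B_injective])

lemma QR_stable:
  assumes "stable \<omega>" "\<omega> \<in> space M" "t \<in> {1..r}"
  shows "reduced_QR (B_mat \<psi> K (N t) (G \<omega>)) (Q (G \<omega>) t) (R (G \<omega>) t) K (N t)"
proof
  show "is_reduced_QR (B_mat \<psi> K (N t) (G \<omega>)) (Q (G \<omega>) t) (R (G \<omega>) t)"
    using qr G_space[OF assms(2)] rank_B[OF assms(1) r_in] assms(3) unfolding QR_choice_def by blast
qed (use B_carrier B_injective[OF assms(1,3)] in auto)

text \<open>\<open>samp_prob\<close> reads the modulus from the first pass that contains column l.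
  That pass is at most t, and by \<open>reduced_QR_prefix\<close> every later pass gives the same
  value.\<close>

lemma samp_prob_eq:
  assumes st: "stable \<omega>" "\<omega> \<in> space M" and t: "t \<in> {1..r}" and l: "l < N t" and i: "i < K"
  shows "samp_prob N (Q (G \<omega>)) l i = (cmod (Q (G \<omega>) t $$ (i, l)))\<^sup>2"
proof -
  let ?s = "LEAST s. l < N s"
  have s: "l < N ?s" "?s \<le> t"
    using LeastI[of "\<lambda>s. l < N s", OF l] Least_le[of "\<lambda>s. l < N s", OF l] by auto
  then have "?s \<noteq> 0"
    using N_0 by (metis not_less0)
  then have s': "?s \<in> {1..r}" using s t by auto
  have "cmod (Q (G \<omega>) ?s $$ (i, l)) = cmod (Q (G \<omega>) t $$ (i, l))"
    using s(2) t N_mono[OF s(2)]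
    by (intro reduced_QR_prefix[OF QR_stable[OF st s'] QR_stable[OF st t] _ _ s(1) i]) (auto simp: B_mat_def)
  then show ?thesis
    by (simp add: samp_prob_def)
qed

lemma samp_prob_nonneg: "0 \<le> samp_prob N q l i"
  by (simp add: samp_prob_def)

lemma samp_prob_sum:
  assumes st: "stable \<omega>" "\<omega> \<in> space M" and l: "l < N r"
  shows "(\<Sum>i<K. samp_prob N (Q (G \<omega>)) l i) = 1"
proof -
  interpret reduced_QR "B_mat \<psi> K (N r) (G \<omega>)" "Q (G \<omega>) r" "R (G \<omega>) r" K "N r"
    by (rule QR_stable[OF st r_in])
  have "complex_of_real (\<Sum>i<K. samp_prob N (Q (G \<omega>)) l i) =
      (\<Sum>i<K. cnj (Q (G \<omega>) r $$ (i, l)) * Q (G \<omega>) r $$ (i, l))"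
    unfolding of_real_sum
    by (intro sum.cong refl)
      (simp add: samp_prob_eq[OF st r_in l] complex_norm_square mult.commute del: of_real_power)
  also have "\<dots> = 1"
    using orthonormal[OF l l] by simp
  finally show ?thesis
    using of_real_eq_1_iff by blast
qed

section \<open>Conditional law of the draws, without measurability of the QR factors\<close>

abbreviation "L \<equiv> {..<N r} \<times> {..<k r}"

abbreviation "draws \<equiv> PiE L (\<lambda>_. {..<K})"

definition drawn_event :: "(nat \<times> nat \<Rightarrow> nat) \<Rightarrow> 'w set" where
  "drawn_event a = {\<omega> \<in> space M. \<forall>l<N r. \<forall>m<k r. J l m \<omega> = a (l, m)}"

text \<open>The conditional probability of a table of draws has two forms: \<open>cond_prob\<close>
  is measurable in \<open>F\<close> but determined only almost surely, while
  \<open>draw_weight\<close> is explicit but depends on the possibly nonmeasurable choice of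
  Q.\<close>

definition cond_prob :: "(nat \<times> nat \<Rightarrow> nat) \<Rightarrow> 'w \<Rightarrow> real" where
  "cond_prob a = real_cond_exp M F (indicator (drawn_event a))"

definition draw_weight :: "(nat \<times> nat \<Rightarrow> nat) \<Rightarrow> 'w \<Rightarrow> real" where
  "draw_weight a \<omega> = (\<Prod>x\<in>L. samp_prob N (Q (G \<omega>)) (fst x) (a x))"

lemma finite_draws: "finite draws"
  by (intro finite_PiE) auto

lemma drawn_event_sets: "drawn_event a \<in> sets M"
proof -
  have J: "J l m \<in> measurable M (count_space UNIV)" if "l < N r" "m < k r" for l m
    using draw that by (simp add: method2_draw_def)
  have "{\<omega> \<in> space M. J l m \<omega> = a (l, m)} \<in> sets M" if "l < N r" "m < k r" for l m
    using measurable_sets[OF J[OF that], of "{a (l, m)}"] by (simp add: vimage_def Int_def conj_commute)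
  then have "{\<omega> \<in> space M. \<forall>x\<in>L. J (fst x) (snd x) \<omega> = a x} \<in> sets M"
    using N_pos[OF r_in] k_pos[OF r_in] by (intro sets.sets_Collect_finite_All') (auto simp: lessThan_empty_iff)
  also have "{\<omega> \<in> space M. \<forall>x\<in>L. J (fst x) (snd x) \<omega> = a x} = drawn_event a"
    by (auto simp: drawn_event_def)
  finally show ?thesis .
qed

text \<open>There are finitely many tables, so one null set serves all of them; stability supplies
  the full rank that \<open>method2_draw\<close> asks for.\<close>

lemma cond_prob_AE: "AE \<omega> in M. stable \<omega> \<longrightarrow> (\<forall>a\<in>draws. cond_prob a \<omega> = draw_weight a \<omega>)"
proof -
  have "AE \<omega> in M. stable \<omega> \<longrightarrow> cond_prob a \<omega> = draw_weight a \<omega>" if a: "a \<in> draws" for a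
  proof -
    have "\<forall>l<N r. \<forall>m<k r. a (l, m) < K"
      using a by (auto simp: PiE_iff)
    then have "AE \<omega> in M. vec_space.rank K (B_mat \<psi> K (N r) (G \<omega>)) = N r \<longrightarrow>
           real_cond_exp M F (indicator {\<omega>' \<in> space M. \<forall>l<N r. \<forall>m<k r. J l m \<omega>' = a (l, m)}) \<omega>
           = (\<Prod>l<N r. \<Prod>m<k r. samp_prob N (Q (G \<omega>)) l (a (l, m)))"
      using draw unfolding method2_draw_def by (elim conjE allE[of _ "\<lambda>l m. a (l, m)"]) simp
    then show ?thesis
    proof (eventually_elim, intro impI)
      fix \<omega>
      assume eq: "vec_space.rank K (B_mat \<psi> K (N r) (G \<omega>)) = N r \<longrightarrow>
           real_cond_exp M F (indicator {\<omega>' \<in> space M. \<forall>l<N r. \<forall>m<k r. J l m \<omega>' = a (l, m)}) \<omega>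
           = (\<Prod>l<N r. \<Prod>m<k r. samp_prob N (Q (G \<omega>)) l (a (l, m)))" and st: "stable \<omega>"
      show "cond_prob a \<omega> = draw_weight a \<omega>"
        using eq[rule_format, OF rank_B[OF st r_in]]
        by (simp add: cond_prob_def draw_weight_def drawn_event_def prod.cartesian_product split_def)
    qed
  qed
  then have "AE \<omega> in M. \<forall>a\<in>draws. stable \<omega> \<longrightarrow> cond_prob a \<omega> = draw_weight a \<omega>"
    using finite_draws by (intro AE_finite_allI) auto
  then show ?thesis
    by eventually_elim auto
qed

text \<open>The sampling probabilities are recovered as marginals of the conditional distribution of the
  draws, hence coincide almost surely with random variables that are measurable in the grid.\<close>

definition marginal :: "nat \<Rightarrow> nat \<Rightarrow> 'w \<Rightarrow> real" where
  "marginal l i \<omega> = (\<Sum>a\<in>draws. cond_prob a \<omega> * of_bool (a (l, 0) = i))"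

lemma draw_weight_sum:
  assumes "stable \<omega>" "\<omega> \<in> space M"
  shows "(\<Sum>a\<in>draws. draw_weight a \<omega>) = 1"
  unfolding draw_weight_def
  by (rule sum_prod_PiE_point(1)) (use samp_prob_sum[OF assms] in auto)

lemma marginal_eq:
  assumes st: "stable \<omega>" "\<omega> \<in> space M" and eq: "\<forall>a\<in>draws. cond_prob a \<omega> = draw_weight a \<omega>"
    and l: "l < N r" and i: "i < K"
  shows "marginal l i \<omega> = samp_prob N (Q (G \<omega>)) l i"
proof -
  have "marginal l i \<omega> = (\<Sum>a\<in>draws. draw_weight a \<omega> * of_bool (a (l, 0) = i))"
    unfolding marginal_def by (intro sum.cong refl) (simp add: eq)
  also have "\<dots> = samp_prob N (Q (G \<omega>)) (fst (l, 0 :: nat)) i"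
    unfolding draw_weight_def
    by (rule sum_prod_PiE_point(2)[where p = "\<lambda>x. samp_prob N (Q (G \<omega>)) (fst x)"])
      (use samp_prob_sum[OF st] l i k_pos[OF r_in] in auto)
  finally show ?thesis by simp
qed

text \<open>The grids on which the table a is good for pass t. Marginals in place of the moduli of Q
  make this an event in \<open>F\<close>; by \<open>well_drawn_iff\<close> it agrees with
  \<open>well_sampled\<close> wherever the two forms of the conditional probability agree.\<close>

definition well_drawn :: "nat \<Rightarrow> (nat \<times> nat \<Rightarrow> nat) \<Rightarrow> 'w set" where
  "well_drawn t a = {\<omega> \<in> space M. \<forall>d. grid_sampled \<psi> K (N t) (k t) \<delta> (\<lambda>i. Z i \<omega>)
     (\<lambda>i. \<Sum>b<N t. marginal b i \<omega>) a d}"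

lemma well_drawn_sets:
  assumes t: "t \<in> {1..r}" and a: "a \<in> draws"
  shows "well_drawn t a \<in> sets F"
proof -
  have aK: "a (l, m) < K" if "l < N t" "m < k t" for l m
  proof -
    have "(l, m) \<in> L" using that N_mono[of t r] k_mono'[of t r] t by auto
    then show ?thesis using a by (auto simp: PiE_iff)
  qed
  have marg [measurable]: "marginal l i \<in> borel_measurable F" for l i
    unfolding marginal_def cond_prob_def by measurable
  have poly: "(\<lambda>\<omega>. (cmod (poly_at (N t) \<psi> d (Z i \<omega>)))\<^sup>2) \<in> borel_measurable F" if "i < K" for i d
  proof -
    have "poly_at (N t) \<psi> d \<in> borel_measurable \<rho>"
      using poly_L2[OF t] by (simp add: L2_fun_def)
    from measurable_compose[OF Z_F_measurable[OF that] this] show ?thesis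
      by measurable
  qed
  let ?z = "\<lambda>\<omega> i. Z i \<omega>" and ?s = "\<lambda>\<omega> i. \<Sum>b<N t. marginal b i \<omega>"
  let ?l = "\<lambda>d \<omega>. \<Sum>i<K. (cmod (poly_at (N t) \<psi> d (Z i \<omega>)))\<^sup>2"
  let ?m = "\<lambda>d \<omega>. \<Sum>l<N t. \<Sum>m<k t. (cmod (poly_at (N t) \<psi> d (Z (a (l, m)) \<omega>)))\<^sup>2 / ?s \<omega> (a (l, m))"
  have ml: "?l d \<in> borel_measurable F" for d
    by (intro borel_measurable_sum poly) simp
  have mm: "?m d \<in> borel_measurable F" for d
    by (intro borel_measurable_sum borel_measurable_divide poly marg aK) simp_all
  \<comment> \<open>For fixed \<omega> both inequalities are continuous in d, since the weights do
    not involve d; this makes the quantifier over d harmless.\<close>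
  have "{\<omega> \<in> space F. \<forall>d. grid_sampled \<psi> K (N t) (k t) \<delta> (?z \<omega>) (?s \<omega>) a d} \<in> sets F"
  proof (rule sets_Collect_all_vectors[where n = "N t"])
    fix d
    show "{\<omega> \<in> space F. grid_sampled \<psi> K (N t) (k t) \<delta> (?z \<omega>) (?s \<omega>) a d} \<in> sets F"
      unfolding grid_sampled_def
      by (intro sets.sets_Collect_conj borel_measurable_le borel_measurable_times borel_measurable_const ml mm)
  next
    fix \<omega> d f
    assume g: "\<And>j. grid_sampled \<psi> K (N t) (k t) \<delta> (?z \<omega>) (?s \<omega>) a (f j)"
      and lim: "\<And>i. i < N t \<Longrightarrow> (\<lambda>j. f j i) \<longlonglongrightarrow> d i"
    have p: "(\<lambda>j. (cmod (poly_at (N t) \<psi> (f j) x))\<^sup>2) \<longlonglongrightarrow> (cmod (poly_at (N t) \<psi> d x))\<^sup>2" for x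
      unfolding poly_at_def by (intro tendsto_intros lim) simp
    have pd: "(\<lambda>j. (cmod (poly_at (N t) \<psi> (f j) x))\<^sup>2 / s) \<longlonglongrightarrow> (cmod (poly_at (N t) \<psi> d x))\<^sup>2 / s" for x s
      unfolding divide_inverse by (intro tendsto_intros p)
    have "(\<lambda>j. (1 - \<delta>) * real (k t) * ?l (f j) \<omega>) \<longlonglongrightarrow> (1 - \<delta>) * real (k t) * ?l d \<omega>"
      "(\<lambda>j. ?m (f j) \<omega>) \<longlonglongrightarrow> ?m d \<omega>"
      "(\<lambda>j. (1 + \<delta>) * real (k t) * ?l (f j) \<omega>) \<longlonglongrightarrow> (1 + \<delta>) * real (k t) * ?l d \<omega>"
      by (intro tendsto_mult tendsto_const tendsto_sum p pd)+
    then show "grid_sampled \<psi> K (N t) (k t) \<delta> (?z \<omega>) (?s \<omega>) a d"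
      using g unfolding grid_sampled_def by (blast intro: LIMSEQ_le)
  qed
  then show ?thesis
    by (simp add: well_drawn_def)
qed

lemma well_drawn_iff:
  assumes st: "stable \<omega>" "\<omega> \<in> space M" and eq: "\<forall>a\<in>draws. cond_prob a \<omega> = draw_weight a \<omega>"
    and t: "t \<in> {1..r}" and a: "a \<in> draws"
  shows "\<omega> \<in> well_drawn t a \<longleftrightarrow> well_sampled (\<lambda>i b. Q (G \<omega>) t $$ (i, b)) (N t) (k t) \<delta> a"
proof -
  have aK: "a (l, m) < K" if "l < N t" "m < k t" for l m
  proof -
    have "(l, m) \<in> L" using that N_mono[of t r] k_mono'[of t r] t by auto
    then show ?thesis using a by (auto simp: PiE_iff)
  qed
  let ?s = "\<lambda>i. \<Sum>b<N t. marginal b i \<omega>"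
  have s: "?s i = (\<Sum>b<N t. (cmod (Q (G \<omega>) t $$ (i, b)))\<^sup>2)" if i: "i < K" for i
  proof -
    have "(\<Sum>b<N t. marginal b i \<omega>) = (\<Sum>b<N t. (cmod (Q (G \<omega>) t $$ (i, b)))\<^sup>2)"
    proof (intro sum.cong refl)
      fix b assume "b \<in> {..<N t}"
      then have b: "b < N t" by simp
      then have "b < N r" using N_mono[of t r] t by auto
      then show "marginal b i \<omega> = (cmod (Q (G \<omega>) t $$ (i, b)))\<^sup>2"
        by (simp add: marginal_eq[OF st eq _ i] samp_prob_eq[OF st t b i])
    qed
    then show ?thesis using K_pos by simp
  qed
  have "grid_sampled \<psi> K (N t) (k t) \<delta> (\<lambda>i. Z i \<omega>) ?s a = grid_sampled \<psi> K (N t) (k t) \<delta> (G \<omega>) ?s a"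
  proof
    fix d
    have "(\<Sum>i<K. (cmod (poly_at (N t) \<psi> d (Z i \<omega>)))\<^sup>2) = (\<Sum>i<K. (cmod (poly_at (N t) \<psi> d (G \<omega> i)))\<^sup>2)"
      by (intro sum.cong refl) (simp add: grid_def)
    moreover have "(\<Sum>l<N t. \<Sum>m<k t. (cmod (poly_at (N t) \<psi> d (Z (a (l, m)) \<omega>)))\<^sup>2 / ?s (a (l, m))) =
        (\<Sum>l<N t. \<Sum>m<k t. (cmod (poly_at (N t) \<psi> d (G \<omega> (a (l, m)))))\<^sup>2 / ?s (a (l, m)))"
      by (intro sum.cong refl) (simp add: grid_def aK)
    ultimately show "grid_sampled \<psi> K (N t) (k t) \<delta> (\<lambda>i. Z i \<omega>) ?s a d =
        grid_sampled \<psi> K (N t) (k t) \<delta> (G \<omega>) ?s a d"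
      unfolding grid_sampled_def by simp
  qed
  then show ?thesis
    using well_sampled_iff[where s = ?s and a = a and K = K and n = "N t" and k = "k t" and Q = "Q (G \<omega>) t",
        OF QR_stable[OF st t] K_pos aK s] st(2)
    by (simp add: well_drawn_def)
qed

text \<open>A union bound over the passes: given a stable grid, pass t fails with weight at most
  \<gamma>_t / 2, and these sum to \<gamma> / 2.\<close>

lemma well_drawn_weight:
  assumes st: "stable \<omega>" "\<omega> \<in> space M" and eq: "\<forall>a\<in>draws. cond_prob a \<omega> = draw_weight a \<omega>"
  shows "1 - \<gamma> / 2 \<le> (\<Sum>a\<in>draws. draw_weight a \<omega> * of_bool (\<forall>t\<in>{1..r}. \<omega> \<in> well_drawn t a))"
proof -
  have w0: "0 \<le> draw_weight a \<omega>" for a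
    unfolding draw_weight_def by (intro prod_nonneg samp_prob_nonneg)
  have fail: "(\<Sum>a\<in>draws. draw_weight a \<omega> * of_bool (\<omega> \<notin> well_drawn t a)) \<le> \<gamma>s t / 2" if t: "t \<in> {1..r}" for t
  proof -
    interpret reduced_QR "B_mat \<psi> K (N t) (G \<omega>)" "Q (G \<omega>) t" "R (G \<omega>) t" K "N t"
      by (rule QR_stable[OF st t])
    have "(\<Sum>a\<in>draws. draw_weight a \<omega> * of_bool (\<omega> \<notin> well_drawn t a)) =
        (\<Sum>a\<in>draws. (\<Prod>x\<in>L. samp_prob N (Q (G \<omega>)) (fst x) (a x)) *
          of_bool (\<not> well_sampled (\<lambda>i b. Q (G \<omega>) t $$ (i, b)) (N t) (k t) \<delta> a))"
      by (intro sum.cong refl) (simp add: well_drawn_iff[OF st eq t] draw_weight_def)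
    also have "\<dots> \<le> \<gamma>s t / 2"
    proof (rule sampling_failure_le)
      show "N t \<le> N r" "k t \<le> k r"
        using N_mono[of t r] k_mono'[of t r] t by auto
      show "real (k t) \<ge> ln (4 * real (N t) / \<gamma>s t) / rate_upper \<delta>"
        using k_large[OF t] by (simp add: rate_upper_def divide_inverse)
      show "0 < \<gamma>s t"
        using gammas[OF t] by simp
    qed (use orthonormal samp_prob_sum[OF st] samp_prob_eq[OF st t] samp_prob_nonneg N_pos[OF t] \<delta> in auto)
    finally show ?thesis .
  qed
  have "1 = (\<Sum>a\<in>draws. draw_weight a \<omega>)"
    using draw_weight_sum[OF st] by simp
  also have "\<dots> \<le> (\<Sum>a\<in>draws. draw_weight a \<omega> * of_bool (\<forall>t\<in>{1..r}. \<omega> \<in> well_drawn t a) +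
      (\<Sum>t=1..r. draw_weight a \<omega> * of_bool (\<omega> \<notin> well_drawn t a)))"
  proof (rule sum_mono)
    fix a
    show "draw_weight a \<omega> \<le> draw_weight a \<omega> * of_bool (\<forall>t\<in>{1..r}. \<omega> \<in> well_drawn t a) +
      (\<Sum>t=1..r. draw_weight a \<omega> * of_bool (\<omega> \<notin> well_drawn t a))"
    proof (cases "\<forall>t\<in>{1..r}. \<omega> \<in> well_drawn t a")
      case True
      then show ?thesis
        using w0 by (simp add: sum_nonneg)
    next
      case False
      then obtain t where t: "t \<in> {1..r}" "\<omega> \<notin> well_drawn t a" by blast
      have "draw_weight a \<omega> * of_bool (\<omega> \<notin> well_drawn t a) \<le>
          (\<Sum>t=1..r. draw_weight a \<omega> * of_bool (\<omega> \<notin> well_drawn t a))"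
        by (rule member_le_sum) (use t w0 in auto)
      moreover have "0 \<le> draw_weight a \<omega> * of_bool (\<forall>t\<in>{1..r}. \<omega> \<in> well_drawn t a)"
        using w0 by simp
      ultimately show ?thesis
        using t(2) by simp
    qed
  qed
  also have "\<dots> = (\<Sum>a\<in>draws. draw_weight a \<omega> * of_bool (\<forall>t\<in>{1..r}. \<omega> \<in> well_drawn t a)) +
      (\<Sum>t=1..r. \<Sum>a\<in>draws. draw_weight a \<omega> * of_bool (\<omega> \<notin> well_drawn t a))"
    unfolding sum.distrib by (intro arg_cong2[of _ _ _ _ "(+)"] refl sum.swap)
  also have "(\<Sum>t=1..r. \<Sum>a\<in>draws. draw_weight a \<omega> * of_bool (\<omega> \<notin> well_drawn t a)) \<le> (\<Sum>t=1..r. \<gamma>s t / 2)"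
    by (intro sum_mono fail)
  also have "\<dots> = \<gamma> / 2"
    unfolding sum_divide_distrib[symmetric] gammas_sum ..
  finally show ?thesis by simp
qed

section \<open>The success event and its consequences\<close>

lemma integrable_event: "A \<in> sets M \<Longrightarrow> integrable M (indicator A :: 'w \<Rightarrow> real)"
  by (rule integrable_real_indicator) (auto simp: M.emeasure_eq_measure)

text \<open>Conditioning on the grid bounds the probability below by (1 - \<gamma>/2) times that of
  the stable event. Splitting by the table a actually drawn makes each piece an event in
  \<open>F\<close> intersected with \<open>drawn_event a\<close>, the form that conditional
  expectations can handle.\<close>

lemma success_event:
  "\<exists>E\<in>sets M. measure M E \<ge> 1 - \<gamma> \<and>
    (\<forall>\<omega>\<in>E. \<omega> \<in> space M \<and> stable \<omega> \<and> (\<forall>a\<in>draws. cond_prob a \<omega> = draw_weight a \<omega>) \<and>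
      (\<exists>a\<in>draws. \<omega> \<in> drawn_event a \<and> (\<forall>t\<in>{1..r}. \<omega> \<in> well_drawn t a)))"
proof -
  obtain E1 where E1: "E1 \<in> sets F" "measure M E1 \<ge> 1 - \<gamma> / 2" "\<And>\<omega>. \<omega> \<in> E1 \<Longrightarrow> stable \<omega>"
    using stable_event by blast
  have FM: "A \<in> sets M" if "A \<in> sets F" for A
    using subalgebra_F that by (auto simp: subalgebra_def)
  have E1s: "\<omega> \<in> space M" if "\<omega> \<in> E1" for \<omega>
    using sets.sets_into_space[OF FM[OF E1(1)]] that by blast
  obtain N0 where N0: "N0 \<in> null_sets M"
    "{\<omega> \<in> space M. \<not> (stable \<omega> \<longrightarrow> (\<forall>a\<in>draws. cond_prob a \<omega> = draw_weight a \<omega>))} \<subseteq> N0"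
    using cond_prob_AE by (auto simp: eventually_ae_filter)
  define W where "W a = E1 \<inter> (\<Inter>t\<in>{1..r}. well_drawn t a)" for a
  have W: "W a \<in> sets F" if "a \<in> draws" for a
    unfolding W_def using r_in that
    by (intro sets.Int E1(1) sets.finite_INT well_drawn_sets) auto
  define E2 where "E2 = (\<Union>a\<in>draws. W a \<inter> drawn_event a)"
  have E2: "E2 \<in> sets M"
    unfolding E2_def by (intro sets.finite_UN finite_draws sets.Int FM W drawn_event_sets)
  have disj: "disjoint_family_on (\<lambda>a. W a \<inter> drawn_event a) draws"
    unfolding disjoint_family_on_def
  proof (intro ballI impI)
    fix a a' assume a: "a \<in> draws" "a' \<in> draws" "a \<noteq> a'"
    have "a = a'" if "\<omega> \<in> drawn_event a" "\<omega> \<in> drawn_event a'" for \<omega>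
      by (rule PiE_ext[OF a(1,2)]) (use that in \<open>auto simp: drawn_event_def\<close>)
    with a(3) show "W a \<inter> drawn_event a \<inter> (W a' \<inter> drawn_event a') = {}"
      by blast
  qed
  have int: "integrable M (\<lambda>\<omega>. indicator (W a) \<omega> * cond_prob a \<omega>)" if a: "a \<in> draws" for a
    using integrable_mult_indicator[OF FM[OF W[OF a]], of "cond_prob a"]
      FM.real_cond_exp_int(1)[OF integrable_event[OF drawn_event_sets[of a]]]
    by (simp add: cond_prob_def)
  \<comment> \<open>The defining property of conditional expectation, available because
    \<open>W a\<close> lies in \<open>F\<close>.\<close>
  have piece: "measure M (W a \<inter> drawn_event a) = (\<integral>\<omega>. indicator (W a) \<omega> * cond_prob a \<omega> \<partial>M)" if a: "a \<in> draws" for a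
  proof -
    have "measure M (W a \<inter> drawn_event a) = (\<integral>\<omega>\<in>W a. indicator (drawn_event a) \<omega> \<partial>M)"
      unfolding set_lebesgue_integral_def using FM[OF W[OF a]] drawn_event_sets[of a]
      by (simp flip: indicator_inter_arith)
    also have "\<dots> = (\<integral>\<omega>\<in>W a. cond_prob a \<omega> \<partial>M)"
      unfolding cond_prob_def
      by (rule FM.real_cond_exp_intA[OF integrable_event[OF drawn_event_sets] W[OF a]])
    finally show ?thesis
      by (simp add: set_lebesgue_integral_def)
  qed
  have "measure M E2 = (\<Sum>a\<in>draws. measure M (W a \<inter> drawn_event a))"
    unfolding E2_def
    by (rule M.finite_measure_finite_Union[OF finite_draws _ disj]) (use FM W drawn_event_sets in auto)
  also have "\<dots> = (\<integral>\<omega>. (\<Sum>a\<in>draws. indicator (W a) \<omega> * cond_prob a \<omega>) \<partial>M)"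
    using int by (simp add: piece Bochner_Integration.integral_sum)
  also have "\<dots> \<ge> (\<integral>\<omega>. (1 - \<gamma> / 2) * indicator E1 \<omega> \<partial>M)"
  proof (rule integral_mono_AE)
    show "integrable M (\<lambda>\<omega>. \<Sum>a\<in>draws. indicator (W a) \<omega> * cond_prob a \<omega>)"
      by (intro Bochner_Integration.integrable_sum int)
    show "integrable M (\<lambda>\<omega>. (1 - \<gamma> / 2) * indicator E1 \<omega>)"
      by (intro integrable_mult_right integrable_event FM E1(1))
    have "AE \<omega> in M. \<omega> \<in> space M" by simp
    with cond_prob_AE show "AE \<omega> in M. (1 - \<gamma> / 2) * indicator E1 \<omega> \<le> (\<Sum>a\<in>draws. indicator (W a) \<omega> * cond_prob a \<omega>)"
    proof eventually_elim
      fix \<omega> assume eq: "stable \<omega> \<longrightarrow> (\<forall>a\<in>draws. cond_prob a \<omega> = draw_weight a \<omega>)" and sp: "\<omega> \<in> space M"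
      show "(1 - \<gamma> / 2) * indicator E1 \<omega> \<le> (\<Sum>a\<in>draws. indicator (W a) \<omega> * cond_prob a \<omega>)"
      proof (cases "\<omega> \<in> E1")
        case True
        with eq E1(3) have st: "stable \<omega>" and eq: "\<forall>a\<in>draws. cond_prob a \<omega> = draw_weight a \<omega>" by auto
        have "(\<Sum>a\<in>draws. indicator (W a) \<omega> * cond_prob a \<omega>) =
            (\<Sum>a\<in>draws. draw_weight a \<omega> * of_bool (\<forall>t\<in>{1..r}. \<omega> \<in> well_drawn t a))"
          using True eq by (intro sum.cong refl) (auto simp: W_def indicator_def)
        then show ?thesis
          using well_drawn_weight[OF st sp eq] True by simp
      next
        case False
        then have "(\<Sum>a\<in>draws. indicator (W a) \<omega> * cond_prob a \<omega>) = 0"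
          by (intro sum.neutral ballI) (simp add: W_def)
        with False show ?thesis by simp
      qed
    qed
  qed
  also have "(\<integral>\<omega>. (1 - \<gamma> / 2) * indicator E1 \<omega> \<partial>M) = (1 - \<gamma> / 2) * measure M E1"
    using FM[OF E1(1)] by simp
  finally have "(1 - \<gamma> / 2) * measure M E1 \<le> measure M E2" .
  moreover have "(1 - \<gamma> / 2) * (1 - \<gamma> / 2) \<le> (1 - \<gamma> / 2) * measure M E1"
    using E1(2) \<gamma> by (intro mult_left_mono) auto
  \<comment> \<open>The square equals 1 - \<gamma> + \<gamma>^2/4.\<close>
  moreover have "1 - \<gamma> \<le> (1 - \<gamma> / 2) * (1 - \<gamma> / 2)"
    by (simp add: algebra_simps)
  ultimately have "1 - \<gamma> \<le> measure M E2" by linarith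
  \<comment> \<open>Removing the null set makes the identification of the conditional probabilities
    valid at every point of the event, so that the remaining argument is pointwise.\<close>
  also have "measure M E2 = measure M (E2 - N0)"
    using N0(1) E2 by (simp add: measure_Diff_null_set)
  finally have "1 - \<gamma> \<le> measure M (E2 - N0)" .
  moreover have "E2 - N0 \<in> sets M"
    using E2 N0(1) by auto
  moreover have "\<omega> \<in> space M \<and> stable \<omega> \<and> (\<forall>a\<in>draws. cond_prob a \<omega> = draw_weight a \<omega>) \<and>
      (\<exists>a\<in>draws. \<omega> \<in> drawn_event a \<and> (\<forall>t\<in>{1..r}. \<omega> \<in> well_drawn t a))" if \<omega>: "\<omega> \<in> E2 - N0" for \<omega>
  proof -
    obtain a where a: "a \<in> draws" "\<omega> \<in> W a" "\<omega> \<in> drawn_event a"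
      using \<omega> by (auto simp: E2_def)
    then have "\<omega> \<in> E1" by (simp add: W_def)
    then have "\<omega> \<in> space M" "stable \<omega>" using E1s E1(3) by auto
    moreover have "\<forall>a\<in>draws. cond_prob a \<omega> = draw_weight a \<omega>"
      using N0(2) \<omega> calculation by auto
    ultimately show ?thesis
      using a by (auto simp: W_def)
  qed
  ultimately show ?thesis by blast
qed

lemma pass_conclusion:
  assumes sp: "\<omega> \<in> space M" and st: "stable \<omega>" and eq: "\<forall>a\<in>draws. cond_prob a \<omega> = draw_weight a \<omega>"
    and a: "a \<in> draws" "\<omega> \<in> drawn_event a" "\<omega> \<in> well_drawn t a" and t: "t \<in> {1..r}"
  shows "cond2 (A_mat N k (Q (G \<omega>)) (\<lambda>l m. J l m \<omega>) t) \<le> ereal (sqrt ((1 + \<delta>) / (1 - \<delta>)))"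
    and "f \<in> Linf_fun \<rho> \<Longrightarrow> \<exists>!g. is_output \<psi> K N k (Q (G \<omega>)) (R (G \<omega>)) (G \<omega>) (\<lambda>l m. J l m \<omega>) t f g"
    and "f \<in> Linf_fun \<rho> \<Longrightarrow> is_output \<psi> K N k (Q (G \<omega>)) (R (G \<omega>)) (G \<omega>) (\<lambda>l m. J l m \<omega>) t f g \<Longrightarrow>
      L2_norm \<rho> (\<lambda>x. f x - g x) \<le>
        (INF p\<in>P t. L2_norm \<rho> (\<lambda>x. f x - p x) + 1 / (1 - \<delta>) *
          Max ((\<lambda>i. cmod (f (Z i \<omega>) - p (Z i \<omega>)) /
             sqrt (real K / real (N t) * (\<Sum>l<N t. samp_prob N (Q (G \<omega>)) l i))) ` {..<K}))"
proof -
  have sub: "l < N r" "m < k r" if "l < N t" "m < k t" for l m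
    using that N_mono[of t r] k_mono'[of t r] t by auto
  have J: "J l m \<omega> = a (l, m)" "a (l, m) < K" if "l < N t" "m < k t" for l m
    using a(1,2) sub[OF that] by (auto simp: drawn_event_def PiE_iff)
  have st_t: "stable_grid \<rho> (N t) \<psi> K \<delta> (G \<omega>)"
    by (rule stable_grid_mono[OF N_mono[of t r]]) (use st t in \<open>auto simp: stable_def\<close>)
  interpret sampling_pass \<psi> K N k "Q (G \<omega>)" "R (G \<omega>)" "G \<omega>" "\<lambda>l m. J l m \<omega>" t \<delta>
  proof (rule sampling_pass.intro)
    show "N s \<le> N (Suc s)" "k s \<le> k (Suc s)" if "s < t" for s
      using N_mono[of s "Suc s"] k_mono'[of s "Suc s"] that t by auto
    show "0 < N t" "0 < k t" by (rule N_pos[OF t], rule k_pos[OF t])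
    show "reduced_QR (B_mat \<psi> K (N t) (G \<omega>)) (Q (G \<omega>) t) (R (G \<omega>) t) K (N t)"
      by (rule QR_stable[OF st sp t])
    show "(\<Sum>l<N t. samp_prob N (Q (G \<omega>)) l i) = (\<Sum>b<N t. (cmod (Q (G \<omega>) t $$ (i, b)))\<^sup>2)" if "i < K" for i
      by (intro sum.cong refl samp_prob_eq[OF st sp t _ that]) simp
    show "J l m \<omega> < K" if "l < N t" "m < k t" for l m
      using J[OF that] by simp
    have "well_sampled (\<lambda>i b. Q (G \<omega>) t $$ (i, b)) (N t) (k t) \<delta> a"
      using a(3) well_drawn_iff[OF st sp eq t a(1)] by simp
    then show "well_sampled (\<lambda>i b. Q (G \<omega>) t $$ (i, b)) (N t) (k t) \<delta> (\<lambda>(l, m). J l m \<omega>)"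
      by (subst well_sampled_cong[where a' = a]) (auto simp: J)
  qed (use N_0 K_pos \<delta> in auto)
  show "cond2 (A_mat N k (Q (G \<omega>)) (\<lambda>l m. J l m \<omega>) t) \<le> ereal (sqrt ((1 + \<delta>) / (1 - \<delta>)))"
    by (rule frame.cond2_le)
  assume f: "f \<in> Linf_fun \<rho>"
  show "\<exists>!g. is_output \<psi> K N k (Q (G \<omega>)) (R (G \<omega>)) (G \<omega>) (\<lambda>l m. J l m \<omega>) t f g"
    by (rule unique_output)
  assume out: "is_output \<psi> K N k (Q (G \<omega>)) (R (G \<omega>)) (G \<omega>) (\<lambda>l m. J l m \<omega>) t f g"
  have fL2: "f \<in> L2_fun \<rho>"
    by (rule Linf_fun_L2_fun[OF rho f])
  show "L2_norm \<rho> (\<lambda>x. f x - g x) \<le>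
        (INF p\<in>P t. L2_norm \<rho> (\<lambda>x. f x - p x) + 1 / (1 - \<delta>) *
          Max ((\<lambda>i. cmod (f (Z i \<omega>) - p (Z i \<omega>)) /
             sqrt (real K / real (N t) * (\<Sum>l<N t. samp_prob N (Q (G \<omega>)) l i))) ` {..<K}))"
  proof (rule cINF_greatest)
    show "P t \<noteq> {}"
      using poly_in_P[OF t] by blast
    fix p assume p: "p \<in> P t"
    let ?C = "Max ((\<lambda>i. cmod (f (Z i \<omega>) - p (Z i \<omega>)) /
             sqrt (real K / real (N t) * (\<Sum>l<N t. samp_prob N (Q (G \<omega>)) l i))) ` {..<K})"
    \<comment> \<open>The expansion holds at every point of the domain and can therefore be
      evaluated at the grid points; an almost everywhere identity would not suffice.\<close>
    obtain c where c: "\<And>x. x \<in> space \<rho> \<Longrightarrow> p x = (\<Sum>j<N t. c j * \<psi> j x)"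
      using basis[OF t] p unfolding is_basis_def by blast
    define e where "e = Matrix.vec (N t) c"
    have e: "e \<in> carrier_vec (N t)" by (simp add: e_def)
    have pe: "p x = poly_at (N t) \<psi> (vec_index e) x" if "x \<in> space \<rho>" for x
      unfolding c[OF that] poly_at_def by (intro sum.cong refl) (simp add: e_def mult.commute)
    have "cmod (f (G \<omega> i) - poly_at (N t) \<psi> (vec_index e) (G \<omega> i)) / sqrt (real K / real (N t) * weight i) \<le> ?C"
      if i: "i < K" for i
    proof -
      have Z: "G \<omega> i = Z i \<omega>" "Z i \<omega> \<in> space \<rho>"
        using i measurable_space[OF Z_measurable[OF i] sp] by (simp_all add: grid_def)
      show ?thesis
        unfolding Z(1) pe[OF Z(2), symmetric] weight_def by (rule Max_ge) (use i in auto)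
    qed
    from output_error[OF out e this st_t] obtain e' where g: "g = poly_at (N t) \<psi> e'"
      and err: "sqrt (\<integral>x. (cmod (poly_at (N t) \<psi> (vec_index e) x - g x))\<^sup>2 \<partial>\<rho>) \<le> 1 / (1 - \<delta>) * ?C"
      by blast
    have "L2_norm \<rho> (\<lambda>x. p x - g x) = sqrt (\<integral>x. (cmod (poly_at (N t) \<psi> (vec_index e) x - g x))\<^sup>2 \<partial>\<rho>)"
      unfolding L2_norm_def
      by (intro arg_cong[of _ _ sqrt] Bochner_Integration.integral_cong refl) (simp add: pe)
    with err have err': "L2_norm \<rho> (\<lambda>x. p x - g x) \<le> 1 / (1 - \<delta>) * ?C" by simp
    have pL2: "p \<in> L2_fun \<rho>"
      using p L2_subspaceD(1)[OF P_subspace[OF t]] by blast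
    have gL2: "g \<in> L2_fun \<rho>"
      unfolding g by (rule poly_L2[OF t])
    have "L2_norm \<rho> (\<lambda>x. f x - g x) \<le> L2_norm \<rho> (\<lambda>x. f x - p x) + L2_norm \<rho> (\<lambda>x. p x - g x)"
      using L2_norm_triangle[OF L2_fun_diff[OF fL2 pL2] L2_fun_diff[OF pL2 gL2]] by simp
    with err' show "L2_norm \<rho> (\<lambda>x. f x - g x) \<le> L2_norm \<rho> (\<lambda>x. f x - p x) + 1 / (1 - \<delta>) * ?C"
      by linarith
  qed
qed

end

section \<open>The error bound\<close>

theorem theorem2p2:
  fixes \<Omega> :: "(real ^ 'd) set"
    and \<rho> :: "(real ^ 'd) measure"
    and P :: "nat \<Rightarrow> (real ^ 'd \<Rightarrow> complex) set"
    and \<psi> :: "nat \<Rightarrow> real ^ 'd \<Rightarrow> complex"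
    and r K :: nat
    and N k :: "nat \<Rightarrow> nat"
    and \<gamma> \<delta> :: real
    and \<gamma>s :: "nat \<Rightarrow> real"
    and Q R :: "(nat \<Rightarrow> real ^ 'd) \<Rightarrow> nat \<Rightarrow> complex mat"
    and M :: "'w measure"
    and Z :: "nat \<Rightarrow> 'w \<Rightarrow> real ^ 'd"
    and J :: "nat \<Rightarrow> nat \<Rightarrow> 'w \<Rightarrow> nat"
  assumes domain: "\<Omega> \<in> sets borel"
    and rho: "prob_space \<rho>" "space \<rho> = \<Omega>" "sets \<rho> = sets (restrict_space borel \<Omega>)"
    and r_pos: "1 \<le> r"
    and P_subspace: "\<And>t. t \<in> {1..r} \<Longrightarrow> L2_subspace \<rho> (P t)"
    and P_nested: "\<And>t. t \<in> {1..<r} \<Longrightarrow> P t \<subseteq> P (Suc t)"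
    and N_0: "N 0 = 0"
    and N_increasing: "\<And>t. t < r \<Longrightarrow> N t < N (Suc t)"
    and basis: "\<And>t. t \<in> {1..r} \<Longrightarrow> is_basis \<rho> \<psi> (N t) (P t)"
    and k_0: "k 0 = 0"
    and k_pos: "\<And>t. t \<in> {1..r} \<Longrightarrow> 0 < k t"
    and k_mono: "\<And>t. t \<in> {1..<r} \<Longrightarrow> k t \<le> k (Suc t)"
    and K_ge_N: "N r \<le> K"
    and qr: "QR_choice \<psi> \<rho> K N r Q R"
    and draw: "method2_draw M \<psi> \<rho> K N k r Q Z J"
    and standing: "AE \<omega> in M. \<forall>i<K. \<forall>t\<in>{1..r}. \<exists>p\<in>P t. p (Z i \<omega>) \<noteq> 0"
    and gamma: "\<gamma> \<in> {0<..<1}"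
    and delta: "\<delta> \<in> {0<..<1}"
    and gammas: "\<And>t. t \<in> {1..r} \<Longrightarrow> \<gamma>s t \<in> {0<..<1}"
    and gammas_sum: "(\<Sum>t = 1..r. \<gamma>s t) = \<gamma>"
    and k_large: "\<And>t. t \<in> {1..r} \<Longrightarrow>
           real (k t) \<ge> ln (4 * real (N t) / \<gamma>s t) * inverse ((1 + \<delta>) * ln (1 + \<delta>) - \<delta>)"
    and K_large: "of_nat K \<ge> (nikolskii (P r) \<rho>)\<^sup>2
           * ennreal (ln (2 * real (N r) / \<gamma>) * inverse ((1 - \<delta>) * ln (1 - \<delta>) + \<delta>))"
  shows "\<exists>E\<in>sets M. measure M E \<ge> 1 - \<gamma> \<and>
    (\<forall>\<omega>\<in>E. \<forall>t\<in>{1..r}.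
       vec_space.rank K (B_mat \<psi> K (N t) (grid K Z \<omega>)) = N t \<and>
       cond2 (A_mat N k (Q (grid K Z \<omega>)) (\<lambda>l m. J l m \<omega>) t) \<le> ereal (sqrt ((1 + \<delta>) / (1 - \<delta>))) \<and>
       (\<forall>f\<in>Linf_fun \<rho>.
          (\<exists>!g. is_output \<psi> K N k (Q (grid K Z \<omega>)) (R (grid K Z \<omega>)) (grid K Z \<omega>)
                  (\<lambda>l m. J l m \<omega>) t f g) \<and>
          (\<forall>g. is_output \<psi> K N k (Q (grid K Z \<omega>)) (R (grid K Z \<omega>)) (grid K Z \<omega>)
                  (\<lambda>l m. J l m \<omega>) t f g \<longrightarrow>
             L2_norm \<rho> (\<lambda>x. f x - g x) \<le>
               (INF p\<in>P t. L2_norm \<rho> (\<lambda>x. f x - p x) + 1 / (1 - \<delta>) *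
                  Max ((\<lambda>i. cmod (f (Z i \<omega>) - p (Z i \<omega>)) /
                     sqrt (real K / real (N t) *
                       (\<Sum>l<N t. samp_prob N (Q (grid K Z \<omega>)) l i))) ` {..<K})))))"
proof -
  interpret method2_setting \<rho> P \<psi> r K N k \<gamma> \<delta> \<gamma>s Q R M Z J
    by (rule method2_setting.intro; fact)
  obtain E where E: "E \<in> sets M" "measure M E \<ge> 1 - \<gamma>"
    "\<And>\<omega>. \<omega> \<in> E \<Longrightarrow> \<omega> \<in> space M \<and> stable \<omega> \<and> (\<forall>a\<in>draws. cond_prob a \<omega> = draw_weight a \<omega>) \<and>
      (\<exists>a\<in>draws. \<omega> \<in> drawn_event a \<and> (\<forall>t\<in>{1..r}. \<omega> \<in> well_drawn t a))"
    using success_event by blast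
  show ?thesis
  proof (intro bexI[OF _ E(1)] conjI E(2) ballI)
    fix \<omega> t assume \<omega>: "\<omega> \<in> E" and t: "t \<in> {1..r}"
    then obtain a where a: "a \<in> draws" "\<omega> \<in> drawn_event a" "\<omega> \<in> well_drawn t a"
      using E(3) by blast
    have sp: "\<omega> \<in> space M" and st: "stable \<omega>" and eq: "\<forall>a\<in>draws. cond_prob a \<omega> = draw_weight a \<omega>"
      using E(3)[OF \<omega>] by blast+
    show "vec_space.rank K (B_mat \<psi> K (N t) (grid K Z \<omega>)) = N t"
      by (rule rank_B[OF st t])
    show "cond2 (A_mat N k (Q (grid K Z \<omega>)) (\<lambda>l m. J l m \<omega>) t) \<le> ereal (sqrt ((1 + \<delta>) / (1 - \<delta>)))"
      by (rule pass_conclusion(1)[OF sp st eq a t])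
    fix f assume f: "f \<in> Linf_fun \<rho>"
    show "\<exists>!g. is_output \<psi> K N k (Q (grid K Z \<omega>)) (R (grid K Z \<omega>)) (grid K Z \<omega>) (\<lambda>l m. J l m \<omega>) t f g"
      by (rule pass_conclusion(2)[OF sp st eq a t f])
    show "\<forall>g. is_output \<psi> K N k (Q (grid K Z \<omega>)) (R (grid K Z \<omega>)) (grid K Z \<omega>)
                  (\<lambda>l m. J l m \<omega>) t f g \<longrightarrow>
             L2_norm \<rho> (\<lambda>x. f x - g x) \<le>
               (INF p\<in>P t. L2_norm \<rho> (\<lambda>x. f x - p x) + 1 / (1 - \<delta>) *
                  Max ((\<lambda>i. cmod (f (Z i \<omega>) - p (Z i \<omega>)) /
                     sqrt (real K / real (N t) *
                       (\<Sum>l<N t. samp_prob N (Q (grid K Z \<omega>)) l i))) ` {..<K}))"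
      using pass_conclusion(3)[OF sp st eq a t f] by blast
  qed
qed

end
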